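(* Let $3\le n\le 10$ and $p>1$, or $n\ge 11$ and $1<p<p_c(n)$, where $p_c(n)=\frac{(n-2)^2-4n+8\sqrt{n-1}}{(n-2)(n-10)}$. Let $\psi\in C^2([0,+\infty))$ be positive on $(0,+\infty)$ with $\psi(0)=\psi''(0)=0$, $\psi'(0)=1$, $\psi'(r)\ge 0$ for every $r>0$, and $l:=\liminf_{r\to+\infty}\frac{\psi'(r)}{\psi(r)}>0$. For any $\alpha\ge 0$ denote by $u_\alpha$ the unique solution of $$-\frac{1}{\psi(r)^{n-1}}\left[\psi(r)^{n-1}u'(r)\right]'=|u(r)|^{p-1}u(r)\quad(r>0),\qquad u(0)=\alpha,\quad u'(0)=0.$$ Then there exists $\alpha_0\in(0,+\infty)$ such that (i) if $\alpha\in[0,\alpha_0]$ then $u_\alpha$ is stable; (ii) if $\alpha>\alpha_0$ then $u_\alpha$ is unstable. Furthermore $\alpha_0\ge\left(p^{-1}\lambda_1(M)\right)^{1/(p-1)}$, and the inequality is strict if one of the following alternatives holds: (a) $\limsup_{r\to+\infty}\frac{\psi'(r)}{\psi(r)}<+\infty$; (b) $l=+\infty$, $\left[\log\left(\frac{\psi'(r)}{\psi(r)}\right)\right]'=O(1)$ as $r\to+\infty$, and $\frac{\psi}{\psi'}\notin L^1(r_0,\infty)$, where $r_0\ge 0$ is any number such that $\psi'>0$ on $[r_0,+\infty)$.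
   Context: $(M,g)$ is the $n$-dimensional Riemannian model with pole $o$ and metric $ds^2=dr^2+\psi(r)^2d\Theta^2$ in polar coordinates $(r,\Theta)\in(0,\infty)\times\mathbb{S}^{n-1}$ around $o$ ($M$ is diffeomorphic to $\mathbb{R}^n$); $V_g$ and $\nabla_g$ are the Riemannian measure and gradient. The function $u_\alpha$ is viewed as a radial function on $M$ ($r$ = distance from $o$); it is globally defined and is a radial solution of $-\Delta_g u=|u|^{p-1}u$ on $M$. A solution $u\in C^2(M)$ of this equation is stable if $\int_M|\nabla_g\varphi|_g^2\,dV_g-p\int_M|u|^{p-1}\varphi^2\,dV_g\ge 0$ for all $\varphi\in C_c^\infty(M)$, and unstable otherwise. $\lambda_1(M):=\inf_{\varphi\in C_c^\infty(M)\setminus\{0\}}\frac{\int_M|\nabla_g\varphi|_g^2\,dV_g}{\int_M\varphi^2\,dV_g}$ is the bottom of the $L^2$ spectrum of $-\Delta_g$. *)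

theory Defs
  imports "HOL-Analysis.Analysis" "HOL-Library.Landau_Symbols"
begin

text \<open>
  A Riemannian metric on the manifold \<open>\<real>\<^sup>n\<close> is given in the global Cartesian chart:
  \<open>g x v w\<close> is the inner product of the tangent vectors \<open>v\<close>, \<open>w\<close> at \<open>x\<close>.
\<close>

type_synonym 'n metric = "real ^ 'n \<Rightarrow> real ^ 'n \<Rightarrow> real ^ 'n \<Rightarrow> real"

text \<open>
  The metric \<open>dr\<^sup>2 + \<psi>(r)\<^sup>2 d\<Theta>\<^sup>2\<close> with pole \<open>0\<close>, where \<open>x = r \<Theta>\<close>. A tangent vector \<open>v\<close> at
  \<open>x \<noteq> 0\<close> has \<open>dr(v) = v \<bullet> sgn x\<close>, and \<open>d\<Theta>(v)\<close> is its part orthogonal to \<open>x\<close> divided by \<open>r\<close>.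
  At the pole the metric extends by the Euclidean one, since \<open>\<psi>(r) / r\<close> tends to \<open>\<psi>'(0) = 1\<close>.
  The geodesic distance from the pole is \<open>norm x\<close>.
\<close>

definition sphere_part :: "real ^ 'n \<Rightarrow> real ^ 'n \<Rightarrow> real ^ 'n" where
  "sphere_part x v = (v - (v \<bullet> sgn x) *\<^sub>R sgn x) /\<^sub>R norm x"

definition model_metric :: "(real \<Rightarrow> real) \<Rightarrow> 'n::finite metric" where
  "model_metric \<psi> x v w =
     (if x = 0 then v \<bullet> w
      else (v \<bullet> sgn x) * (w \<bullet> sgn x)
           + (\<psi> (norm x))\<^sup>2 * (sphere_part x v \<bullet> sphere_part x w))"

definition volume_measure :: "'n::finite metric \<Rightarrow> (real ^ 'n) measure" where
  "volume_measure g =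
     density lborel (\<lambda>x. ennreal (sqrt (det (\<chi> i j. g x (axis i 1) (axis j 1)))))"

definition riemannian_gradient :: "'n::finite metric \<Rightarrow> (real ^ 'n \<Rightarrow> real) \<Rightarrow> real ^ 'n \<Rightarrow> real ^ 'n" where
  "riemannian_gradient g \<phi> x = (THE v. \<forall>w. g x v w = frechet_derivative \<phi> (at x) w)"

primrec C_k :: "nat \<Rightarrow> (real ^ 'n::finite \<Rightarrow> real) \<Rightarrow> bool" where
  "C_k 0 f \<longleftrightarrow> continuous_on UNIV f"
| "C_k (Suc k) f \<longleftrightarrow>
     (\<forall>x. f differentiable (at x)) \<and>
     (\<forall>i. C_k k (\<lambda>x. frechet_derivative f (at x) (axis i 1)))"

definition test_functions :: "(real ^ 'n::finite \<Rightarrow> real) set" where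
  "test_functions = {\<phi>. (\<forall>k. C_k k \<phi>) \<and> compact (closure {x. \<phi> x \<noteq> 0})}"

definition dirichlet_energy :: "'n::finite metric \<Rightarrow> (real ^ 'n \<Rightarrow> real) \<Rightarrow> real" where
  "dirichlet_energy g \<phi> =
     (LINT x|volume_measure g. g x (riemannian_gradient g \<phi> x) (riemannian_gradient g \<phi> x))"

definition bottom_spectrum :: "'n::finite metric \<Rightarrow> real" where
  "bottom_spectrum g =
     (INF \<phi> \<in> test_functions - {\<lambda>x. 0}.
        dirichlet_energy g \<phi> / (LINT x|volume_measure g. (\<phi> x)\<^sup>2))"

text \<open>
  Stability of a solution \<open>u\<close> of \<open>-\<Delta>\<^sub>g u = \<bar>u\<bar>\<^sup>p\<^sup>-\<^sup>1 u\<close>. The predicate is only meaningful for, and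
  only applied to, solutions; a solution is unstable iff it is not stable.
\<close>

definition is_stable :: "'n::finite metric \<Rightarrow> real \<Rightarrow> (real ^ 'n \<Rightarrow> real) \<Rightarrow> bool" where
  "is_stable g p u \<longleftrightarrow>
     (\<forall>\<phi> \<in> test_functions.
        dirichlet_energy g \<phi>
          - p * (LINT x|volume_measure g. \<bar>u x\<bar> powr (p - 1) * (\<phi> x)\<^sup>2) \<ge> 0)"

text \<open>
  The radial initial value problem on \<open>[0,\<infinity>)\<close>; the derivative at \<open>0\<close> is one-sided, and the values
  of \<open>u\<close> on the negative half-line are irrelevant.
\<close>

definition radial_solution ::
  "(real \<Rightarrow> real) \<Rightarrow> nat \<Rightarrow> real \<Rightarrow> real \<Rightarrow> (real \<Rightarrow> real) \<Rightarrow> bool" where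
  "radial_solution \<psi> n p \<alpha> u \<longleftrightarrow>
     (\<exists>u'. (\<forall>r\<ge>0. (u has_real_derivative u' r) (at r within {0..})) \<and>
           u 0 = \<alpha> \<and> u' 0 = 0 \<and>
           (\<forall>r>0. \<exists>D. ((\<lambda>s. \<psi> s ^ (n - 1) * u' s) has_real_derivative D) (at r) \<and>
                      - (1 / \<psi> r ^ (n - 1)) * D = \<bar>u r\<bar> powr (p - 1) * u r))"

definition joseph_lundgren_exponent :: "nat \<Rightarrow> real" where
  "joseph_lundgren_exponent n =
     ((real n - 2)\<^sup>2 - 4 * real n + 8 * sqrt (real n - 1)) / ((real n - 2) * (real n - 10))"

end

theory Submission
  imports Defs
begin

text \<open>
  Write \<open>w = \<psi>\<^sup>n\<^sup>-\<^sup>1\<close> for the radial weight, \<open>V(r)\<close> for the integral of \<open>w\<close> over \<open>[0,r]\<close>, and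
  \<open>Q\<^sub>\<alpha> = p \<bar>u\<^sub>\<alpha>\<bar>\<^sup>p\<^sup>-\<^sup>1\<close>. Stability of \<open>u\<^sub>\<alpha>\<close> says that the quadratic form of the potential \<open>Q\<^sub>\<alpha>\<close> lies
  below the Dirichlet energy; potentials with this property are called form bounded. They are
  closed under passing to smaller potentials, convex combinations and locally uniform limits.

  The set of stable \<open>\<alpha>\<close> is an interval. If \<open>0 < \<alpha> < \<beta>\<close>, \<open>u\<^sub>\<beta>\<close> is stable and \<open>0 < u\<^sub>\<alpha> < u\<^sub>\<beta>\<close> first fails
  at \<open>R\<close>, then \<open>u\<^sub>\<alpha>\<close> or \<open>u\<^sub>\<beta> - u\<^sub>\<alpha>\<close> vanishes at \<open>R\<close>; used as a test function on the ball of radius \<open>R\<close> it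
  contradicts the stability of \<open>u\<^sub>\<beta>\<close>, by strict convexity of the power (\<open>stable_solutions_ordered\<close>).
  So \<open>Q\<^sub>\<alpha> \<le> Q\<^sub>\<beta>\<close> and \<open>u\<^sub>\<alpha>\<close> is stable. The interval is closed because \<open>Q\<^sub>\<alpha>\<close> depends on \<open>\<alpha>\<close> continuously,
  locally uniformly in \<open>r\<close>.

  It is bounded (\<open>stable_solutions_bounded\<close>). If every \<open>u\<^sub>\<alpha>\<close> were stable, Farina's argument, which
  tests the equation with \<open>u\<^sup>\<gamma> \<eta>\<^sup>2\<close> and the stability inequality with \<open>u\<^sup>(\<^sup>\<gamma>\<^sup>+\<^sup>1\<^sup>)\<^sup>/\<^sup>2 \<eta>\<close>, would bound the
  integral of \<open>u\<^sub>\<alpha>\<^sup>p\<^sup>+\<^sup>\<gamma>\<close> over the unit ball independently of \<open>\<alpha>\<close>. But \<open>u\<^sub>\<alpha> \<ge> \<alpha>/2\<close> on a ball of radius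
  comparable with \<open>\<alpha>\<^sup>-\<^sup>(\<^sup>p\<^sup>-\<^sup>1\<^sup>)\<^sup>/\<^sup>2\<close>, so that integral is at least a constant times \<open>\<alpha>\<close> to the power
  \<open>p + \<gamma> - n (p - 1) / 2\<close>. The assumption on \<open>p\<close> and \<open>n\<close> says exactly that some admissible \<open>\<gamma>\<close> makes
  this power positive (\<open>Joseph_Lundgren_exponent_choice\<close>).

  The lower bound on the threshold rests on one inequality. The radial field \<open>(V/w) \<partial>\<^sub>r\<close> has divergence
  one, hence the Dirichlet energy dominates the potential \<open>c - c\<^sup>2 (V/w)\<^sup>2\<close> for every constant \<open>c\<close>
  (\<open>dirichlet_energy_Hardy\<close>). Since \<open>l > 0\<close>, the quotient \<open>V/w\<close> is bounded, and a small \<open>c\<close> gives a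
  positive lower bound for the spectrum. Let \<open>\<lambda>\<close> be positive and form bounded as a constant potential,
  and let \<open>p a\<^sup>p\<^sup>-\<^sup>1 = \<lambda>\<close>. The energy \<open>u'\<^sup>2/2 + \<bar>u\<bar>\<^sup>p\<^sup>+\<^sup>1/(p+1)\<close> decreases along solutions and does so strictly
  near the pole. Hence, for \<open>\<alpha>\<close> slightly above \<open>a\<close>, \<open>Q\<^sub>\<alpha>\<close> exceeds \<open>\<lambda>\<close> only by a small amount on a small
  ball and stays below \<open>\<lambda>\<close> by a fixed amount outside it. A convex combination of the constant \<open>\<lambda>\<close>
  with the potential above for a large \<open>c\<close>, which is greater than \<open>\<lambda>\<close> near the pole, dominates such a
  \<open>Q\<^sub>\<alpha>\<close> (\<open>stable_above_spectral_threshold\<close>). So some \<open>\<alpha> > a\<close> is stable.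

  All test functions that detect instability are radial. A \<open>C\<^sup>1\<close> profile is replaced by a smooth one in
  \<open>radial_instability\<close>. The formulas for the metric in Cartesian coordinates and the distribution of the
  norm under Lebesgue measure turn integrals over the manifold into integrals over \<open>[0,R]\<close> with weight \<open>w\<close>.
\<close>

section \<open>Signed powers\<close>

definition signed_power :: "real \<Rightarrow> real \<Rightarrow> real" where
  "signed_power p x = \<bar>x\<bar> powr (p - 1) * x"

lemma signed_power_nonneg_eq:
  assumes "x \<ge> 0" "p > 1" shows "signed_power p x = x powr p"
proof (cases "x = 0")
  case False
  then have "x > 0" using assms by simp
  then have "x powr (p - 1) * x = x powr (p - 1) * x powr 1" by simp
  also have "\<dots> = x powr p" by (subst powr_add [symmetric]) simp
  finally show ?thesis using \<open>x > 0\<close> by (simp add: signed_power_def)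
qed (simp add: signed_power_def)

lemma signed_power_abs: "\<bar>signed_power p x\<bar> = \<bar>x\<bar> powr (p - 1) * \<bar>x\<bar>"
  by (simp add: signed_power_def abs_mult)

text \<open>
  The powers used below are differentiable at \<open>0\<close> because they vanish there faster than linearly.
\<close>
lemma DERIV_abs_powr_zero:
  fixes q :: real
  assumes "q > 0" "\<And>h. \<bar>g h\<bar> \<le> \<bar>h\<bar> powr q * \<bar>h\<bar>"
  shows "(g has_real_derivative 0) (at 0)"
proof -
  have g0: "g 0 = 0" using assms(2)[of 0] by simp
  have "((\<lambda>h::real. \<bar>h\<bar> powr q) \<longlongrightarrow> 0) (at 0)"
  proof -
    have "((\<lambda>h::real. \<bar>h\<bar> powr q) \<longlongrightarrow> \<bar>0\<bar> powr q) (at 0)"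
      by (rule tendsto_powr2) (use assms(1) in \<open>auto intro!: tendsto_eq_intros\<close>)
    then show ?thesis using assms(1) by simp
  qed
  then have "((\<lambda>h. (g (0 + h) - g 0) / h) \<longlongrightarrow> 0) (at 0)"
  proof (rule Lim_null_comparison[rotated])
    show "\<forall>\<^sub>F h in at 0. norm ((g (0 + h) - g 0) / h) \<le> \<bar>h\<bar> powr q"
      using assms(2) by (auto simp: eventually_at_filter g0 abs_divide divide_simps)
  qed
  then show ?thesis by (simp add: DERIV_def)
qed

lemma abs_real_DERIV:
  assumes "x \<noteq> 0" shows "(abs has_real_derivative sgn x) (at (x::real))"
proof (rule has_field_derivative_transform_within_open)
  show "((\<lambda>y. sgn x * y) has_real_derivative sgn x) (at x)" by (auto intro!: derivative_eq_intros)
  show "open (if x > 0 then {0<..} else {..<0::real})" by auto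
qed (use assms in \<open>auto split: if_splits\<close>)

lemma signed_power_DERIV:
  assumes "p > 1"
  shows "(signed_power p has_real_derivative p * \<bar>x\<bar> powr (p - 1)) (at x)"
proof (cases "x = 0")
  case True
  have "(signed_power p has_real_derivative 0) (at 0)"
    by (rule DERIV_abs_powr_zero[of "p - 1"]) (use assms in \<open>auto simp: signed_power_abs\<close>)
  then show ?thesis using True assms by simp
next
  case False
  have abs_d: "(abs has_real_derivative sgn x) (at x)"
    using False by (rule abs_real_DERIV)
  have "((\<lambda>x. \<bar>x\<bar> powr (p - 1) * x) has_real_derivative
      ((p - 1) * \<bar>x\<bar> powr (p - 1 - 1) * sgn x) * x + \<bar>x\<bar> powr (p - 1)) (at x)"
    using False by (auto intro!: derivative_eq_intros abs_d simp: field_simps)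
  moreover have "((p - 1) * \<bar>x\<bar> powr (p - 1 - 1) * sgn x) * x = (p - 1) * \<bar>x\<bar> powr (p - 1)"
  proof -
    have "sgn x * x = \<bar>x\<bar> powr 1" using abs_sgn[of x] by (metis abs_ge_zero mult.commute powr_one)
    then have "((p - 1) * \<bar>x\<bar> powr (p - 1 - 1) * sgn x) * x = (p - 1) * (\<bar>x\<bar> powr (p - 1 - 1) * \<bar>x\<bar> powr 1)"
      by (simp only: mult.assoc)
    also have "\<dots> = (p - 1) * \<bar>x\<bar> powr (p - 1)" by (subst powr_add [symmetric]) simp
    finally show ?thesis .
  qed
  ultimately show ?thesis
    unfolding signed_power_def by (simp add: algebra_simps)
qed

lemma continuous_signed_power: "p > 1 \<Longrightarrow> continuous_on A (signed_power p)"
  by (meson signed_power_DERIV DERIV_isCont continuous_at_imp_continuous_on)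

lemma signed_power_Lipschitz:
  assumes "p > 1" "\<bar>x\<bar> \<le> A" "\<bar>y\<bar> \<le> A"
  shows "\<bar>signed_power p x - signed_power p y\<bar> \<le> p * A powr (p - 1) * \<bar>x - y\<bar>"
proof -
  have "norm (signed_power p x - signed_power p y) \<le> p * A powr (p - 1) * norm (x - y)"
  proof (rule field_differentiable_bound[of "{-A..A}" "signed_power p" "\<lambda>x. p * \<bar>x\<bar> powr (p - 1)"])
    fix z assume "z \<in> {-A..A}"
    then show "norm (p * \<bar>z\<bar> powr (p - 1)) \<le> p * A powr (p - 1)"
      using assms by (auto simp: abs_mult intro!: mult_left_mono powr_mono2)
  qed (use assms in \<open>auto intro: DERIV_subset[OF signed_power_DERIV]\<close>)
  then show ?thesis by simp
qed

text \<open>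
  Strict convexity of the power on \<open>[0,\<infinity>)\<close>; it makes differences of ordered solutions strict
  subsolutions of the linearised equation.
\<close>
lemma signed_power_tangent_less:
  assumes "p > 1" "0 \<le> a" "a < b"
  shows "signed_power p b - signed_power p a < p * \<bar>b\<bar> powr (p - 1) * (b - a)"
proof -
  obtain z where z: "a < z" "z < b"
    and eq: "signed_power p b - signed_power p a = (b - a) * (p * \<bar>z\<bar> powr (p - 1))"
    using MVT2[OF assms(3), of "signed_power p" "\<lambda>x. p * \<bar>x\<bar> powr (p - 1)"] signed_power_DERIV[OF assms(1)]
    by auto
  have "\<bar>z\<bar> powr (p - 1) < \<bar>b\<bar> powr (p - 1)"
    using z assms by (auto intro!: powr_less_mono2)
  then have "(b - a) * (p * \<bar>z\<bar> powr (p - 1)) < (b - a) * (p * \<bar>b\<bar> powr (p - 1))"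
    using assms by (intro mult_strict_left_mono) auto
  then show ?thesis using eq by (simp add: mult_ac)
qed

lemma abs_powr_DERIV:
  assumes "p > 1"
  shows "((\<lambda>x. \<bar>x\<bar> powr (p + 1) / (p + 1)) has_real_derivative signed_power p x) (at x)"
proof (cases "x = 0")
  case True
  have "((\<lambda>x. \<bar>x\<bar> powr (p + 1) / (p + 1)) has_real_derivative 0) (at 0)"
  proof (rule DERIV_abs_powr_zero[of p])
    fix h :: real
    have "\<bar>h\<bar> powr (p + 1) = \<bar>h\<bar> powr p * \<bar>h\<bar>" by (cases "h = 0") (auto simp: powr_add)
    then show "\<bar>\<bar>h\<bar> powr (p + 1) / (p + 1)\<bar> \<le> \<bar>h\<bar> powr p * \<bar>h\<bar>"
      using assms mult_nonneg_nonneg[of "\<bar>h\<bar> powr p" "\<bar>h\<bar>"]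
      by (simp add: abs_mult divide_le_eq mult_le_cancel_left1 not_less)
  qed (use assms in auto)
  then show ?thesis using True by (simp add: signed_power_def)
next
  case False
  have abs_d: "(abs has_real_derivative sgn x) (at x)"
    using False by (rule abs_real_DERIV)
  have "((\<lambda>x. \<bar>x\<bar> powr (p + 1)) has_real_derivative (p + 1) * (\<bar>x\<bar> powr p * sgn x)) (at x)"
    using False assms by (auto intro!: derivative_eq_intros abs_d)
  from DERIV_cdivide[OF this, of "p + 1"]
  have "((\<lambda>x. \<bar>x\<bar> powr (p + 1) / (p + 1)) has_real_derivative \<bar>x\<bar> powr p * sgn x) (at x)"
    using assms by simp
  moreover have "\<bar>x\<bar> powr p * sgn x = signed_power p x"
  proof -
    have "\<bar>x\<bar> powr p = \<bar>x\<bar> powr (p - 1) * \<bar>x\<bar>"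
      using False powr_add[of "\<bar>x\<bar>" "p - 1" 1] by simp
    then show ?thesis by (simp add: signed_power_def mult.assoc abs_mult_sgn)
  qed
  ultimately show ?thesis by simp
qed

section \<open>The radial weight\<close>

lemma at_within_atLeast: "(r::real) > a \<Longrightarrow> at r within {a..} = at r"
  by (rule at_within_interior) auto

lemma integral_FTC_atLeast:
  fixes k :: "real \<Rightarrow> real"
  assumes "continuous_on {0..} k" "r \<ge> 0"
  shows "((\<lambda>r. integral {0..r} k) has_real_derivative k r) (at r within {0..})"
proof -
  have "((\<lambda>r. integral {0..r} k) has_real_derivative k r) (at r within {0..r+1})"
    unfolding has_real_derivative_iff_has_vector_derivative
    by (rule integral_has_vector_derivative) (use assms in \<open>auto intro: continuous_on_subset[OF assms(1)]\<close>)
  moreover have "at r within {0..r+1} = at r within {0..}"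
    by (rule at_within_nhd[of _ "{..<r+1}"]) auto
  ultimately show ?thesis by simp
qed

text \<open>
  The last assumption, exponential growth of \<open>\<psi>\<close> at infinity, is the form in which a positive lower
  limit of \<open>\<psi>'/\<psi>\<close> is used.
\<close>
locale radial_weight =
  fixes \<psi> \<psi>' :: "real \<Rightarrow> real" and n :: nat
  assumes n3: "3 \<le> n"
    and \<psi>_deriv: "\<And>r. r \<ge> 0 \<Longrightarrow> (\<psi> has_real_derivative \<psi>' r) (at r within {0..})"
    and \<psi>'_cont: "continuous_on {0..} \<psi>'"
    and \<psi>_pos: "\<And>r. r > 0 \<Longrightarrow> \<psi> r > 0"
    and \<psi>_0: "\<psi> 0 = 0" "\<psi>' 0 = 1"
    and \<psi>'_nonneg: "\<And>r. r \<ge> 0 \<Longrightarrow> \<psi>' r \<ge> 0"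
    and growth: "\<exists>c>0. \<exists>R. \<forall>r\<ge>R. c * \<psi> r \<le> \<psi>' r"
begin

definition w :: "real \<Rightarrow> real" where "w r = \<psi> r ^ (n - 1)"
definition w' :: "real \<Rightarrow> real" where "w' r = real (n - 1) * \<psi> r ^ (n - 2) * \<psi>' r"
definition V :: "real \<Rightarrow> real" where "V r = integral {0..r} w"

lemma \<psi>_cont: "continuous_on {0..} \<psi>"
  using \<psi>_deriv by (auto intro!: DERIV_continuous_on)

lemma w_cont: "continuous_on {0..} w"
  unfolding w_def [abs_def] by (intro continuous_intros \<psi>_cont)

lemma w_0 [simp]: "w 0 = 0" using n3 by (simp add: w_def \<psi>_0)

lemma w_pos: "r > 0 \<Longrightarrow> w r > 0" by (simp add: w_def \<psi>_pos)

lemma w_nonneg: "r \<ge> 0 \<Longrightarrow> w r \<ge> 0"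
  using w_pos[of r] by (cases "r = 0") auto

lemma w_deriv: "r > 0 \<Longrightarrow> (w has_real_derivative w' r) (at r)"
  unfolding w_def [abs_def] w'_def
  using \<psi>_deriv[of r] n3
  by (auto intro!: derivative_eq_intros simp: at_within_atLeast numeral_2_eq_2 diff_Suc_Suc algebra_simps)

lemma w'_nonneg: "r > 0 \<Longrightarrow> w' r \<ge> 0"
  using \<psi>_pos[of r] \<psi>'_nonneg[of r] by (simp add: w'_def)

lemma w_mono: assumes "0 \<le> r" "r \<le> s" shows "w r \<le> w s"
proof (cases "r = 0")
  case False
  then show ?thesis
    using DERIV_nonneg_imp_nondecreasing[of r s w] w_deriv w'_nonneg assms
    by (metis less_eq_real_def order_less_le_trans)
qed (use assms w_nonneg in auto)

lemma w_integrable: "a \<ge> 0 \<Longrightarrow> w integrable_on {a..b}"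
  by (rule integrable_continuous_real) (auto intro: continuous_on_subset[OF w_cont])

lemma V_0 [simp]: "V 0 = 0" by (simp add: V_def)

lemma V_deriv: "r \<ge> 0 \<Longrightarrow> (V has_real_derivative w r) (at r within {0..})"
  unfolding V_def [abs_def] by (rule integral_FTC_atLeast[OF w_cont])

lemma V_cont: "continuous_on {0..} V"
  using V_deriv by (auto intro!: DERIV_continuous_on)

lemma V_nonneg: "r \<ge> 0 \<Longrightarrow> V r \<ge> 0"
  unfolding V_def by (rule integral_nonneg) (auto intro: w_integrable w_nonneg)

lemma V_pos: assumes "r > 0" shows "V r > 0"
proof -
  have "integral {0..r} (\<lambda>_. 0) < integral {0..r} w"
    by (rule integral_less_real) (use assms in \<open>auto intro: continuous_on_subset[OF w_cont] w_pos\<close>)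
  then show ?thesis by (simp add: V_def)
qed

lemma V_le: assumes "r \<ge> 0" shows "V r \<le> r * w r"
proof -
  have "V r \<le> integral {0..r} (\<lambda>_. w r)"
    unfolding V_def by (rule integral_le) (use assms in \<open>auto intro: w_integrable w_mono\<close>)
  then show ?thesis using assms by simp
qed

text \<open>
  A linear isoperimetric inequality for balls. Where \<open>w' \<ge> c w\<close> the difference \<open>C w - V\<close> is
  nondecreasing as soon as \<open>C c \<ge> 1\<close>; on the remaining compact interval \<open>V(r) \<le> r w(r)\<close> suffices.
\<close>
lemma V_le_w: obtains C where "C > 0" "\<And>r. r \<ge> 0 \<Longrightarrow> V r \<le> C * w r"
proof -
  obtain c R0 where c: "c > 0" and R0: "\<And>r. r \<ge> R0 \<Longrightarrow> c * \<psi> r \<le> \<psi>' r"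
    using growth by auto
  define R where "R = max R0 1"
  define C where "C = max R (1 / c)"
  have R: "R \<ge> 1" "\<And>r. r \<ge> R \<Longrightarrow> c * \<psi> r \<le> \<psi>' r" using R0 by (auto simp: R_def)
  have C: "C \<ge> R" "C * c \<ge> 1" "C > 0"
    using c R(1) by (auto simp: C_def max_def field_simps)
  have "V r \<le> C * w r" if r: "r \<ge> 0" for r
  proof (cases "r \<le> R")
    case True
    then show ?thesis using V_le[OF r] C w_nonneg[OF r] by (meson mult_right_mono order_trans)
  next
    case False
    then have rR: "R < r" by simp
    have "C * w R - V R \<le> C * w r - V r"
    proof (rule DERIV_nonneg_imp_nondecreasing[where f = "\<lambda>x. C * w x - V x"])
      fix x assume x: "R \<le> x" "x \<le> r"
      then have x0: "x > 0" using R by simp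
      have d: "((\<lambda>x. C * w x - V x) has_real_derivative C * w' x - w x) (at x)"
        using w_deriv[OF x0] V_deriv[of x] x0
        by (auto intro!: derivative_eq_intros simp: at_within_atLeast)
      have "w x = \<psi> x * \<psi> x ^ (n - 2)"
        using n3 by (simp add: w_def flip: power_Suc) (simp add: Suc_diff_Suc numeral_2_eq_2)
      also have "\<dots> \<le> (C * c * \<psi> x) * \<psi> x ^ (n - 2)"
        using C(2) \<psi>_pos[OF x0] by (auto intro!: mult_right_mono)
      also have "\<dots> \<le> C * \<psi>' x * \<psi> x ^ (n - 2)"
        using C(3) R(2)[OF x(1)] \<psi>_pos[OF x0] by (auto intro!: mult_right_mono)
      also have "\<dots> = C * (1 * (\<psi> x ^ (n - 2) * \<psi>' x))" by simp
      also have "\<dots> \<le> C * (real (n - 1) * (\<psi> x ^ (n - 2) * \<psi>' x))"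
        using C(3) \<psi>'_nonneg[of x] \<psi>_pos[OF x0] n3 x0
        by (intro mult_left_mono mult_right_mono) auto
      finally show "\<exists>y. ((\<lambda>x. C * w x - V x) has_real_derivative y) (at x) \<and> 0 \<le> y"
        using d by (auto simp: w'_def mult_ac)
    qed (use rR in auto)
    moreover have "V R \<le> C * w R"
      using V_le[of R] R C w_nonneg[of R] by (smt (verit) mult_right_mono)
    ultimately show ?thesis by simp
  qed
  then show ?thesis using that C(3) by blast
qed

lemma \<psi>_quotient_tendsto: "((\<lambda>r. \<psi> r / r) \<longlongrightarrow> 1) (at 0 within {0..})"
  using \<psi>_deriv[of 0] \<psi>_0 by (simp add: has_field_derivative_iff)

text \<open>
  Near the pole the weight is comparable with the Euclidean weight, since \<open>\<psi>(r)/r\<close> tends to \<open>1\<close>.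
\<close>
lemma w_lower: obtains r0 where "r0 > 0" "\<And>r. 0 \<le> r \<Longrightarrow> r \<le> r0 \<Longrightarrow> (r / 2) ^ (n - 1) \<le> w r"
proof -
  have "\<forall>\<^sub>F r in at 0 within {0..}. \<psi> r / r > 1/2"
    by (rule order_tendstoD(1)[OF \<psi>_quotient_tendsto]) simp
  then obtain d where d: "d > 0" "\<And>r. r \<in> {0..} \<Longrightarrow> r \<noteq> 0 \<Longrightarrow> dist r 0 < d \<Longrightarrow> \<psi> r / r > 1/2"
    unfolding eventually_at by auto
  have "(r / 2) ^ (n - 1) \<le> w r" if "0 \<le> r" "r \<le> d / 2" for r
  proof (cases "r = 0")
    case False
    then have "\<psi> r / r > 1/2" using d that by (auto simp: dist_real_def)
    then have "r / 2 \<le> \<psi> r" using False that by (simp add: field_simps)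
    then show ?thesis unfolding w_def using that by (intro power_mono) auto
  qed (use n3 in \<open>auto simp: power_0_left\<close>)
  then show ?thesis using that[of "d/2"] d(1) by auto
qed

section \<open>The radial initial value problem\<close>

text \<open>
  The initial value problem with the derivative as an explicit argument. The equation is kept in flux
  form: divided by \<open>w\<close> it would contain a coefficient that is singular at the pole.
\<close>
definition sol :: "real \<Rightarrow> real \<Rightarrow> (real \<Rightarrow> real) \<Rightarrow> (real \<Rightarrow> real) \<Rightarrow> bool" where
  "sol p \<alpha> u u' \<longleftrightarrow> p > 1 \<and>
     (\<forall>r\<ge>0. (u has_real_derivative u' r) (at r within {0..})) \<and> u 0 = \<alpha> \<and> u' 0 = 0 \<and>
     (\<forall>r>0. ((\<lambda>s. w s * u' s) has_real_derivative - (w r * signed_power p (u r))) (at r))"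

lemma radial_solution_imp_sol:
  assumes "radial_solution \<psi> n p \<alpha> u" "p > 1"
  obtains u' where "sol p \<alpha> u u'"
proof -
  obtain u' where u': "\<forall>r\<ge>0. (u has_real_derivative u' r) (at r within {0..})" "u 0 = \<alpha>" "u' 0 = 0"
    and D: "\<And>r. r > 0 \<Longrightarrow> \<exists>D. ((\<lambda>s. \<psi> s ^ (n - 1) * u' s) has_real_derivative D) (at r) \<and>
                      - (1 / \<psi> r ^ (n - 1)) * D = \<bar>u r\<bar> powr (p - 1) * u r"
    using assms(1) unfolding radial_solution_def by blast
  have "((\<lambda>s. w s * u' s) has_real_derivative - (w r * signed_power p (u r))) (at r)" if r: "r > 0" for r
  proof -
    obtain D where D: "((\<lambda>s. w s * u' s) has_real_derivative D) (at r)"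
      and eq: "- (1 / w r) * D = signed_power p (u r)"
      using D[OF r] by (auto simp: w_def signed_power_def)
    have "D = - (w r * signed_power p (u r))"
      using w_pos[OF r] by (simp flip: eq)
    then show ?thesis using D by simp
  qed
  then show ?thesis using that[of u'] u' assms(2) by (auto simp: sol_def)
qed

lemma sol_p: "sol p \<alpha> u u' \<Longrightarrow> p > 1" by (simp add: sol_def)

lemma sol_deriv: "sol p \<alpha> u u' \<Longrightarrow> r \<ge> 0 \<Longrightarrow> (u has_real_derivative u' r) (at r within {0..})"
  by (simp add: sol_def)

lemma sol_DERIV: "sol p \<alpha> u u' \<Longrightarrow> r > 0 \<Longrightarrow> (u has_real_derivative u' r) (at r)"
  using sol_deriv[of p \<alpha> u u' r] by (simp add: at_within_atLeast)

lemma sol_cont: "sol p \<alpha> u u' \<Longrightarrow> continuous_on {0..} u"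
  using sol_deriv by (auto intro!: DERIV_continuous_on)

lemma sol_signed_power_cont: "sol p \<alpha> u u' \<Longrightarrow> continuous_on {0..} (\<lambda>r. signed_power p (u r))"
  by (rule continuous_on_compose2[OF continuous_signed_power[of p UNIV] sol_cont]) (auto simp: sol_p)

lemma DERIV_square:
  "(f has_real_derivative D) (at x) \<Longrightarrow> ((\<lambda>x. (f x)\<^sup>2) has_real_derivative 2 * f x * D) (at x)"
  by (auto intro!: derivative_eq_intros)

text \<open>
  Away from the pole the flux differs from the right-hand side by a constant. The constant is zero: the
  difference quotients of \<open>u\<close> at \<open>0\<close> tend to \<open>u'(0) = 0\<close>, so the mean value theorem gives points
  arbitrarily close to the pole where \<open>u'\<close>, and with it the flux, is small.
\<close>
lemma sol_flux:
  assumes s: "sol p \<alpha> u u'" and r: "r \<ge> 0"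
  shows "w r * u' r = - integral {0..r} (\<lambda>s. w s * signed_power p (u s))"
proof -
  define k where "k = (\<lambda>s. w s * signed_power p (u s))"
  define K where "K = (\<lambda>r. integral {0..r} k)"
  have kc: "continuous_on {0..} k"
    unfolding k_def by (intro continuous_intros w_cont sol_signed_power_cont[OF s])
  have Kd: "(K has_real_derivative k r) (at r within {0..})" if "r \<ge> 0" for r
    unfolding K_def by (rule integral_FTC_atLeast[OF kc that])
  have d0: "((\<lambda>r. w r * u' r + K r) has_real_derivative 0) (at r)" if "r > 0" for r
  proof -
    have "((\<lambda>r. w r * u' r) has_real_derivative - k r) (at r)"
      using s that by (simp add: sol_def k_def)
    moreover have "(K has_real_derivative k r) (at r)"
      using Kd[of r] that by (simp add: at_within_atLeast)
    ultimately show ?thesis using DERIV_add by fastforce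
  qed
  have const: "w r * u' r + K r = w 1 * u' 1 + K 1" if "r > 0" for r
  proof -
    have "(\<lambda>r. w r * u' r + K r) constant_on {0<..}"
      by (rule has_field_derivative_0_imp_constant_on) (use d0 in auto)
    then show ?thesis using that by (force simp: constant_on_def)
  qed
  define c where "c = w 1 * u' 1 + K 1"
  have "c = 0"
  proof (rule ccontr)
    assume c: "c \<noteq> 0"
    define e where "e = \<bar>c\<bar> / (4 * (w 1 + 1))"
    have e: "e > 0" "e * w 1 \<le> \<bar>c\<bar> / 4"
      using c w_pos[of 1] by (auto simp: e_def field_simps)
    have "((\<lambda>r. (u r - u 0) / (r - 0)) \<longlongrightarrow> u' 0) (at 0 within {0..})"
      using sol_deriv[OF s, of 0] by (simp add: has_field_derivative_iff)
    then have "\<forall>\<^sub>F r in at 0 within {0..}. dist ((u r - u 0) / (r - 0)) (u' 0) < e"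
      using e(1) by (rule tendstoD)
    moreover have "\<forall>\<^sub>F r in at 0 within {0..}. dist (K r) (K 0) < \<bar>c\<bar> / 4"
    proof (rule tendstoD)
      show "(K \<longlongrightarrow> K 0) (at 0 within {0..})"
        using DERIV_continuous[OF Kd[of 0]] by (simp add: continuous_within)
    qed (use c in simp)
    ultimately have "\<forall>\<^sub>F r in at 0 within {0..}. \<bar>(u r - u 0) / r\<bar> < e \<and> \<bar>K r\<bar> < \<bar>c\<bar> / 4"
    proof eventually_elim
      case (elim r)
      have "u' 0 = 0" "K 0 = 0" using s by (simp_all add: sol_def K_def)
      then show ?case using elim by (simp add: dist_real_def)
    qed
    then obtain d1 where d1: "d1 > 0"
      "\<And>r. r \<in> {0..} \<Longrightarrow> r \<noteq> 0 \<Longrightarrow> dist r 0 < d1 \<Longrightarrow> \<bar>(u r - u 0) / r\<bar> < e \<and> \<bar>K r\<bar> < \<bar>c\<bar> / 4"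
      unfolding eventually_at by blast
    define r where "r = min d1 1 / 2"
    have r: "r > 0" "r < d1" "r < 1" using d1(1) by (auto simp: r_def)
    obtain z where z: "z > 0" "z < r" "u r - u 0 = u' z * (r - 0)"
    proof (rule mvt[of 0 r u "\<lambda>x. (*) (u' x)"])
      show "continuous_on {0..r} u" using sol_cont[OF s] by (rule continuous_on_subset) auto
      show "(u has_derivative (*) (u' x)) (at x)" if "0 < x" for x
        using sol_DERIV[OF s that] by (simp add: has_field_derivative_def)
    qed (use r in auto)
    have "\<bar>u' z\<bar> < e" using d1(2)[of r] z(3) r by (simp add: dist_real_def)
    then have "\<bar>w z * u' z\<bar> \<le> w z * e"
      using w_nonneg[of z] z by (auto simp: abs_mult intro!: mult_left_mono)
    also have "\<dots> \<le> w 1 * e"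
      using w_mono[of z 1] z r e by (intro mult_right_mono) auto
    finally have "\<bar>w z * u' z\<bar> \<le> \<bar>c\<bar> / 4" using e by (simp add: mult.commute)
    moreover have "\<bar>K z\<bar> < \<bar>c\<bar> / 4" using d1(2)[of z] z r by (simp add: dist_real_def)
    moreover have "w z * u' z + K z = c" using const[of z] z by (simp add: c_def)
    ultimately show False using c by linarith
  qed
  then show ?thesis using const[of r] r by (cases "r = 0") (auto simp: K_def k_def c_def)
qed

text \<open>
  The bound is linear in \<open>r\<close> since \<open>V(r)/w(r) \<le> r\<close>; this linear decay at the pole is what makes the
  profiles built from \<open>u\<close> usable as test functions.
\<close>
lemma sol_flux_bound:
  assumes s: "sol p \<alpha> u u'" and r: "r \<ge> 0"
    and M: "\<And>t. 0 \<le> t \<Longrightarrow> t \<le> r \<Longrightarrow> \<bar>signed_power p (u t)\<bar> \<le> M"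
  shows "\<bar>u' r\<bar> \<le> M * r"
proof (cases "r = 0")
  case False
  then have rpos: "r > 0" using r by simp
  have "norm (integral {0..r} (\<lambda>s. w s * signed_power p (u s))) \<le> integral {0..r} (\<lambda>s. M * w s)"
  proof (rule integral_norm_bound_integral)
    show "(\<lambda>s. w s * signed_power p (u s)) integrable_on {0..r}"
      by (intro integrable_continuous_real continuous_intros)
        (auto intro: continuous_on_subset[OF w_cont] continuous_on_subset[OF sol_signed_power_cont[OF s]])
    show "(\<lambda>s. M * w s) integrable_on {0..r}" by (intro integrable_continuous_real continuous_intros continuous_on_subset[OF w_cont]) auto
    show "norm (w x * signed_power p (u x)) \<le> M * w x" if "x \<in> {0..r}" for x
      using M[of x] w_nonneg[of x] that by (simp add: abs_mult) (metis mult.commute mult_left_mono)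
  qed
  moreover have "w r * \<bar>u' r\<bar> = \<bar>integral {0..r} (\<lambda>s. w s * signed_power p (u s))\<bar>"
    using sol_flux[OF s r] w_nonneg[OF r] by (metis abs_minus_cancel abs_mult abs_of_nonneg)
  ultimately have "w r * \<bar>u' r\<bar> \<le> M * V r" by (simp add: V_def)
  also have "\<dots> \<le> M * (r * w r)"
    using V_le[OF r] M[of 0] r by (intro mult_left_mono) auto
  finally have "\<bar>u' r\<bar> * w r \<le> (M * r) * w r" by (simp add: mult_ac)
  then show ?thesis using w_pos[OF rpos] by simp
qed (use s in \<open>simp add: sol_def\<close>)

lemma sol_deriv2:
  assumes s: "sol p \<alpha> u u'" and r: "r > 0"
  shows "(u' has_real_derivative - (w' r / w r) * u' r - signed_power p (u r)) (at r)"
proof -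
  have "((\<lambda>s. (w s * u' s) / w s) has_real_derivative - (w' r / w r) * u' r - signed_power p (u r)) (at r)"
  proof -
    have "((\<lambda>s. w s * u' s) has_real_derivative - (w r * signed_power p (u r))) (at r)"
      using s r by (simp add: sol_def)
    from DERIV_divide[OF this w_deriv[OF r]] w_pos[OF r]
    have "((\<lambda>s. (w s * u' s) / w s) has_real_derivative
       (- (w r * signed_power p (u r)) * w r - w r * u' r * w' r) / (w r * w r)) (at r)" by simp
    moreover have "(- (w r * signed_power p (u r)) * w r - w r * u' r * w' r) / (w r * w r)
       = - (w' r / w r) * u' r - signed_power p (u r)"
      using w_pos[OF r] by (simp add: field_simps)
    ultimately show ?thesis by simp
  qed
  then show ?thesis
  proof (rule has_field_derivative_transform_within_open)
    show "w s * u' s / w s = u' s" if "s \<in> {0<..}" for s using w_pos[of s] that by simp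
  qed (use r in auto)
qed

lemma sol_deriv_bound:
  assumes s: "sol p \<alpha> u u'" and R: "R \<ge> 0"
  obtains M where "M \<ge> 0" "\<And>r. 0 \<le> r \<Longrightarrow> r \<le> R \<Longrightarrow> \<bar>u' r\<bar> \<le> M * r"
proof -
  have "compact ((\<lambda>r. signed_power p (u r)) ` {0..R})"
    by (rule compact_continuous_image) (auto intro: continuous_on_subset[OF sol_signed_power_cont[OF s]])
  then obtain M where "\<forall>x\<in>{0..R}. \<bar>signed_power p (u x)\<bar> \<le> M"
    by (auto dest!: compact_imp_bounded simp: bounded_iff)
  then have M: "\<And>t. 0 \<le> t \<Longrightarrow> t \<le> R \<Longrightarrow> \<bar>signed_power p (u t)\<bar> \<le> M" by simp
  have "\<bar>u' r\<bar> \<le> M * r" if "0 \<le> r" "r \<le> R" for r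
    by (rule sol_flux_bound[OF s that(1)]) (use M that in auto)
  moreover have "M \<ge> 0" using M[of 0] R by linarith
  ultimately show ?thesis using that by blast
qed

lemma sol_deriv_cont:
  assumes s: "sol p \<alpha> u u'" shows "continuous_on {0..} u'"
proof -
  have "continuous (at r within {0..}) u'" if "r \<ge> 0" for r
  proof (cases "r = 0")
    case False
    then show ?thesis
      using sol_deriv2[OF s, of r] that by (simp add: at_within_atLeast DERIV_isCont)
  next
    case True
    obtain M where M: "M \<ge> 0" "\<And>r. 0 \<le> r \<Longrightarrow> r \<le> 1 \<Longrightarrow> \<bar>u' r\<bar> \<le> M * r"
      using sol_deriv_bound[OF s, of 1] by auto
    have "(u' \<longlongrightarrow> 0) (at 0 within {0..})"
    proof (rule Lim_null_comparison)
      show "\<forall>\<^sub>F x in at 0 within {0..}. norm (u' x) \<le> M * x"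
        unfolding eventually_at by (rule exI[of _ 1]) (use M in \<open>auto simp: dist_real_def\<close>)
      show "((*) M \<longlongrightarrow> 0) (at 0 within {0..})" by (auto intro!: tendsto_eq_intros)
    qed
    then show ?thesis using True s by (simp add: continuous_within sol_def)
  qed
  then show ?thesis by (simp add: continuous_on_eq_continuous_within)
qed

definition energy :: "real \<Rightarrow> (real \<Rightarrow> real) \<Rightarrow> (real \<Rightarrow> real) \<Rightarrow> real \<Rightarrow> real" where
  "energy p u u' r = (u' r)\<^sup>2 / 2 + \<bar>u r\<bar> powr (p + 1) / (p + 1)"

lemma energy_cont: "sol p \<alpha> u u' \<Longrightarrow> continuous_on {0..} (energy p u u')"
proof -
  assume s: "sol p \<alpha> u u'"
  have "continuous_on UNIV (\<lambda>x. \<bar>x\<bar> powr (p + 1) / (p + 1))"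
    using abs_powr_DERIV[OF sol_p[OF s]] by (meson DERIV_isCont continuous_at_imp_continuous_on)
  from continuous_on_compose2[OF this sol_cont[OF s]]
  have uc: "continuous_on {0..} (\<lambda>x. \<bar>u x\<bar> powr (p + 1) / (p + 1))" by simp
  show ?thesis unfolding energy_def [abs_def]
    by (intro continuous_on_add[OF _ uc]
        continuous_on_divide continuous_on_power continuous_on_const sol_deriv_cont[OF s]) auto
qed

lemma energy_DERIV:
  assumes s: "sol p \<alpha> u u'" and r: "r > 0"
  shows "(energy p u u' has_real_derivative - (w' r / w r) * (u' r)\<^sup>2) (at r)"
proof -
  have "((\<lambda>r. \<bar>u r\<bar> powr (p + 1) / (p + 1)) has_real_derivative signed_power p (u r) * u' r) (at r)"
    using DERIV_chain2[OF abs_powr_DERIV[OF sol_p[OF s]] sol_DERIV[OF s r]] .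
  moreover have "((\<lambda>r. (u' r)\<^sup>2 / 2) has_real_derivative u' r * (- (w' r / w r) * u' r - signed_power p (u r))) (at r)"
    by (auto intro!: derivative_eq_intros sol_deriv2[OF s r])
  ultimately have "(energy p u u' has_real_derivative
      u' r * (- (w' r / w r) * u' r - signed_power p (u r)) + signed_power p (u r) * u' r) (at r)"
    unfolding energy_def [abs_def] by (rule DERIV_add[rotated])
  then show ?thesis by (simp add: power2_eq_square algebra_simps)
qed

text \<open>
  The friction term \<open>(w'/w) u'\<close> of the equation dissipates the energy, because \<open>\<psi>\<close> is nondecreasing.
\<close>
lemma energy_antimono:
  assumes s: "sol p \<alpha> u u'" and r: "0 \<le> r" "r \<le> t"
  shows "energy p u u' t \<le> energy p u u' r"
proof (rule DERIV_nonpos_imp_decreasing_open[where f = "energy p u u'"])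
  show "\<exists>y. (energy p u u' has_real_derivative y) (at x) \<and> y \<le> 0" if "r < x" "x < t" for x
  proof -
    have x: "x > 0" using that r by simp
    have "- (w' x / w x) * (u' x)\<^sup>2 \<le> 0" using w'_nonneg[OF x] w_pos[OF x] by simp
    then show ?thesis using energy_DERIV[OF s x] by blast
  qed
qed (use r in \<open>auto intro: continuous_on_subset[OF energy_cont[OF s]]\<close>)

lemma sol_abs_le:
  assumes s: "sol p \<alpha> u u'" and r: "0 \<le> r"
  shows "\<bar>u r\<bar> \<le> \<bar>\<alpha>\<bar>"
proof -
  have "\<bar>u r\<bar> powr (p + 1) / (p + 1) \<le> \<bar>\<alpha>\<bar> powr (p + 1) / (p + 1)"
  proof -
    have "(u' 0)\<^sup>2 = 0" "u 0 = \<alpha>" using s by (auto simp: sol_def)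
    then have "(u' r)\<^sup>2 / 2 + \<bar>u r\<bar> powr (p + 1) / (p + 1) \<le> \<bar>\<alpha>\<bar> powr (p + 1) / (p + 1)"
      using energy_antimono[OF s order_refl r] by (simp add: energy_def)
    moreover have "(u' r)\<^sup>2 / 2 \<ge> 0" by simp
    ultimately show ?thesis by linarith
  qed
  then have "\<bar>u r\<bar> powr (p + 1) \<le> \<bar>\<alpha>\<bar> powr (p + 1)"
    using sol_p[OF s] by (simp add: divide_le_cancel)
  then show ?thesis using sol_p[OF s] by (smt (verit) powr_less_mono2)
qed

text \<open>
  A Gronwall argument for \<open>(u - v)\<^sup>2 + (u' - v')\<^sup>2\<close>. The coefficient \<open>w'/w\<close> is singular at the pole, but
  it enters with a favourable sign and is dropped.
\<close>
lemma sol_continuous_dependence: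
  assumes s: "sol p \<alpha> u u'" and t: "sol p \<beta> v v'" and A: "\<bar>\<alpha>\<bar> \<le> A" "\<bar>\<beta>\<bar> \<le> A" and r: "r \<ge> 0"
  shows "(u r - v r)\<^sup>2 + (u' r - v' r)\<^sup>2 \<le> (\<alpha> - \<beta>)\<^sup>2 * exp ((1 + p * A powr (p - 1)) * r)"
proof -
  define L where "L = p * A powr (p - 1)"
  define N where "N = (\<lambda>r. ((u r - v r)\<^sup>2 + (u' r - v' r)\<^sup>2) * exp (- (1 + L) * r))"
  have L: "L \<ge> 0" using sol_p[OF s] by (simp add: L_def)
  have "N r \<le> N 0"
  proof (rule DERIV_nonpos_imp_decreasing_open[where f = N])
    show "continuous_on {0..r} N"
      unfolding N_def
      by (intro continuous_intros)
        (auto intro: continuous_on_subset[OF sol_cont[OF s]] continuous_on_subset[OF sol_cont[OF t]]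
          continuous_on_subset[OF sol_deriv_cont[OF s]] continuous_on_subset[OF sol_deriv_cont[OF t]])
    fix x assume x: "0 < x" "x < r"
    define z z' df where "z = u x - v x" and "z' = u' x - v' x"
      and "df = signed_power p (u x) - signed_power p (v x)"
    have "((\<lambda>r. (u r - v r)\<^sup>2 + (u' r - v' r)\<^sup>2) has_real_derivative
        2 * z * z' + 2 * z' * (- (w' x / w x) * z' - df)) (at x)"
    proof -
      have "((\<lambda>r. u r - v r) has_real_derivative z') (at x)"
        unfolding z'_def by (intro DERIV_diff sol_DERIV[OF s x(1)] sol_DERIV[OF t x(1)])
      moreover have "((\<lambda>r. u' r - v' r) has_real_derivative - (w' x / w x) * z' - df) (at x)"
        using DERIV_diff[OF sol_deriv2[OF s x(1)] sol_deriv2[OF t x(1)]]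
        by (simp add: z'_def df_def algebra_simps diff_divide_distrib)
      ultimately show ?thesis
        using DERIV_add[OF DERIV_square DERIV_square] unfolding z_def z'_def by blast
    qed
    moreover have "((\<lambda>r. exp (- (1 + L) * r)) has_real_derivative - (1 + L) * exp (- (1 + L) * x)) (at x)"
      by (auto intro!: derivative_eq_intros)
    ultimately have "(N has_real_derivative
        (2 * z * z' + 2 * z' * (- (w' x / w x) * z' - df)) * exp (- (1 + L) * x)
         + - (1 + L) * exp (- (1 + L) * x) * (z\<^sup>2 + z'\<^sup>2)) (at x)"
      unfolding N_def z_def z'_def by (rule DERIV_mult)
    moreover have "(2 * z * z' + 2 * z' * (- (w' x / w x) * z' - df)) * exp (- (1 + L) * x)
         + - (1 + L) * exp (- (1 + L) * x) * (z\<^sup>2 + z'\<^sup>2) =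
        (2 * z * z' + 2 * z' * (- (w' x / w x) * z' - df) - (1 + L) * (z\<^sup>2 + z'\<^sup>2)) * exp (- (1 + L) * x)"
      by (simp add: algebra_simps)
    ultimately have d: "(N has_real_derivative
        (2 * z * z' + 2 * z' * (- (w' x / w x) * z' - df) - (1 + L) * (z\<^sup>2 + z'\<^sup>2)) * exp (- (1 + L) * x)) (at x)"
      by simp
    have "\<bar>df\<bar> \<le> L * \<bar>z\<bar>"
      unfolding df_def L_def z_def
      by (rule signed_power_Lipschitz)
        (use sol_p[OF s] sol_abs_le[OF s, of x] sol_abs_le[OF t, of x] A x in auto)
    then have "\<bar>z'\<bar> * \<bar>df\<bar> \<le> \<bar>z'\<bar> * (L * \<bar>z\<bar>)" by (intro mult_left_mono) auto
    then have "\<bar>z' * df\<bar> \<le> L * \<bar>z' * z\<bar>" unfolding abs_mult by (simp add: mult.left_commute)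
    then have 1: "- (z' * df) \<le> L * \<bar>z' * z\<bar>" by linarith
    have 2: "(w' x / w x) * z'\<^sup>2 \<ge> 0"
      using w'_nonneg[OF x(1)] w_pos[OF x(1)] by simp
    have 3: "2 * \<bar>z' * z\<bar> \<le> z\<^sup>2 + z'\<^sup>2"
      using sum_squares_bound[of "\<bar>z\<bar>" "\<bar>z'\<bar>"] unfolding abs_mult by (simp add: mult.commute)
    have "2 * z * z' + 2 * z' * (- (w' x / w x) * z' - df) =
       2 * (z' * z) - 2 * ((w' x / w x) * z'\<^sup>2) - 2 * (z' * df)"
      by (simp add: algebra_simps power2_eq_square)
    also have "\<dots> \<le> (1 + L) * (2 * \<bar>z' * z\<bar>)"
      using 1 2 abs_ge_self[of "z' * z"] unfolding distrib_right by linarith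
    also have "\<dots> \<le> (1 + L) * (z\<^sup>2 + z'\<^sup>2)"
      using 3 L by (intro mult_left_mono) auto
    finally have "(2 * z * z' + 2 * z' * (- (w' x / w x) * z' - df) - (1 + L) * (z\<^sup>2 + z'\<^sup>2)) * exp (- (1 + L) * x) \<le> 0"
      by (simp add: mult_le_0_iff)
    with d show "\<exists>y. (N has_real_derivative y) (at x) \<and> y \<le> 0" by blast
  qed (use r in auto)
  then have "((u r - v r)\<^sup>2 + (u' r - v' r)\<^sup>2) * exp (- (1 + L) * r) \<le> (\<alpha> - \<beta>)\<^sup>2"
    using s t by (simp add: N_def sol_def)
  then have "((u r - v r)\<^sup>2 + (u' r - v' r)\<^sup>2) * exp (- (1 + L) * r) * exp ((1 + L) * r)
      \<le> (\<alpha> - \<beta>)\<^sup>2 * exp ((1 + L) * r)"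
    by (intro mult_right_mono) auto
  moreover have "exp (- (1 + L) * r) * exp ((1 + L) * r) = 1"
    by (subst exp_add [symmetric]) (simp add: algebra_simps)
  ultimately show ?thesis unfolding L_def by (simp only: mult.assoc mult_1_right)
qed

text \<open>
  Integration by parts. Both boundary terms vanish, the one at the pole because \<open>w(0) = 0\<close>.
\<close>
lemma sol_weak_form:
  assumes s: "sol p \<alpha> u u'" and R: "R \<ge> 0"
    and \<zeta>: "continuous_on {0..R} \<zeta>" "continuous_on {0..R} \<zeta>'" "\<zeta> R = 0"
    and \<zeta>_deriv: "\<And>r. 0 < r \<Longrightarrow> r < R \<Longrightarrow> (\<zeta> has_real_derivative \<zeta>' r) (at r)"
  shows "integral {0..R} (\<lambda>r. w r * u' r * \<zeta>' r) = integral {0..R} (\<lambda>r. w r * signed_power p (u r) * \<zeta> r)"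
proof -
  have c: "continuous_on {0..R} w" "continuous_on {0..R} u'" "continuous_on {0..R} (\<lambda>r. signed_power p (u r))"
    by (auto intro: continuous_on_subset[OF w_cont] continuous_on_subset[OF sol_deriv_cont[OF s]]
        continuous_on_subset[OF sol_signed_power_cont[OF s]])
  have "((\<lambda>r. w r * u' r * \<zeta>' r - w r * signed_power p (u r) * \<zeta> r) has_integral
      w R * u' R * \<zeta> R - w 0 * u' 0 * \<zeta> 0) {0..R}"
  proof (rule fundamental_theorem_of_calculus_interior)
    fix x assume x: "x \<in> {0<..<R}"
    then have "((\<lambda>r. w r * u' r) has_real_derivative - (w x * signed_power p (u x))) (at x)"
      using s by (simp add: sol_def)
    from DERIV_mult[OF this \<zeta>_deriv] x
    show "((\<lambda>r. w r * u' r * \<zeta> r) has_vector_derivative w x * u' x * \<zeta>' x - w x * signed_power p (u x) * \<zeta> x) (at x)"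
      unfolding has_real_derivative_iff_has_vector_derivative[symmetric] by (simp add: algebra_simps)
  qed (use R in \<open>auto intro!: continuous_intros c \<zeta>\<close>)
  then have "integral {0..R} (\<lambda>r. w r * u' r * \<zeta>' r - w r * signed_power p (u r) * \<zeta> r) = 0"
    using \<zeta>(3) by (simp add: integral_unique)
  moreover have "integral {0..R} (\<lambda>r. w r * u' r * \<zeta>' r - w r * signed_power p (u r) * \<zeta> r) =
      integral {0..R} (\<lambda>r. w r * u' r * \<zeta>' r) - integral {0..R} (\<lambda>r. w r * signed_power p (u r) * \<zeta> r)"
    by (rule integral_diff) (intro integrable_continuous_real continuous_intros c \<zeta>)+
  ultimately show ?thesis by simp
qed

end

section \<open>Smooth radial test functions\<close>

lemma C_k_SucI:
  assumes "\<And>x. (f has_derivative f' x) (at x)" "\<And>i. C_k k (\<lambda>x. f' x (axis i 1))"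
  shows "C_k (Suc k) f"
proof -
  have "frechet_derivative f (at x) = f' x" for x
    using frechet_derivative_at[OF assms(1)] by simp
  then show ?thesis using assms by (auto simp: differentiable_def)
qed

lemma C_k_SucD:
  assumes "C_k (Suc k) f"
  shows "(f has_derivative frechet_derivative f (at x)) (at x)"
    "C_k k (\<lambda>x. frechet_derivative f (at x) (axis i 1))"
  using assms by (auto simp: frechet_derivative_works)

lemma C_k_Suc_imp: "C_k (Suc k) f \<Longrightarrow> C_k k f"
proof (induction k arbitrary: f)
  case 0
  then have "\<And>x. f differentiable (at x)" by simp
  then show ?case
    by (auto intro!: continuous_at_imp_continuous_on differentiable_imp_continuous_within)
next
  case (Suc k)
  show ?case
    by (rule C_k_SucI[OF C_k_SucD(1)[OF Suc.prems] Suc.IH[OF C_k_SucD(2)[OF Suc.prems]]])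
qed

lemma C_k_const: "C_k k (\<lambda>x. c)"
proof (induction k arbitrary: c)
  case (Suc k)
  show ?case by (rule C_k_SucI[of _ "\<lambda>_ _. 0"]) (auto intro: Suc.IH)
qed simp

lemma C_k_add: "C_k k f \<Longrightarrow> C_k k g \<Longrightarrow> C_k k (\<lambda>x. f x + g x)"
proof (induction k arbitrary: f g)
  case (Suc k)
  show ?case
    by (rule C_k_SucI[OF has_derivative_add[OF C_k_SucD(1)[OF Suc.prems(1)] C_k_SucD(1)[OF Suc.prems(2)]]])
      (intro Suc.IH C_k_SucD(2) Suc.prems)
qed (auto intro: continuous_intros)

lemma C_k_mult: "C_k k f \<Longrightarrow> C_k k g \<Longrightarrow> C_k k (\<lambda>x. f x * g x)"
proof (induction k arbitrary: f g)
  case (Suc k)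
  show ?case
    by (rule C_k_SucI[OF has_derivative_mult[OF C_k_SucD(1)[OF Suc.prems(1)] C_k_SucD(1)[OF Suc.prems(2)]]])
      (intro C_k_add Suc.IH C_k_SucD(2) Suc.prems C_k_Suc_imp)
qed (auto intro: continuous_intros)

lemma C_k_nth: "C_k k (\<lambda>x. x $ i)"
proof (cases k)
  case (Suc j)
  show ?thesis unfolding Suc
    by (rule C_k_SucI[of _ "\<lambda>_ v. v $ i"])
      (auto intro!: C_k_const derivative_eq_intros bounded_linear_imp_has_derivative bounded_linear_vec_nth)
qed (auto intro: continuous_intros)

lemma C_k_sum: "finite A \<Longrightarrow> (\<And>i. i \<in> A \<Longrightarrow> C_k k (f i)) \<Longrightarrow> C_k k (\<lambda>x. \<Sum>i\<in>A. f i x)"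
  by (induction A rule: finite_induct) (auto intro: C_k_const C_k_add)

lemma C_k_inner_self: "C_k k (\<lambda>x. x \<bullet> x)"
  unfolding inner_vec_def inner_real_def by (intro C_k_sum C_k_mult C_k_nth) auto

lemma C_k_power: "C_k k f \<Longrightarrow> C_k k (\<lambda>x. f x ^ j)"
  by (induction j) (auto intro: C_k_const C_k_mult)

text \<open>
  The functions \<open>x\<^sup>-\<^sup>k exp(-1/x)\<close>, extended by zero. Their span is closed under differentiation, which
  gives smoothness at \<open>0\<close> without a formula for higher derivatives.
\<close>
definition flat :: "nat \<Rightarrow> real \<Rightarrow> real" where
  "flat k x = (if x > 0 then (1 / x) ^ k * exp (- (1 / x)) else 0)"

text \<open>
  The exponential beats every power as \<open>1/x\<close> tends to infinity.
\<close>
lemma flat_quotient_tendsto: "((\<lambda>x. flat k x / x) \<longlongrightarrow> 0) (at 0)"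
proof -
  have "((\<lambda>t::real. t ^ Suc k / exp t) \<longlongrightarrow> 0) at_top"
    by (rule tendsto_power_div_exp_0)
  then have "((\<lambda>x::real. inverse x ^ Suc k / exp (inverse x)) \<longlongrightarrow> 0) (at_right 0)"
    by (rule filterlim_compose[OF _ filterlim_inverse_at_top_right])
  then have r: "((\<lambda>x. flat k x / x) \<longlongrightarrow> 0) (at_right 0)"
    by (rule tendsto_cong[THEN iffD1, rotated])
      (auto simp: eventually_at_right_less flat_def exp_minus field_simps intro!: eventually_mono[OF eventually_at_right_less])
  have l: "((\<lambda>x. flat k x / x) \<longlongrightarrow> 0) (at_left 0)"
    by (rule tendsto_eventually) (auto simp: eventually_at_filter flat_def)
  show ?thesis using l r by (simp add: filterlim_at_split)
qed

lemma flat_DERIV: "(flat k has_real_derivative flat (k + 2) x - k * flat (k + 1) x) (at x)"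
proof (cases x "0::real" rule: linorder_cases)
  case equal
  have "((\<lambda>h. (flat k (0 + h) - flat k 0) / h) \<longlongrightarrow> 0) (at 0)"
    using flat_quotient_tendsto[of k] by (simp add: flat_def[of k 0])
  then show ?thesis using equal by (simp add: DERIV_def flat_def[of _ 0])
next
  case less
  then have z: "flat (k + 2) x - k * flat (k + 1) x = 0" by (simp add: flat_def)
  show ?thesis unfolding z
    by (rule has_field_derivative_transform_within_open[of "\<lambda>_. 0" _ _ "{..<0}"])
      (use less in \<open>auto simp: flat_def\<close>)
next
  case greater
  have i: "((\<lambda>x. 1 / x) has_real_derivative - (1 / x)\<^sup>2) (at x)"
    using greater by (auto intro!: derivative_eq_intros simp: power2_eq_square)
  have "((\<lambda>x. (1 / x) ^ k * exp (- (1 / x))) has_real_derivative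
       real k * (1 / x) ^ (k - 1) * (- (1 / x)\<^sup>2) * exp (- (1 / x)) + exp (- (1 / x)) * (1 / x)\<^sup>2 * (1 / x) ^ k) (at x)"
    using DERIV_mult[OF DERIV_power[OF i, of k] DERIV_fun_exp[OF DERIV_minus[OF i]]]
    by (rule DERIV_cong) (simp add: mult_ac)
  moreover have *: "real k * (1 / x) ^ (k - 1) * (1 / x)\<^sup>2 = real k * (1 / x) ^ (k + 1)"
    by (cases k) (simp_all add: power2_eq_square)
  moreover have "real k * (1 / x) ^ (k - 1) * (- (1 / x)\<^sup>2) * e + e * (1 / x)\<^sup>2 * (1 / x) ^ k =
      (1 / x) ^ (k + 2) * e - k * ((1 / x) ^ (k + 1) * e)" for e
  proof -
    have alg: "k * A * B = t \<Longrightarrow> k * A * (- B) * e + e * B * C = C * B * e - t * e" for k A B C t :: real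
      by (auto simp: algebra_simps)
    show ?thesis
      unfolding power_add[of _ k 2] mult.assoc[of "real k" "(1 / x) ^ (k + 1)" e, symmetric]
      by (rule alg[OF *])
  qed
  ultimately have "((\<lambda>x. (1 / x) ^ k * exp (- (1 / x))) has_real_derivative
       (1 / x) ^ (k + 2) * exp (- (1 / x)) - k * ((1 / x) ^ (k + 1) * exp (- (1 / x)))) (at x)"
    by simp
  then have "(flat k has_real_derivative
       (1 / x) ^ (k + 2) * exp (- (1 / x)) - k * ((1 / x) ^ (k + 1) * exp (- (1 / x)))) (at x)"
    by (rule has_field_derivative_transform_within_open[where S = "{0<..}"])
      (use greater in \<open>auto simp: flat_def\<close>)
  then show ?thesis using greater by (simp add: flat_def)
qed

lemma continuous_on_flat: "continuous_on A (flat k)"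
  by (meson flat_DERIV DERIV_isCont continuous_at_imp_continuous_on)

lemma flat_0_bounds: "0 \<le> flat 0 x" "flat 0 x \<le> 1"
  by (auto simp: flat_def)

lemma has_derivative_radial:
  fixes x :: "'a::real_inner"
  assumes "(G has_real_derivative D) (at (x \<bullet> x))"
  shows "((\<lambda>x. G (x \<bullet> x)) has_derivative (\<lambda>v. D * (2 * (x \<bullet> v)))) (at x)"
proof -
  have "((\<lambda>x. x \<bullet> x) has_derivative (\<lambda>v. 2 * (x \<bullet> v))) (at x)"
    by (auto intro!: derivative_eq_intros simp: inner_commute)
  from DERIV_compose_FDERIV[OF assms this] show ?thesis by (simp add: mult.commute)
qed

text \<open>
  A radial function is written as \<open>G(\<bar>x\<bar>\<^sup>2)\<close> rather than as a function of \<open>\<bar>x\<bar>\<close>: since \<open>\<bar>x\<bar>\<^sup>2\<close> is a polynomial,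
  smoothness of \<open>G\<close> suffices and the origin needs no separate treatment.
\<close>
lemma C_k_radial:
  fixes G g :: "real \<Rightarrow> real"
  assumes "\<And>s. (G has_real_derivative g s) (at s)" "C_k k (\<lambda>x::real^'n::finite. g (x \<bullet> x))"
  shows "C_k (Suc k) (\<lambda>x::real^'n. G (x \<bullet> x))"
proof (rule C_k_SucI[OF has_derivative_radial[OF assms(1)]])
  fix i
  show "C_k k (\<lambda>x::real^'n. g (x \<bullet> x) * (2 * (x \<bullet> axis i 1)))"
    unfolding inner_axis inner_real_def by (intro C_k_mult C_k_const C_k_nth assms(2))
qed

lemma C_k_flat_radial: "C_k j (\<lambda>x::real^'n::finite. flat k (m * (b - x \<bullet> x)))"
proof (induction j arbitrary: k)
  case 0
  show ?case by (auto intro!: continuous_on_compose2[OF continuous_on_flat[of UNIV]] continuous_intros)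
next
  case (Suc j)
  define g where "g = (\<lambda>s. (flat (k + 2) (m * (b - s)) - k * flat (k + 1) (m * (b - s))) * (- m))"
  show ?case
  proof (rule C_k_radial[of "\<lambda>s. flat k (m * (b - s))" g])
    show "((\<lambda>s. flat k (m * (b - s))) has_real_derivative g s) (at s)" for s
      unfolding g_def by (rule DERIV_chain2[OF flat_DERIV]) (auto intro!: derivative_eq_intros)
    have "g = (\<lambda>s. (flat (k + 2) (m * (b - s)) + (- k) * flat (k + 1) (m * (b - s))) * (- m))"
      unfolding g_def by simp
    then show "C_k j (\<lambda>x::real^'n. g (x \<bullet> x))"
      by (simp only:) (intro C_k_mult C_k_add C_k_const Suc.IH)
  qed
qed

text \<open>
  The derivative of the profile can be prescribed as a polynomial times a flat cutoff at \<open>b\<close>. The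
  profile is the antiderivative that vanishes beyond \<open>b\<close>.
\<close>
lemma radial_test_function:
  fixes a :: "nat \<Rightarrow> real" and b m :: real and N :: nat
  defines "H \<equiv> \<lambda>s. (\<Sum>i\<le>N. a i * s ^ i) * flat 0 (m * (b - s))"
  assumes "m > 0" "b \<ge> 0"
  obtains G where "\<And>s. (G has_real_derivative H s) (at s)" "\<And>s. s \<ge> b \<Longrightarrow> G s = 0"
    "(\<lambda>x::real^'n::finite. G (x \<bullet> x)) \<in> test_functions"
proof -
  have cont: "continuous_on UNIV H"
    unfolding H_def by (auto intro!: continuous_intros continuous_on_compose2[OF continuous_on_flat[of UNIV]])
  have "\<exists>F. \<forall>x::real. -\<infinity> < ereal x \<longrightarrow> ereal x < \<infinity> \<longrightarrow> (F has_vector_derivative H x) (at x)"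
    by (rule einterval_antiderivative) (use cont in \<open>auto simp: continuous_on_eq_continuous_at\<close>)
  then obtain F where F: "\<And>x. (F has_real_derivative H x) (at x)"
    by (auto simp: has_real_derivative_iff_has_vector_derivative)
  define G where "G = (\<lambda>s. F s - F b)"
  have G: "(G has_real_derivative H s) (at s)" for s
    unfolding G_def using F by (auto intro!: derivative_eq_intros)
  have G0: "G s = 0" if "s \<ge> b" for s
  proof (cases "s = b")
    case False
    then have "b < s" using that by simp
    moreover have "H z = 0" if "z \<ge> b" for z
      using that assms(2) by (simp add: H_def flat_def zero_less_mult_iff)
    ultimately show ?thesis using MVT2[of b s G H] G by (fastforce simp: G_def)
  qed (simp add: G_def)
  have "C_k k (\<lambda>x::real^'n. H (x \<bullet> x))" for k
    unfolding H_def by (intro C_k_mult C_k_sum C_k_const C_k_power C_k_inner_self C_k_flat_radial) auto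
  then have "C_k k (\<lambda>x::real^'n. G (x \<bullet> x))" for k
    using C_k_Suc_imp C_k_radial G by blast
  moreover have "compact (closure {x::real^'n. G (x \<bullet> x) \<noteq> 0})"
  proof -
    have "norm x \<le> sqrt b" if "G (x \<bullet> x) \<noteq> 0" for x :: "real^'n"
      using G0[of "x \<bullet> x"] that by (metis linear norm_eq_sqrt_inner real_sqrt_le_iff)
    then have "bounded {x::real^'n. G (x \<bullet> x) \<noteq> 0}"
      by (auto simp: bounded_iff)
    then show ?thesis by (simp add: compact_eq_bounded_closed bounded_closure)
  qed
  ultimately have "(\<lambda>x::real^'n. G (x \<bullet> x)) \<in> test_functions"
    by (simp add: test_functions_def)
  with G G0 show ?thesis using that by blast
qed

section \<open>The model metric in Cartesian coordinates\<close>

text \<open>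
  An orthogonal matrix that maps a coordinate vector to \<open>e\<close> diagonalises \<open>a I + b e e\<^sup>T\<close>, with the
  eigenvalue \<open>a + b\<close> once and \<open>a\<close> otherwise.
\<close>
lemma det_rank_one_perturbation:
  fixes e :: "real^'n::finite"
  assumes "norm e = 1"
  shows "det (\<chi> i j. a * (if i = j then 1 else 0) + b * (e $ i * e $ j)) = a ^ (CARD('n) - 1) * (a + b)"
proof -
  fix k :: 'n
  obtain A :: "real^'n^'n" where A: "orthogonal_matrix A" "A *v axis k 1 = e"
    using orthogonal_matrix_exists_basis[OF assms] by blast
  define d where "d = (\<lambda>l. if l = k then a + b else a)"
  define D :: "real^'n^'n" where "D = (\<chi> i j. if i = j then d i else 0)"
  have e: "e $ i = A $ i $ k" for i
    using A(2) by (auto simp: vec_eq_iff matrix_vector_mult_def axis_def if_distrib[where f = "\<lambda>x. _ * x"] cong: if_cong)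
  have orth: "(\<Sum>l\<in>UNIV. A $ i $ l * A $ j $ l) = (if i = j then 1 else 0)" for i j
  proof -
    have "A ** transpose A = mat 1" using A(1) by (simp add: orthogonal_matrix_def)
    then have "(A ** transpose A) $ i $ j = mat 1 $ i $ j" by simp
    then show ?thesis by (simp add: matrix_matrix_mult_def transpose_def mat_def)
  qed
  have "(A ** D ** transpose A) $ i $ j = a * (if i = j then 1 else 0) + b * (e $ i * e $ j)" for i j
  proof -
    have "(A ** D ** transpose A) $ i $ j = (\<Sum>l\<in>UNIV. A $ i $ l * d l * A $ j $ l)"
      by (simp add: matrix_matrix_mult_def D_def transpose_def if_distrib[where f = "\<lambda>x. _ * x"] cong: if_cong)
    also have "\<dots> = (\<Sum>l\<in>UNIV. a * (A $ i $ l * A $ j $ l) + (if l = k then b * (A $ i $ k * A $ j $ k) else 0))"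
      by (rule sum.cong) (auto simp: d_def algebra_simps)
    also have "\<dots> = a * (if i = j then 1 else 0) + b * (e $ i * e $ j)"
      by (simp add: sum.distrib orth e flip: sum_distrib_left)
    finally show ?thesis .
  qed
  then have "(\<chi> i j. a * (if i = j then 1 else 0) + b * (e $ i * e $ j)) = A ** D ** transpose A"
    by (simp add: vec_eq_iff)
  then have "det (\<chi> i j. a * (if i = j then 1 else 0) + b * (e $ i * e $ j)) = det A * det D * det A"
    by (simp add: det_mul)
  also have "\<dots> = det D"
    using det_orthogonal_matrix[OF A(1)] by auto
  also have "\<dots> = (\<Prod>i\<in>UNIV. d i)"
    by (subst det_diagonal) (auto simp: D_def)
  also have "\<dots> = d k * (\<Prod>i\<in>UNIV - {k}. d i)"
    by (rule prod.remove) auto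
  also have "(\<Prod>i\<in>UNIV - {k}. d i) = (\<Prod>i\<in>UNIV - {k}. a)"
    by (rule prod.cong) (auto simp: d_def)
  finally show ?thesis by (simp add: d_def mult.commute)
qed

lemma integrable_bounded_support:
  fixes f :: "'a::euclidean_space \<Rightarrow> real"
  assumes "f \<in> borel_measurable borel" "\<And>x. \<bar>f x\<bar> \<le> B" "\<And>x. norm x > R \<Longrightarrow> f x = 0"
  shows "integrable lborel f"
proof (rule Bochner_Integration.integrable_bound)
  show "integrable lborel (\<lambda>x::'a. indicator (cball 0 R) x *\<^sub>R B)"
    by (intro integrable_scaleR_left integrable_real_indicator) (use emeasure_lborel_cball_finite in auto)
  show "AE x in lborel. norm (f x) \<le> norm (indicator (cball 0 R) x *\<^sub>R B)"
  proof (rule AE_I2)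
    fix x :: 'a
    show "norm (f x) \<le> norm (indicator (cball 0 R) x *\<^sub>R B)"
      using assms(2)[of x] assms(3)[of x] by (cases "norm x > R") (auto simp: indicator_def)
  qed
qed (use assms(1) in simp)

text \<open>
  The Euclidean gradient in the Cartesian chart, from which the Riemannian gradient is computed.
\<close>
definition coord_grad :: "(real^'n::finite \<Rightarrow> real) \<Rightarrow> real^'n \<Rightarrow> real^'n" where
  "coord_grad \<phi> x = (\<chi> i. frechet_derivative \<phi> (at x) (axis i 1))"

lemma frechet_derivative_coord_grad:
  assumes "\<phi> differentiable (at x)"
  shows "frechet_derivative \<phi> (at x) v = coord_grad \<phi> x \<bullet> v"
proof -
  have "linear (frechet_derivative \<phi> (at x))" using assms by (rule linear_frechet_derivative)
  then have "frechet_derivative \<phi> (at x) (\<Sum>i\<in>UNIV. v $ i *\<^sub>R axis i 1) =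
      (\<Sum>i\<in>UNIV. v $ i * frechet_derivative \<phi> (at x) (axis i 1))"
    by (simp add: linear_sum linear_scale)
  moreover have "(\<Sum>i\<in>UNIV. v $ i *\<^sub>R axis i 1) = v"
    using basis_expansion[of v] by (simp add: scalar_mult_eq_scaleR)
  ultimately show ?thesis by (simp add: inner_vec_def coord_grad_def mult.commute)
qed

lemma test_function_diff: "\<phi> \<in> test_functions \<Longrightarrow> \<phi> differentiable (at x)"
proof -
  assume "\<phi> \<in> test_functions"
  then have "C_k (Suc 0) \<phi>" unfolding test_functions_def by blast
  then show ?thesis by simp
qed

lemma test_function_has_derivative:
  "\<phi> \<in> test_functions \<Longrightarrow> (\<phi> has_derivative (\<lambda>v. coord_grad \<phi> x \<bullet> v)) (at x)"
proof -
  assume "\<phi> \<in> test_functions"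
  note d = test_function_diff[OF this, of x]
  have "frechet_derivative \<phi> (at x) = (\<lambda>v. coord_grad \<phi> x \<bullet> v)"
    by (rule ext) (rule frechet_derivative_coord_grad[OF d])
  then show ?thesis using d by (simp add: frechet_derivative_works)
qed

lemma test_function_cont: "\<phi> \<in> test_functions \<Longrightarrow> continuous_on UNIV \<phi>"
  using test_function_diff
  by (auto intro!: continuous_at_imp_continuous_on differentiable_imp_continuous_within)

lemma test_function_grad_cont: "\<phi> \<in> test_functions \<Longrightarrow> continuous_on UNIV (coord_grad \<phi>)"
proof -
  assume "\<phi> \<in> test_functions"
  then have "C_k (Suc 0) \<phi>" unfolding test_functions_def by blast
  then show ?thesis unfolding coord_grad_def [abs_def]
    by (auto intro!: continuous_on_vec_lambda)
qed

lemma test_function_support: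
  assumes "\<phi> \<in> test_functions"
  obtains R where "R > 0" "\<And>x. norm x > R \<Longrightarrow> \<phi> x = 0" "\<And>x. norm x > R \<Longrightarrow> coord_grad \<phi> x = 0"
proof -
  have "bounded (closure {x. \<phi> x \<noteq> 0})"
    using assms by (auto simp: test_functions_def compact_eq_bounded_closed)
  then have "bounded {x. \<phi> x \<noteq> 0}" by (rule bounded_subset) (rule closure_subset)
  then obtain R where R: "R > 0" "\<And>x. \<phi> x \<noteq> 0 \<Longrightarrow> norm x \<le> R"
    by (auto simp: bounded_pos)
  have "coord_grad \<phi> x = 0" if x: "norm x > R" for x
  proof -
    have "(\<phi> has_derivative (\<lambda>v. 0)) (at x)"
    proof (rule has_derivative_transform_within_open)
      show "((\<lambda>x. 0) has_derivative (\<lambda>v. 0)) (at x)" by simp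
      show "open {x. norm x > R}" by (intro open_Collect_less continuous_intros)
    qed (use x R in force)+
    then have "frechet_derivative \<phi> (at x) = (\<lambda>v. 0)" by (metis frechet_derivative_at)
    then show ?thesis by (simp add: coord_grad_def vec_eq_iff)
  qed
  moreover have "\<phi> x = 0" if "norm x > R" for x using R(2)[of x] that by auto
  ultimately show ?thesis using that R(1) by blast
qed

lemma continuous_compact_support_bounded:
  fixes f :: "'a::euclidean_space \<Rightarrow> 'b::real_normed_vector"
  assumes "continuous_on UNIV f" "\<And>x. norm x > R \<Longrightarrow> f x = 0"
  obtains M where "M > 0" "\<And>x. norm (f x) \<le> M"
proof -
  have "bounded (f ` cball 0 R)"
    by (intro compact_imp_bounded compact_continuous_image continuous_on_subset[OF assms(1)]) auto
  then obtain M where M: "M > 0" "\<And>x. norm x \<le> R \<Longrightarrow> norm (f x) \<le> M"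
    by (auto simp: bounded_pos)
  have "norm (f x) \<le> M" for x
    using M assms(2)[of x] by (cases "norm x \<le> R") auto
  then show ?thesis using that M(1) by blast
qed

context radial_weight
begin

text \<open>
  The density of the Riemannian volume with respect to Lebesgue measure, as a function of the radius.
  The value at \<open>0\<close> makes it continuous.
\<close>
definition dens :: "real \<Rightarrow> real" where
  "dens r = (if r = 0 then 1 else (\<psi> r / r) ^ (n - 1))"

text \<open>
  The factor by which the metric enlarges the squared length of a tangential covector, compared with
  the Euclidean metric. The value at \<open>0\<close> makes it continuous.
\<close>
definition tang :: "real \<Rightarrow> real" where
  "tang r = (if r = 0 then 1 else (r / \<psi> r)\<^sup>2)"

lemma \<psi>_quotient_cont: "continuous_on {0..} (\<lambda>r. if r = 0 then 1 else \<psi> r / r)"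
proof -
  have "continuous (at r within {0..}) (\<lambda>r. if r = 0 then 1 else \<psi> r / r)" if r: "r \<ge> 0" for r
  proof (cases "r = 0")
    case True
    have "((\<lambda>r. if r = 0 then 1 else \<psi> r / r) \<longlongrightarrow> 1) (at 0 within {0..})"
      by (rule Lim_transform_eventually[OF \<psi>_quotient_tendsto]) (auto simp: eventually_at_filter)
    then show ?thesis using True by (simp add: continuous_within)
  next
    case False
    then have "isCont (\<lambda>r. \<psi> r / r) r"
      using r \<psi>_deriv[of r] by (intro continuous_intros) (auto simp: at_within_atLeast intro: DERIV_isCont)
    then have "isCont (\<lambda>r. if r = 0 then 1 else \<psi> r / r) r"
    proof (rule isCont_cong[THEN iffD1, rotated])
      show "\<forall>\<^sub>F x in nhds r. \<psi> x / x = (if x = 0 then 1 else \<psi> x / x)"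
        using eventually_nhds_in_open[of "-{0}" r] False by (auto elim: eventually_mono)
    qed
    then show ?thesis by (rule continuous_at_imp_continuous_within)
  qed
  then show ?thesis by (simp add: continuous_on_eq_continuous_within)
qed

lemma dens_cont: "continuous_on {0..} dens"
proof -
  have "continuous_on {0..} (\<lambda>r. (if r = 0 then 1 else \<psi> r / r) ^ (n - 1))"
    by (intro continuous_intros \<psi>_quotient_cont)
  moreover have "(\<lambda>r. (if r = 0 then 1 else \<psi> r / r) ^ (n - 1)) = dens"
    by (auto simp: dens_def)
  ultimately show ?thesis by (simp only:)
qed

lemma tang_cont: "continuous_on {0..} tang"
proof -
  have "continuous_on {0..} (\<lambda>r. (inverse (if r = 0 then 1 else \<psi> r / r))\<^sup>2)"
  proof (intro continuous_intros \<psi>_quotient_cont ballI)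
    fix r :: real assume "r \<in> {0..}"
    then show "(if r = 0 then 1 else \<psi> r / r) \<noteq> 0" using \<psi>_pos[of r] by (cases "r = 0") auto
  qed
  moreover have "(\<lambda>r. (inverse (if r = 0 then 1 else \<psi> r / r))\<^sup>2) = tang"
    by (auto simp: tang_def)
  ultimately show ?thesis by (simp only:)
qed

lemma dens_pos: "r \<ge> 0 \<Longrightarrow> dens r > 0"
  using \<psi>_pos[of r] by (simp add: dens_def)

lemma tang_nonneg: "tang r \<ge> 0" by (simp add: tang_def)

lemma dens_eq: "r > 0 \<Longrightarrow> dens r * r ^ (n - 1) = w r"
  by (simp add: dens_def w_def power_divide)

lemma radial_cont: 
  "continuous_on {0..} f \<Longrightarrow> continuous_on UNIV (\<lambda>x::'a::real_normed_vector. f (norm x))"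
  by (rule continuous_on_compose2[of "{0..}" f]) (auto intro: continuous_intros)

text \<open>
  The metric is the Euclidean one in the radial direction and \<open>(\<psi>(r)/r)\<^sup>2\<close> times the Euclidean one in
  the directions orthogonal to \<open>x\<close>.
\<close>
lemma model_metric_eq:
  fixes x :: "real^'n::finite"
  assumes "x \<noteq> 0"
  shows "model_metric \<psi> x v z = (v \<bullet> sgn x) * (z \<bullet> sgn x) +
     (\<psi> (norm x) / norm x)\<^sup>2 * (v \<bullet> z - (v \<bullet> sgn x) * (z \<bullet> sgn x))"
proof -
  have ee: "sgn x \<bullet> sgn x = 1" using assms by (simp add: norm_sgn flip: norm_eq_1)
  have "(v - (v \<bullet> sgn x) *\<^sub>R sgn x) \<bullet> (z - (z \<bullet> sgn x) *\<^sub>R sgn x) = v \<bullet> z - (v \<bullet> sgn x) * (z \<bullet> sgn x)"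
    by (simp add: inner_diff_left inner_diff_right ee inner_commute[of "sgn x" z])
  then have "sphere_part x v \<bullet> sphere_part x z = (v \<bullet> z - (v \<bullet> sgn x) * (z \<bullet> sgn x)) / (norm x)\<^sup>2"
    unfolding sphere_part_def inner_scaleR_left inner_scaleR_right
    by (simp add: power2_eq_square divide_inverse)
  then show ?thesis using assms by (simp add: model_metric_def power_divide)
qed

lemma sqrt_det_model_metric:
  fixes x :: "real^'n::finite"
  assumes "n = CARD('n)"
  shows "sqrt (det (\<chi> i j. model_metric \<psi> x (axis i 1) (axis j 1))) = dens (norm x)"
proof (cases "x = 0")
  case True
  have "(\<chi> i j. model_metric \<psi> x (axis i 1) (axis j 1)) = (mat 1 :: real^'n^'n)"
    using True by (auto simp: model_metric_def vec_eq_iff mat_def inner_axis_axis)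
  then show ?thesis using True by (simp add: dens_def)
next
  case False
  define q where "q = \<psi> (norm x) / norm x"
  have A: "(axis i 1 :: real^'n) \<bullet> axis j 1 = (if i = j then 1 else 0)" for i j
    by (simp add: inner_axis_axis)
  have B: "axis i 1 \<bullet> sgn x = sgn x $ i" for i by (simp add: inner_axis')
  have "(\<chi> i j. model_metric \<psi> x (axis i 1) (axis j 1)) =
      (\<chi> i j. q\<^sup>2 * (if i = j then 1 else 0) + (1 - q\<^sup>2) * (sgn x $ i * sgn x $ j))"
    unfolding model_metric_eq[OF False] A B q_def[symmetric]
    by (intro arg_cong[of _ _ vec_lambda] ext) (simp add: algebra_simps)
  then have "det (\<chi> i j. model_metric \<psi> x (axis i 1) (axis j 1)) = (q\<^sup>2) ^ (CARD('n) - 1) * (q\<^sup>2 + (1 - q\<^sup>2))"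
    by (simp only:) (rule det_rank_one_perturbation, use False in \<open>simp add: norm_sgn\<close>)
  also have "\<dots> = (q ^ (n - 1))\<^sup>2"
    unfolding assms by (simp add: power2_eq_square power_mult_distrib)
  finally have "sqrt (det (\<chi> i j. model_metric \<psi> x (axis i 1) (axis j 1))) = \<bar>q ^ (n - 1)\<bar>"
    by (simp only: real_sqrt_abs)
  also have "\<dots> = dens (norm x)"
    using False \<psi>_pos[of "norm x"] by (simp add: dens_def q_def)
  finally show ?thesis .
qed

lemma dens_measurable [measurable]: "(\<lambda>x::real^'n::finite. dens (norm x)) \<in> borel_measurable borel"
  by (intro borel_measurable_continuous_onI radial_cont dens_cont)

lemma tang_measurable [measurable]: "(\<lambda>x::real^'n::finite. tang (norm x)) \<in> borel_measurable borel"
  by (intro borel_measurable_continuous_onI radial_cont tang_cont)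

abbreviation vol :: "(real ^ 'n::finite) measure" where
  "vol \<equiv> volume_measure (model_metric \<psi>)"

abbreviation dirichlet :: "(real ^ 'n::finite \<Rightarrow> real) \<Rightarrow> real" where
  "dirichlet \<equiv> dirichlet_energy (model_metric \<psi>)"

lemma volume_measure_eq:
  assumes "n = CARD('n::finite)"
  shows "volume_measure (model_metric \<psi> :: 'n metric) = density lborel (\<lambda>x. ennreal (dens (norm x)))"
  unfolding volume_measure_def sqrt_det_model_metric[OF assms] ..

lemma LINT_volume:
  fixes f :: "real^'n::finite \<Rightarrow> real"
  assumes "n = CARD('n)" "f \<in> borel_measurable borel"
  shows "(LINT x|vol. f x) = (LINT x|lborel. dens (norm x) * f x)"
proof -
  have "(LINT x|density lborel (\<lambda>x. ennreal (dens (norm x))). f x) = (LINT x|lborel. dens (norm x) *\<^sub>R f x)"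
  proof (rule integral_density)
    show "f \<in> borel_measurable lborel"
      unfolding measurable_lborel2 by (rule assms(2))
    show "(\<lambda>x::real^'n. dens (norm x)) \<in> borel_measurable lborel"
      unfolding measurable_lborel2 by (rule dens_measurable)
    show "AE x::real^'n in lborel. 0 \<le> dens (norm x)"
      by (rule AE_I2) (rule less_imp_le[OF dens_pos[OF norm_ge_zero]])
  qed
  then show ?thesis unfolding volume_measure_eq[OF assms(1)] by simp
qed

lemma model_metric_left_diff:
  fixes x :: "real^'n::finite"
  shows "model_metric \<psi> x (u - v) z = model_metric \<psi> x u z - model_metric \<psi> x v z"
proof (cases "x = 0")
  case True
  then show ?thesis by (simp add: model_metric_def inner_diff_left)
next
  case False
  then show ?thesis unfolding model_metric_eq[OF False] inner_diff_left by (simp add: algebra_simps)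
qed

lemma model_metric_definite:
  fixes x :: "real^'n::finite"
  assumes z: "model_metric \<psi> x d d = 0"
  shows "d = 0"
proof (cases "x = 0")
  case True
  then show ?thesis using z by (simp add: model_metric_def)
next
  case False
  define e where "e = sgn x"
  define k where "k = (\<psi> (norm x) / norm x)\<^sup>2"
  have k: "k > 0" using False \<psi>_pos[of "norm x"] by (simp add: k_def)
  have z: "(d \<bullet> e)\<^sup>2 + k * (d \<bullet> d - (d \<bullet> e)\<^sup>2) = 0"
    using z unfolding model_metric_eq[OF False] e_def[symmetric] k_def[symmetric] power2_eq_square[of "d \<bullet> e"] .
  have "\<bar>d \<bullet> e\<bar> \<le> norm d * norm e" by (rule Cauchy_Schwarz_ineq2)
  then have "\<bar>d \<bullet> e\<bar> \<le> norm d" using False by (simp add: e_def norm_sgn)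
  then have le: "(d \<bullet> e)\<^sup>2 \<le> d \<bullet> d"
    using power_mono[of "\<bar>d \<bullet> e\<bar>" "norm d" 2] by (simp add: power2_norm_eq_inner)
  then have "k * (d \<bullet> d - (d \<bullet> e)\<^sup>2) \<ge> 0" using k by simp
  then have "(d \<bullet> e)\<^sup>2 = 0" "k * (d \<bullet> d - (d \<bullet> e)\<^sup>2) = 0"
    using z zero_le_power2[of "d \<bullet> e"] by linarith+
  then have "d \<bullet> d = 0" using k by simp
  then show ?thesis by simp
qed

text \<open>
  Raising an index: the radial part of the covector \<open>G\<close> is kept and the tangential part is rescaled.
\<close>
lemma model_metric_dual_vector:
  fixes x :: "real^'n::finite"
  shows "model_metric \<psi> x ((G \<bullet> sgn x) *\<^sub>R sgn x + tang (norm x) *\<^sub>R (G - (G \<bullet> sgn x) *\<^sub>R sgn x)) z = G \<bullet> z"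
proof (cases "x = 0")
  case True
  then show ?thesis by (simp add: model_metric_def tang_def)
next
  case False
  define e where "e = sgn x"
  define t where "t = tang (norm x)"
  define U where "U = (G \<bullet> e) *\<^sub>R e + t *\<^sub>R (G - (G \<bullet> e) *\<^sub>R e)"
  define k where "k = (\<psi> (norm x) / norm x)\<^sup>2"
  have k: "k * t = 1"
    using False \<psi>_pos[of "norm x"] by (simp add: k_def t_def tang_def power_divide)
  have ee: "e \<bullet> e = 1" unfolding e_def using False by (simp add: norm_sgn flip: norm_eq_1)
  have 1: "U \<bullet> e = G \<bullet> e" by (simp add: U_def inner_add_left inner_diff_left ee)
  have "U \<bullet> z = (G \<bullet> e) * (e \<bullet> z) + t * (G \<bullet> z - (G \<bullet> e) * (e \<bullet> z))"
    unfolding U_def inner_add_left inner_diff_left inner_scaleR_left ..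
  then have 2: "U \<bullet> z - (U \<bullet> e) * (z \<bullet> e) = t * (G \<bullet> z - (G \<bullet> e) * (z \<bullet> e))"
    unfolding 1 inner_commute[of e z] by simp
  have "model_metric \<psi> x U z = (U \<bullet> e) * (z \<bullet> e) + k * (U \<bullet> z - (U \<bullet> e) * (z \<bullet> e))"
    unfolding model_metric_eq[OF False] k_def e_def ..
  also have "\<dots> = (G \<bullet> e) * (z \<bullet> e) + (k * t) * (G \<bullet> z - (G \<bullet> e) * (z \<bullet> e))"
    unfolding 2 unfolding 1 by (simp only: mult.assoc)
  also have "\<dots> = G \<bullet> z" unfolding k by simp
  finally show ?thesis unfolding U_def t_def e_def .
qed

lemma riemannian_gradient_eq:
  fixes \<phi> :: "real^'n::finite \<Rightarrow> real"
  assumes "\<phi> differentiable (at x)"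
  defines "G \<equiv> coord_grad \<phi> x"
  shows "riemannian_gradient (model_metric \<psi>) \<phi> x =
    (G \<bullet> sgn x) *\<^sub>R sgn x + tang (norm x) *\<^sub>R (G - (G \<bullet> sgn x) *\<^sub>R sgn x)" (is "_ = ?U")
proof -
  have D: "frechet_derivative \<phi> (at x) v = G \<bullet> v" for v
    unfolding G_def by (rule frechet_derivative_coord_grad[OF assms(1)])
  show ?thesis
    unfolding riemannian_gradient_def D
  proof (rule the_equality)
    show "\<forall>z. model_metric \<psi> x ?U z = G \<bullet> z" using model_metric_dual_vector by blast
    fix W assume W: "\<forall>z. model_metric \<psi> x W z = G \<bullet> z"
    have "model_metric \<psi> x (W - ?U) (W - ?U) = 0"
      unfolding model_metric_left_diff[of x W ?U] model_metric_dual_vector using W by simp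
    then have "W - ?U = 0" by (rule model_metric_definite)
    then show "W = ?U" by simp
  qed
qed

text \<open>
  The squared Riemannian length of the gradient, split into its radial and its tangential part.
\<close>
definition grad_sq :: "(real^'n::finite \<Rightarrow> real) \<Rightarrow> real^'n \<Rightarrow> real" where
  "grad_sq \<phi> x = (coord_grad \<phi> x \<bullet> sgn x)\<^sup>2 +
     tang (norm x) * (coord_grad \<phi> x \<bullet> coord_grad \<phi> x - (coord_grad \<phi> x \<bullet> sgn x)\<^sup>2)"

lemma riemannian_gradient_norm:
  fixes \<phi> :: "real^'n::finite \<Rightarrow> real"
  assumes "\<phi> differentiable (at x)"
  shows "model_metric \<psi> x (riemannian_gradient (model_metric \<psi>) \<phi> x) (riemannian_gradient (model_metric \<psi>) \<phi> x)
    = grad_sq \<phi> x"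
  unfolding riemannian_gradient_eq[OF assms] model_metric_dual_vector grad_sq_def
  unfolding inner_add_right inner_scaleR_right inner_diff_right power2_eq_square ..

lemma inner_sgn_sq_le: "(v \<bullet> sgn x)\<^sup>2 \<le> v \<bullet> (v::'a::real_inner)"
proof -
  have "\<bar>v \<bullet> sgn x\<bar> \<le> norm v * norm (sgn x)" by (rule Cauchy_Schwarz_ineq2)
  also have "\<dots> \<le> norm v" by (simp add: norm_sgn)
  finally show ?thesis
    using power_mono[of "\<bar>v \<bullet> sgn x\<bar>" "norm v" 2] by (simp add: power2_norm_eq_inner)
qed

lemma grad_sq_ge: "grad_sq \<phi> x \<ge> (coord_grad \<phi> x \<bullet> sgn x)\<^sup>2"
  unfolding grad_sq_def using inner_sgn_sq_le[of "coord_grad \<phi> x" x] tang_nonneg[of "norm x"]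
  by (simp add: mult_nonneg_nonneg)

lemma grad_sq_nonneg: "grad_sq \<phi> x \<ge> 0"
  using grad_sq_ge[of \<phi> x] zero_le_power2 order_trans by blast

lemma coord_grad_measurable: "\<phi> \<in> test_functions \<Longrightarrow> coord_grad \<phi> \<in> borel_measurable borel"
  by (intro borel_measurable_continuous_onI test_function_grad_cont)

lemma sgn_measurable: "(sgn :: real^'n::finite \<Rightarrow> real^'n) \<in> borel_measurable borel"
  unfolding sgn_div_norm[abs_def] by measurable

lemma grad_sq_measurable: "\<phi> \<in> test_functions \<Longrightarrow> grad_sq \<phi> \<in> borel_measurable borel"
  unfolding grad_sq_def [abs_def]
  using coord_grad_measurable[of \<phi>] sgn_measurable tang_measurable
  by (intro borel_measurable_add borel_measurable_power borel_measurable_times borel_measurable_diff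
      borel_measurable_inner) auto

lemma continuous_atLeast_bounded_above:
  fixes f :: "real \<Rightarrow> real"
  assumes "continuous_on {0..} f"
  obtains M where "M > 0" "\<And>r. 0 \<le> r \<Longrightarrow> r \<le> R \<Longrightarrow> \<bar>f r\<bar> \<le> M"
proof -
  have "bounded (f ` {0..R})"
    by (intro compact_imp_bounded compact_continuous_image continuous_on_subset[OF assms]) auto
  then obtain M where "M > 0" "\<forall>x\<in>{0..R}. \<bar>f x\<bar> \<le> M" by (auto simp: bounded_pos)
  then show ?thesis using that[of M] by simp
qed

text \<open>
  Integrability has to be shown since the Bochner integral of a function that is not integrable is \<open>0\<close>,
  for which no lower bound on the energy could hold.
\<close>
lemma grad_sq_integrable:
  fixes \<phi> :: "real^'n::finite \<Rightarrow> real"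
  assumes \<phi>: "\<phi> \<in> test_functions"
  shows "integrable lborel (\<lambda>x. dens (norm x) * grad_sq \<phi> x)"
proof -
  obtain R where R: "R > 0" "\<And>x. norm x > R \<Longrightarrow> \<phi> x = 0" "\<And>x. norm x > R \<Longrightarrow> coord_grad \<phi> x = 0"
    by (rule test_function_support[OF \<phi>]) (rule that)
  obtain M where M: "M > 0" "\<And>x. norm (coord_grad \<phi> x) \<le> M"
    by (rule continuous_compact_support_bounded[where R = R, OF test_function_grad_cont[OF \<phi>] R(3)]) (assumption, rule that)
  obtain D where D: "D > 0" "\<And>r. 0 \<le> r \<Longrightarrow> r \<le> R \<Longrightarrow> \<bar>dens r\<bar> \<le> D"
    by (rule continuous_atLeast_bounded_above[OF dens_cont]) (rule that)
  obtain T where T: "T > 0" "\<And>r. 0 \<le> r \<Longrightarrow> r \<le> R \<Longrightarrow> \<bar>tang r\<bar> \<le> T"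
    by (rule continuous_atLeast_bounded_above[OF tang_cont]) (rule that)
  show ?thesis
  proof (rule integrable_bounded_support[where R = R and B = "D * (M\<^sup>2 + T * M\<^sup>2)"])
    show "(\<lambda>x. dens (norm x) * grad_sq \<phi> x) \<in> borel_measurable borel"
      by (intro borel_measurable_times dens_measurable grad_sq_measurable \<phi>)
    show "dens (norm x) * grad_sq \<phi> x = 0" if "norm x > R" for x
      using R(3)[OF that] by (simp add: grad_sq_def)
    fix x :: "real^'n"
    show "\<bar>dens (norm x) * grad_sq \<phi> x\<bar> \<le> D * (M\<^sup>2 + T * M\<^sup>2)"
    proof (cases "norm x \<le> R")
      case False
      then show ?thesis using R(3)[of x] D(1) T(1) by (simp add: grad_sq_def)
    next
      case True
      have GG: "coord_grad \<phi> x \<bullet> coord_grad \<phi> x \<le> M\<^sup>2"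
        using power_mono[OF M(2)[of x], of 2] by (simp add: power2_norm_eq_inner)
      have s: "(coord_grad \<phi> x \<bullet> sgn x)\<^sup>2 \<le> coord_grad \<phi> x \<bullet> coord_grad \<phi> x"
        by (rule inner_sgn_sq_le)
      have "tang (norm x) * (coord_grad \<phi> x \<bullet> coord_grad \<phi> x - (coord_grad \<phi> x \<bullet> sgn x)\<^sup>2) \<le> T * M\<^sup>2"
      proof (rule mult_mono)
        have "\<bar>tang (norm x)\<bar> \<le> T" using T(2) True by simp
        then show "tang (norm x) \<le> T" by simp
        show "coord_grad \<phi> x \<bullet> coord_grad \<phi> x - (coord_grad \<phi> x \<bullet> sgn x)\<^sup>2 \<le> M\<^sup>2"
          using GG zero_le_power2[of "coord_grad \<phi> x \<bullet> sgn x"] by linarith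
      qed (use T(1) s in auto)
      then have "grad_sq \<phi> x \<le> M\<^sup>2 + T * M\<^sup>2"
        using GG s unfolding grad_sq_def by linarith
      moreover have "\<bar>dens (norm x)\<bar> \<le> D" using D(2) True by simp
      ultimately show ?thesis
        using grad_sq_nonneg[of \<phi> x] D(1) unfolding abs_mult by (intro mult_mono) auto
    qed
  qed
qed

lemma dirichlet_energy_eq:
  fixes \<phi> :: "real^'n::finite \<Rightarrow> real"
  assumes "n = CARD('n)" "\<phi> \<in> test_functions"
  shows "dirichlet \<phi> = (LINT x|lborel. dens (norm x) * grad_sq \<phi> x)"
  unfolding dirichlet_energy_def riemannian_gradient_norm[OF test_function_diff[OF assms(2)]]
  by (rule LINT_volume[OF assms(1) grad_sq_measurable[OF assms(2)]])

lemma weighted_sq_integrable: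
  fixes \<phi> :: "real^'n::finite \<Rightarrow> real"
  assumes \<phi>: "\<phi> \<in> test_functions" and q: "continuous_on {0..} q"
  shows "integrable lborel (\<lambda>x. dens (norm x) * (q (norm x) * (\<phi> x)\<^sup>2))"
proof -
  obtain R where R: "R > 0" "\<And>x. norm x > R \<Longrightarrow> \<phi> x = 0" "\<And>x. norm x > R \<Longrightarrow> coord_grad \<phi> x = 0"
    by (rule test_function_support[OF \<phi>]) (rule that)
  have c: "continuous_on UNIV (\<lambda>x. dens (norm x) * (q (norm x) * (\<phi> x)\<^sup>2))"
    by (intro continuous_intros radial_cont dens_cont q test_function_cont[OF \<phi>])
  have z: "dens (norm x) * (q (norm x) * (\<phi> x)\<^sup>2) = 0" if "norm x > R" for x
    using R(2)[OF that] by simp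
  obtain M where M: "M > 0" "\<And>x. norm (dens (norm x) * (q (norm x) * (\<phi> x)\<^sup>2)) \<le> M"
    by (rule continuous_compact_support_bounded[where R = R, OF c z]) (assumption, rule that)
  show ?thesis
    by (rule integrable_bounded_support[where R = R and B = M])
      (use M(2) z in \<open>auto intro: borel_measurable_continuous_onI[OF c]\<close>)
qed

lemma LINT_weighted_sq:
  fixes \<phi> :: "real^'n::finite \<Rightarrow> real"
  assumes "n = CARD('n)" "\<phi> \<in> test_functions" "continuous_on {0..} q"
  shows "(LINT x|vol. q (norm x) * (\<phi> x)\<^sup>2) =
    (LINT x|lborel. dens (norm x) * (q (norm x) * (\<phi> x)\<^sup>2))"
  by (intro LINT_volume[OF assms(1)] borel_measurable_continuous_onI continuous_intros radial_cont
      assms(3) test_function_cont[OF assms(2)])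

end

section \<open>A Hardy inequality from a radial field of divergence one\<close>

lemma integral_lborel_scale:
  fixes F :: "'a::euclidean_space \<Rightarrow> real"
  assumes "F \<in> borel_measurable borel" "c > 0"
  shows "(LINT x|lborel. F (c *\<^sub>R x)) = (LINT x|lborel. F x) / c ^ DIM('a)"
proof -
  have m: "(\<lambda>x::'a. 0 + c *\<^sub>R x) \<in> measurable lborel borel" by measurable
  have "lborel = density (distr lborel borel (\<lambda>x::'a. 0 + c *\<^sub>R x)) (\<lambda>_. ennreal (\<bar>c\<bar> ^ DIM('a)))"
    using assms(2) by (intro lborel_affine) simp
  then have "(LINT x|lborel. F x) =
      (LINT x|density (distr lborel borel (\<lambda>x::'a. 0 + c *\<^sub>R x)) (\<lambda>_. ennreal (\<bar>c\<bar> ^ DIM('a))). F x)"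
    by simp
  also have "\<dots> = (LINT x|distr lborel borel (\<lambda>x::'a. 0 + c *\<^sub>R x). \<bar>c\<bar> ^ DIM('a) *\<^sub>R F x)"
    by (rule integral_density) (use assms in \<open>auto intro!: AE_I2\<close>)
  also have "\<dots> = (LINT x|lborel. \<bar>c\<bar> ^ DIM('a) *\<^sub>R F (0 + c *\<^sub>R x))"
    by (rule integral_distr[OF m]) (use assms in measurable)
  also have "\<dots> = c ^ DIM('a) * (LINT x|lborel. F (c *\<^sub>R x))"
    using assms(2) by simp
  finally show ?thesis using assms(2) by simp
qed

text \<open>
  The integrated form of Euler's identity: if \<open>K = x \<bullet> \<nabla>F\<close>, the divergence of \<open>F x\<close> is \<open>K\<close> plus the dimension
  times \<open>F\<close>, and it has integral zero. The proof differentiates the scaling law for the integral of \<open>F\<close>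
  under dilations. Only derivatives along rays enter, so \<open>F\<close> need not be differentiable at the origin.
\<close>
lemma integral_radial_derivative:
  fixes F K :: "'a::euclidean_space \<Rightarrow> real"
  assumes F: "F \<in> borel_measurable borel" "\<And>x. \<bar>F x\<bar> \<le> B" "\<And>x. norm x > R \<Longrightarrow> F x = 0"
    and K: "K \<in> borel_measurable borel" "\<And>x. \<bar>K x\<bar> \<le> B" "\<And>x. norm x > R \<Longrightarrow> K x = 0"
    and d: "\<And>x t. x \<noteq> 0 \<Longrightarrow> t > 0 \<Longrightarrow> ((\<lambda>t. F (t *\<^sub>R x)) has_real_derivative K (t *\<^sub>R x) / t) (at t)"
  shows "(LINT x|lborel. K x) = - real DIM('a) * (LINT x|lborel. F x)"
proof -
  define h where "h = (\<lambda>m. inverse (real (Suc m)))"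
  define f where "f = (\<lambda>m x. (F ((1 + h m) *\<^sub>R x) - F x) / h m)"
  have hpos: "h m > 0" for m by (simp add: h_def)
  have hne: "h m \<noteq> 0" for m using hpos[of m] by simp
  have h0: "h \<longlonglongrightarrow> 0" unfolding h_def by (rule LIMSEQ_inverse_real_of_nat)
  have Fi: "integrable lborel F" by (rule integrable_bounded_support[OF F])
  have Fm: "(\<lambda>x. F (c *\<^sub>R x)) \<in> borel_measurable borel" for c using F(1) by measurable
  have Fci: "integrable lborel (\<lambda>x. F ((1 + h m) *\<^sub>R x))" for m
  proof (rule integrable_bounded_support[where R = R and B = B])
    fix x :: 'a assume x: "norm x > R"
    have "norm x \<le> norm ((1 + h m) *\<^sub>R x)"
      using hpos[of m] mult_right_mono[of 1 "1 + h m" "norm x"] by simp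
    then show "F ((1 + h m) *\<^sub>R x) = 0" using x F(3) by simp
  qed (use F Fm in auto)
  have lim: "(\<lambda>m. LINT x|lborel. f m x) \<longlonglongrightarrow> (LINT x|lborel. K x)"
  proof (rule integral_dominated_convergence)
    show "K \<in> borel_measurable lborel" using K(1) by simp
    show "f m \<in> borel_measurable lborel" for m
      unfolding f_def using F(1) Fm by simp
    show "integrable lborel (\<lambda>x::'a. indicator (cball 0 R) x *\<^sub>R B)"
      by (intro integrable_scaleR_left integrable_real_indicator) (use emeasure_lborel_cball_finite in auto)
    have "AE x::'a in lborel. x \<noteq> 0" by (rule AE_lborel_singleton)
    then show "AE x in lborel. (\<lambda>m. f m x) \<longlonglongrightarrow> K x"
    proof eventually_elim
      case (elim x)
      have "((\<lambda>s. (F ((1 + s) *\<^sub>R x) - F (1 *\<^sub>R x)) / s) \<longlongrightarrow> K (1 *\<^sub>R x) / 1) (at 0)"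
        using d[OF elim, of 1] unfolding DERIV_def by simp
      then have "((\<lambda>m. (F ((1 + h m) *\<^sub>R x) - F (1 *\<^sub>R x)) / h m) \<longlonglongrightarrow> K (1 *\<^sub>R x) / 1)"
        by (rule filterlim_compose) (use h0 hne in \<open>auto simp: filterlim_at intro!: always_eventually\<close>)
      then show ?case by (simp add: f_def)
    qed
    fix m
    have "AE x::'a in lborel. x \<noteq> 0" by (rule AE_lborel_singleton)
    then show "AE x in lborel. norm (f m x) \<le> indicator (cball 0 R) x *\<^sub>R B"
    proof eventually_elim
      case (elim x)
      obtain z where z: "1 < z" "z < 1 + h m"
        "F ((1 + h m) *\<^sub>R x) - F (1 *\<^sub>R x) = (1 + h m - 1) * (K (z *\<^sub>R x) / z)"
        using MVT2[of 1 "1 + h m" "\<lambda>t. F (t *\<^sub>R x)" "\<lambda>t. K (t *\<^sub>R x) / t"] d[OF elim] hpos[of m] by auto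
      then have fK: "f m x = K (z *\<^sub>R x) / z" using hpos[of m] by (simp add: f_def)
      show ?case
      proof (cases "norm x > R")
        case True
        have "norm x \<le> norm (z *\<^sub>R x)"
          using z mult_right_mono[of 1 z "norm x"] by simp
        then have "K (z *\<^sub>R x) = 0" using True K(3) by simp
        then show ?thesis using fK True by (simp add: indicator_def)
      next
        case False
        have "\<bar>K (z *\<^sub>R x)\<bar> / z \<le> \<bar>K (z *\<^sub>R x)\<bar>" using z by (simp add: divide_le_eq mult_le_cancel_left1)
        also have "\<dots> \<le> B" by (rule K(2))
        finally show ?thesis using fK False z by (simp add: indicator_def)
      qed
    qed
  qed
  define I where "I = (LINT x|lborel. F x)"
  have "(LINT x|lborel. f m x) = (1 / (1 + h m) ^ DIM('a) - 1) / h m * I" for m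
  proof -
    have "(LINT x|lborel. f m x) = ((LINT x|lborel. F ((1 + h m) *\<^sub>R x)) - I) / h m"
      unfolding f_def I_def using Fi Fci by simp
    also have "(LINT x|lborel. F ((1 + h m) *\<^sub>R x)) = I / (1 + h m) ^ DIM('a)"
      unfolding I_def using hpos[of m] by (intro integral_lborel_scale F) simp
    finally show ?thesis by (simp add: field_simps)
  qed
  moreover have "(\<lambda>m. (1 / (1 + h m) ^ DIM('a) - 1) / h m * I) \<longlonglongrightarrow> - real DIM('a) * I"
  proof (rule tendsto_mult[OF _ tendsto_const])
    have "((\<lambda>t. (inverse t) ^ DIM('a)) has_real_derivative - real DIM('a)) (at 1)"
      by (auto intro!: derivative_eq_intros)
    then have "((\<lambda>s. ((inverse (1 + s)) ^ DIM('a) - (inverse 1) ^ DIM('a)) / s) \<longlongrightarrow> - real DIM('a)) (at 0)"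
      unfolding DERIV_def .
    then have "(\<lambda>m. ((inverse (1 + h m)) ^ DIM('a) - (inverse 1) ^ DIM('a)) / h m) \<longlonglongrightarrow> - real DIM('a)"
      by (rule filterlim_compose) (use h0 hne in \<open>auto simp: filterlim_at intro!: always_eventually\<close>)
    then show "(\<lambda>m. (1 / (1 + h m) ^ DIM('a) - 1) / h m) \<longlonglongrightarrow> - real DIM('a)"
      by (simp add: inverse_eq_divide power_one_over)
  qed
  ultimately have "(\<lambda>m. LINT x|lborel. f m x) \<longlonglongrightarrow> - real DIM('a) * I" by simp
  with lim show ?thesis unfolding I_def by (rule LIMSEQ_unique)
qed

context radial_weight
begin

definition ratio :: "real \<Rightarrow> real" where "ratio r = V r / w r"

lemma ratio_bounds: assumes "r \<ge> 0" shows "0 \<le> ratio r" "ratio r \<le> r"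
  using V_nonneg[OF assms] w_nonneg[OF assms] V_le[OF assms] w_pos[of r] assms
  by (cases "r = 0"; simp add: ratio_def divide_le_eq)+

lemma ratio_cont: "continuous_on {0..} ratio"
proof -
  have "continuous (at r within {0..}) ratio" if r: "r \<ge> 0" for r
  proof (cases "r = 0")
    case True
    have "(ratio \<longlongrightarrow> 0) (at 0 within {0..})"
    proof (rule Lim_null_comparison)
      show "\<forall>\<^sub>F x in at 0 within {0..}. norm (ratio x) \<le> x"
        using ratio_bounds by (auto simp: eventually_at_filter)
    qed (rule tendsto_ident_at)
    then show ?thesis using True by (simp add: continuous_within ratio_def)
  next
    case False
    then have "isCont ratio r"
      unfolding ratio_def[abs_def] using r w_pos[of r] V_deriv[of r] w_deriv[of r]
      by (intro continuous_intros) (auto simp: at_within_atLeast intro: DERIV_isCont)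
    then show ?thesis by (rule continuous_at_imp_continuous_within)
  qed
  then show ?thesis by (simp add: continuous_on_eq_continuous_within)
qed

text \<open>
  The field \<open>(V/w) \<partial>\<^sub>r\<close> has divergence one, because \<open>(w V/w)' = w\<close>; this is integrated against \<open>\<phi>\<^sup>2\<close>. In
  Cartesian coordinates the field times the density is \<open>x V(r)/r\<^sup>n\<close>, so Euler's identity is applied to
  \<open>F = \<phi>\<^sup>2 V(r)/r\<^sup>n\<close>.
\<close>
lemma integral_divergence_identity:
  fixes \<phi> :: "real^'n::finite \<Rightarrow> real"
  assumes n: "n = CARD('n)" and \<phi>: "\<phi> \<in> test_functions"
  shows "(LINT x|lborel. dens (norm x) * (\<phi> x)\<^sup>2) =
     - (LINT x|lborel. dens (norm x) * (2 * \<phi> x * ratio (norm x) * (coord_grad \<phi> x \<bullet> sgn x)))"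
    and "integrable lborel (\<lambda>x. dens (norm x) * (2 * \<phi> x * ratio (norm x) * (coord_grad \<phi> x \<bullet> sgn x)))"
proof -
  obtain R where R: "R > 0" "\<And>x. norm x > R \<Longrightarrow> \<phi> x = 0" "\<And>x. norm x > R \<Longrightarrow> coord_grad \<phi> x = 0"
    by (rule test_function_support[OF \<phi>]) (rule that)
  obtain M1 where M1: "M1 > 0" "\<And>x. norm (\<phi> x) \<le> M1"
    by (rule continuous_compact_support_bounded[where R = R, OF test_function_cont[OF \<phi>] R(2)])
      (assumption, rule that)
  obtain M2 where M2: "M2 > 0" "\<And>x. norm (coord_grad \<phi> x) \<le> M2"
    by (rule continuous_compact_support_bounded[where R = R, OF test_function_grad_cont[OF \<phi>] R(3)])
      (assumption, rule that)
  obtain D where D: "D > 0" "\<And>r. 0 \<le> r \<Longrightarrow> r \<le> R \<Longrightarrow> \<bar>dens r\<bar> \<le> D"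
    by (rule continuous_atLeast_bounded_above[OF dens_cont]) (rule that)
  define h1 where "h1 = (\<lambda>x. dens (norm x) * (\<phi> x)\<^sup>2)"
  define h2 where "h2 = (\<lambda>x. dens (norm x) * (2 * \<phi> x * ratio (norm x) * (coord_grad \<phi> x \<bullet> sgn x)))"
  define Y where "Y = (\<lambda>r. V r / r ^ n)"
  define F where "F = (\<lambda>x. (\<phi> x)\<^sup>2 * Y (norm x))"
  define K where "K = (\<lambda>x. h1 x + h2 x - real n * F x)"
  have n1: "n = Suc (n - 1)" using n3 by simp
  have Ydens: "Y r = dens r * ratio r / r" if "r > 0" for r
  proof -
    have "dens r * r ^ (n - 1) = w r" by (rule dens_eq[OF that])
    moreover have "r ^ n = r * r ^ (n - 1)" by (subst n1) simp
    ultimately show ?thesis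
      using that w_pos[OF that] by (simp add: Y_def ratio_def field_simps)
  qed
  have Y0: "Y 0 = 0" by (simp add: Y_def)
  have Ybound: "0 \<le> Y r \<and> Y r \<le> dens r" if "r \<ge> 0" for r
  proof (cases "r = 0")
    case False
    then have "r > 0" using that by simp
    moreover have "dens r * ratio r \<le> dens r * r"
      using ratio_bounds[OF that] dens_pos[OF that] by (intro mult_left_mono) auto
    ultimately show ?thesis
      using ratio_bounds[OF that] dens_pos[OF that] by (simp add: Ydens divide_le_eq)
  qed (use Y0 dens_pos[of 0] in simp)
  have \<phi>m: "\<phi> \<in> borel_measurable borel"
    by (intro borel_measurable_continuous_onI test_function_cont[OF \<phi>])
  have rm: "(\<lambda>x::real^'n. ratio (norm x)) \<in> borel_measurable borel"
    by (intro borel_measurable_continuous_onI radial_cont ratio_cont)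
  have Ym: "(\<lambda>x::real^'n. Y (norm x)) \<in> borel_measurable borel"
    unfolding Y_def
    by (intro borel_measurable_divide borel_measurable_continuous_onI radial_cont V_cont continuous_intros)
  have h1m: "h1 \<in> borel_measurable borel" unfolding h1_def using \<phi>m dens_measurable by simp
  have h2m: "h2 \<in> borel_measurable borel" unfolding h2_def
    by (intro borel_measurable_times dens_measurable borel_measurable_const \<phi>m rm
        borel_measurable_inner coord_grad_measurable[OF \<phi>] sgn_measurable)
  have Fm: "F \<in> borel_measurable borel" unfolding F_def using \<phi>m Ym by simp
  have h1b: "\<bar>h1 x\<bar> \<le> D * M1\<^sup>2" and h2b: "\<bar>h2 x\<bar> \<le> D * (2 * M1 * R * M2)" and Fb: "\<bar>F x\<bar> \<le> D * M1\<^sup>2" for x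
  proof -
    have "\<bar>h1 x\<bar> \<le> D * M1\<^sup>2 \<and> \<bar>h2 x\<bar> \<le> D * (2 * M1 * R * M2) \<and> \<bar>F x\<bar> \<le> D * M1\<^sup>2"
    proof (cases "norm x \<le> R")
      case False
      then show ?thesis using R D(1) M1(1) M2(1) by (simp add: h1_def h2_def F_def)
    next
      case True
      have d: "\<bar>dens (norm x)\<bar> \<le> D" using D(2) True by simp
      have p: "\<bar>\<phi> x\<bar> \<le> M1" using M1(2)[of x] by simp
      have p2: "(\<phi> x)\<^sup>2 \<le> M1\<^sup>2" using power_mono[OF p, of 2] by simp
      have r: "\<bar>ratio (norm x)\<bar> \<le> R" using ratio_bounds[of "norm x"] True by simp
      have "\<bar>coord_grad \<phi> x \<bullet> sgn x\<bar> \<le> norm (coord_grad \<phi> x) * norm (sgn x)" by (rule Cauchy_Schwarz_ineq2)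
      also have "\<dots> \<le> M2 * 1" using M2 by (intro mult_mono) (auto simp: norm_sgn less_imp_le)
      finally have g: "\<bar>coord_grad \<phi> x \<bullet> sgn x\<bar> \<le> M2" by simp
      have "\<bar>h1 x\<bar> \<le> D * M1\<^sup>2"
        unfolding h1_def abs_mult using d p2 D(1) by (intro mult_mono) auto
      moreover have "\<bar>h2 x\<bar> \<le> D * (2 * M1 * R * M2)"
        unfolding h2_def abs_mult using d p r g D(1) M1(1) M2(1) R(1)
        by (intro mult_mono mult_nonneg_nonneg) auto
      moreover have "Y (norm x) \<le> D" using Ybound[of "norm x"] d by auto
      then have "\<bar>F x\<bar> \<le> M1\<^sup>2 * D"
        unfolding F_def abs_mult using p2 Ybound[of "norm x"] D(1) by (intro mult_mono) auto
      ultimately show ?thesis by (simp add: mult.commute)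
    qed
    then show "\<bar>h1 x\<bar> \<le> D * M1\<^sup>2" "\<bar>h2 x\<bar> \<le> D * (2 * M1 * R * M2)" "\<bar>F x\<bar> \<le> D * M1\<^sup>2" by auto
  qed
  have z: "h1 x = 0" "h2 x = 0" "F x = 0" if "norm x > R" for x
    using R(2)[OF that] by (simp_all add: h1_def h2_def F_def)
  have h1i: "integrable lborel h1" by (rule integrable_bounded_support[OF h1m h1b z(1)])
  show h2i: "integrable lborel (\<lambda>x. dens (norm x) * (2 * \<phi> x * ratio (norm x) * (coord_grad \<phi> x \<bullet> sgn x)))"
    using integrable_bounded_support[OF h2m h2b z(2)] unfolding h2_def .
  have Fi: "integrable lborel F" by (rule integrable_bounded_support[OF Fm Fb z(3)])
  define B where "B = D * M1\<^sup>2 + D * (2 * M1 * R * M2) + real n * (D * M1\<^sup>2)"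
  have nn: "0 \<le> D * M1\<^sup>2" "0 \<le> D * (2 * M1 * R * M2)" "0 \<le> real n * (D * M1\<^sup>2)"
    using D(1) M1(1) M2(1) R(1) by auto
  have "(LINT x|lborel. K x) = - real DIM(real^'n) * (LINT x|lborel. F x)"
  proof (rule integral_radial_derivative[where B = B and R = R])
    show "F \<in> borel_measurable borel" "K \<in> borel_measurable borel"
      unfolding K_def using Fm h1m h2m by auto
    show "F x = 0" "K x = 0" if "norm x > R" for x using z[OF that] by (simp_all add: K_def)
    show "\<bar>F x\<bar> \<le> B" for x using Fb[of x] nn unfolding B_def by linarith
    show "\<bar>K x\<bar> \<le> B" for x
    proof -
      have "\<bar>real n * F x\<bar> \<le> real n * (D * M1\<^sup>2)" unfolding abs_mult using Fb[of x] by (intro mult_mono) auto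
      then show ?thesis using h1b[of x] h2b[of x] unfolding B_def K_def by linarith
    qed
    fix x :: "real^'n" and t :: real assume x: "x \<noteq> 0" and t: "t > 0"
    define r where "r = norm x"
    have r: "r > 0" "t * r > 0" using x t by (auto simp: r_def)
    define g where "g = coord_grad \<phi> (t *\<^sub>R x) \<bullet> x"
    have dphi: "((\<lambda>t. \<phi> (t *\<^sub>R x)) has_real_derivative g) (at t)"
    proof -
      have "((\<lambda>t. t *\<^sub>R x) has_derivative (\<lambda>s. s *\<^sub>R x)) (at t)"
        by (auto intro!: derivative_eq_intros)
      from has_derivative_compose[OF this test_function_has_derivative[OF \<phi>]]
      show ?thesis by (simp add: has_field_derivative_def g_def mult_commute_abs)
    qed
    have dY: "((\<lambda>t. Y (t * r)) has_real_derivative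
        (w (t * r) * r * (t * r) ^ n - V (t * r) * (real n * (t * r) ^ (n - 1) * r)) / ((t * r) ^ n * (t * r) ^ n)) (at t)"
    proof -
      have "(V has_real_derivative w (t * r)) (at (t * r))"
        using V_deriv[of "t * r"] r by (simp add: at_within_atLeast)
      moreover have lin: "((\<lambda>t. t * r) has_real_derivative r) (at t)"
        by (auto intro!: derivative_eq_intros)
      ultimately have "((\<lambda>t. V (t * r)) has_real_derivative w (t * r) * r) (at t)" by (rule DERIV_chain2)
      moreover have "((\<lambda>t. (t * r) ^ n) has_real_derivative real n * (t * r) ^ (n - 1) * r) (at t)"
        using DERIV_power[OF lin, of n] by (rule DERIV_cong) simp
      ultimately show ?thesis unfolding Y_def using r by (intro DERIV_divide) auto
    qed
    have pw: "(t * r) ^ n = (t * r) * (t * r) ^ (n - 1)" by (subst n1) simp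
    define a where "a = (t * r) ^ (n - 1)"
    have a: "a > 0" using r by (simp add: a_def)
    have aw: "dens (t * r) * a = w (t * r)" unfolding a_def by (rule dens_eq) fact
    have "(w (t * r) * r * (t * r) ^ n - V (t * r) * (real n * (t * r) ^ (n - 1) * r)) / ((t * r) ^ n * (t * r) ^ n)
       = (dens (t * r) - real n * Y (t * r)) / t"
      unfolding Y_def pw a_def[symmetric] aw[symmetric] using r t a by (simp add: field_simps)
    with dY have dY: "((\<lambda>t. Y (t * r)) has_real_derivative (dens (t * r) - real n * Y (t * r)) / t) (at t)" by simp
    have eq: "(\<lambda>t. F (t *\<^sub>R x)) = (\<lambda>t. (\<phi> (t *\<^sub>R x))\<^sup>2 * Y (\<bar>t\<bar> * r))" by (simp add: F_def r_def)
    have "((\<lambda>t. (\<phi> (t *\<^sub>R x))\<^sup>2 * Y (t * r)) has_real_derivative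
       2 * \<phi> (t *\<^sub>R x) * g * Y (t * r) + (dens (t * r) - real n * Y (t * r)) / t * (\<phi> (t *\<^sub>R x))\<^sup>2) (at t)"
      by (rule DERIV_mult[OF DERIV_square[OF dphi] dY])
    moreover have "2 * \<phi> (t *\<^sub>R x) * g * Y (t * r) + (dens (t * r) - real n * Y (t * r)) / t * (\<phi> (t *\<^sub>R x))\<^sup>2
       = K (t *\<^sub>R x) / t"
    proof -
      have nt: "norm (t *\<^sub>R x) = t * r" using t by (simp add: r_def)
      define s where "s = coord_grad \<phi> (t *\<^sub>R x) \<bullet> sgn (t *\<^sub>R x)"
      have g: "g = s * r"
        unfolding g_def r_def s_def using t x by (simp add: sgn_scaleR) (simp add: sgn_div_norm)
      have Y: "Y (t * r) * (t * r) = dens (t * r) * ratio (t * r)"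
        using Ydens[OF r(2)] r t by simp
      have "2 * \<phi> (t *\<^sub>R x) * g * Y (t * r) * t = (2 * \<phi> (t *\<^sub>R x) * s) * (Y (t * r) * (t * r))"
        unfolding g by (simp only: mult_ac)
      also have "\<dots> = h2 (t *\<^sub>R x)"
        unfolding Y h2_def nt s_def by (simp only: mult_ac)
      finally have "2 * \<phi> (t *\<^sub>R x) * g * Y (t * r) = h2 (t *\<^sub>R x) / t" using t by (simp add: field_simps)
      then show ?thesis using t unfolding K_def h1_def F_def nt by (simp add: field_simps)
    qed
    ultimately have "((\<lambda>t. (\<phi> (t *\<^sub>R x))\<^sup>2 * Y (t * r)) has_real_derivative K (t *\<^sub>R x) / t) (at t)" by simp
    then show "((\<lambda>t. F (t *\<^sub>R x)) has_real_derivative K (t *\<^sub>R x) / t) (at t)"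
      unfolding eq by (rule has_field_derivative_transform_within_open[where S = "{0<..}"]) (use t in auto)
  qed
  then have "(LINT x|lborel. h1 x) + (LINT x|lborel. h2 x) = 0"
    unfolding K_def using h1i integrable_bounded_support[OF h2m h2b z(2)] Fi by (simp add: n)
  then show "(LINT x|lborel. dens (norm x) * (\<phi> x)\<^sup>2) =
     - (LINT x|lborel. dens (norm x) * (2 * \<phi> x * ratio (norm x) * (coord_grad \<phi> x \<bullet> sgn x)))"
    unfolding h1_def h2_def by simp
qed

text \<open>
  Expand \<open>0 \<le> (\<partial>\<^sub>r\<phi> + c (V/w) \<phi>)\<^sup>2\<close> and replace the integral of the mixed term by means of the divergence
  identity.
\<close>
lemma dirichlet_energy_Hardy:
  fixes \<phi> :: "real^'n::finite \<Rightarrow> real"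
  assumes n: "n = CARD('n)" and \<phi>: "\<phi> \<in> test_functions"
  shows "dirichlet \<phi> \<ge>
    (LINT x|vol. (c - c\<^sup>2 * (ratio (norm x))\<^sup>2) * (\<phi> x)\<^sup>2)"
proof -
  define h1 where "h1 = (\<lambda>x. dens (norm x) * (\<phi> x)\<^sup>2)"
  define h2 where "h2 = (\<lambda>x. dens (norm x) * (2 * \<phi> x * ratio (norm x) * (coord_grad \<phi> x \<bullet> sgn x)))"
  define h3 where "h3 = (\<lambda>x. dens (norm x) * ((ratio (norm x))\<^sup>2 * (\<phi> x)\<^sup>2))"
  have qc: "continuous_on {0..} (\<lambda>r. c - c\<^sup>2 * (ratio r)\<^sup>2)" by (intro continuous_intros ratio_cont)
  have i1: "integrable lborel h1" using weighted_sq_integrable[OF \<phi>, of "\<lambda>_. 1"] by (simp add: h1_def)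
  have i3: "integrable lborel h3" unfolding h3_def
    by (rule weighted_sq_integrable[OF \<phi>, of "\<lambda>r. (ratio r)\<^sup>2"]) (intro continuous_intros ratio_cont)
  have i2: "integrable lborel h2" unfolding h2_def by (rule integral_divergence_identity(2)[OF n \<phi>])
  have eq: "(LINT x|lborel. h1 x) = - (LINT x|lborel. h2 x)"
    unfolding h1_def h2_def by (rule integral_divergence_identity(1)[OF n \<phi>])
  have "(LINT x|vol. (c - c\<^sup>2 * (ratio (norm x))\<^sup>2) * (\<phi> x)\<^sup>2) =
      (LINT x|lborel. dens (norm x) * ((c - c\<^sup>2 * (ratio (norm x))\<^sup>2) * (\<phi> x)\<^sup>2))"
    by (rule LINT_weighted_sq[OF n \<phi> qc])
  also have "\<dots> = (LINT x|lborel. c * h1 x - c\<^sup>2 * h3 x)"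
    by (intro Bochner_Integration.integral_cong refl) (simp add: h1_def h3_def algebra_simps)
  also have "\<dots> = c * (LINT x|lborel. h1 x) - c\<^sup>2 * (LINT x|lborel. h3 x)"
    using i1 i3 by simp
  also have "\<dots> = (LINT x|lborel. - c * h2 x - c\<^sup>2 * h3 x)"
    using i2 i3 eq by simp
  also have "\<dots> \<le> (LINT x|lborel. dens (norm x) * grad_sq \<phi> x)"
  proof (rule integral_mono)
    show "integrable lborel (\<lambda>x. - c * h2 x - c\<^sup>2 * h3 x)" using i2 i3 by simp
    show "integrable lborel (\<lambda>x. dens (norm x) * grad_sq \<phi> x)" by (rule grad_sq_integrable[OF \<phi>])
    fix x :: "real^'n"
    define s where "s = coord_grad \<phi> x \<bullet> sgn x"
    have "0 \<le> (s + c * ratio (norm x) * \<phi> x)\<^sup>2" by simp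
    then have "- c * (2 * \<phi> x * ratio (norm x) * s) - c\<^sup>2 * ((ratio (norm x))\<^sup>2 * (\<phi> x)\<^sup>2) \<le> s\<^sup>2"
      by (simp add: power2_eq_square algebra_simps)
    also have "s\<^sup>2 \<le> grad_sq \<phi> x" unfolding s_def by (rule grad_sq_ge)
    finally have "dens (norm x) * (- c * (2 * \<phi> x * ratio (norm x) * s) - c\<^sup>2 * ((ratio (norm x))\<^sup>2 * (\<phi> x)\<^sup>2))
        \<le> dens (norm x) * grad_sq \<phi> x"
      using dens_pos[of "norm x"] by (intro mult_left_mono) auto
    then show "- c * h2 x - c\<^sup>2 * h3 x \<le> dens (norm x) * grad_sq \<phi> x"
      unfolding h2_def h3_def s_def by (simp add: algebra_simps)
  qed
  finally show ?thesis unfolding dirichlet_energy_eq[OF n \<phi>] .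
qed

end

section \<open>One-dimensional test functions detect instability\<close>

text \<open>
  Polar coordinates for radial integrands: both measures agree on the half-lines, where the left-hand
  side is the volume of a ball.
\<close>
lemma distr_lborel_norm:
  defines "d \<equiv> DIM('a::euclidean_space)"
  assumes "d \<ge> 2"
  shows "distr lborel borel (norm :: 'a \<Rightarrow> real) =
     density lborel (\<lambda>r. ennreal (real d * unit_ball_vol d * r ^ (d - 1)) * indicator {0..} r)"
    (is "?M = ?N")
proof (rule measure_eqI_generator_eq[where \<Omega> = UNIV and E = "range (\<lambda>a::real. {..a})" and A = "\<lambda>i. {..real i}"])
  show "Int_stable (range (\<lambda>a::real. {..a}))"
    by (auto simp: Int_stable_def intro!: exI[of _ "min _ _"])
  show "sets ?M = sigma_sets UNIV (range (\<lambda>a::real. {..a}))" "sets ?N = sigma_sets UNIV (range (\<lambda>a::real. {..a}))"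
    by (simp_all add: borel_eq_atMost[where 'a = real])
  have d0: "d > 0" using assms(2) by simp
  have M: "emeasure ?M {..a} = (if a < 0 then 0 else ennreal (unit_ball_vol d * a ^ d))" for a
  proof -
    have "emeasure ?M {..a} = emeasure lborel (norm -` {..a} :: 'a set)"
      by (subst emeasure_distr) auto
    also have "(norm -` {..a} :: 'a set) = (if a < 0 then {} else cball 0 a)"
    proof (cases "a < 0")
      case True
      then show ?thesis by (auto dest: order.strict_trans1[OF _ True])
    qed auto
    also have "emeasure lborel \<dots> = (if a < 0 then 0 else ennreal (unit_ball_vol d * a ^ d))"
      by (auto simp: emeasure_cball d_def)
    finally show ?thesis .
  qed
  show "emeasure ?M X = emeasure ?N X" if "X \<in> range (\<lambda>a::real. {..a})" for X
  proof -
    obtain a where X: "X = {..a}" using \<open>X \<in> _\<close> by blast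
    have "emeasure ?N {..a} = (\<integral>\<^sup>+r. ennreal (real d * unit_ball_vol d * r ^ (d - 1)) * indicator {0..} r * indicator {..a} r \<partial>lborel)"
      by (subst emeasure_density) auto
    also have "\<dots> = (\<integral>\<^sup>+r. ennreal (real d * unit_ball_vol d * r ^ (d - 1)) * indicator {0..a} r \<partial>lborel)"
      by (intro nn_integral_cong) (auto simp: indicator_def)
    also have "\<dots> = (if a < 0 then 0 else ennreal (unit_ball_vol d * a ^ d))"
    proof (cases "a < 0")
      case False
      have "(\<integral>\<^sup>+r. ennreal (real d * unit_ball_vol d * r ^ (d - 1)) * indicator {0..a} r \<partial>lborel)
         = ennreal (unit_ball_vol d * a ^ d - unit_ball_vol d * 0 ^ d)"
      proof (rule nn_integral_FTC_Icc[where F = "\<lambda>r. unit_ball_vol d * r ^ d"])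
        fix x :: real assume x: "x \<in> {0..a}"
        show "((\<lambda>r. unit_ball_vol d * r ^ d) has_real_derivative real d * unit_ball_vol d * x ^ (d - 1)) (at x)"
          by (auto intro!: derivative_eq_intros)
        show "0 \<le> real d * unit_ball_vol d * x ^ (d - 1)" using x by simp
      qed (use False in auto)
      then show ?thesis using False d0 by simp
    qed simp
    finally show ?thesis using M[of a] X by simp
  qed
  show "(\<Union>i. {..real i}) = UNIV"
    using real_arch_simple by auto
  show "emeasure ?M {..real i} \<noteq> \<infinity>" for i using M[of "real i"] by simp
qed auto

context radial_weight
begin

lemma radial_integral:
  fixes k :: "real \<Rightarrow> real"
  assumes n: "n = CARD('n::finite)" and R: "R \<ge> 0"
    and k: "continuous_on {0..R} k" "\<And>r. r > R \<Longrightarrow> k r = 0"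
  shows "(LINT x::real^'n|lborel. dens (norm x) * k (norm x)) =
      real n * unit_ball_vol n * integral {0..R} (\<lambda>r. w r * k r)"
proof -
  define c where "c = real n * unit_ball_vol n"
  define f where "f = (\<lambda>r. indicator {0..R} r *\<^sub>R (dens r * k r))"
  have "continuous_on {0..R} (\<lambda>r. dens r * k r)"
    by (intro continuous_intros k continuous_on_subset[OF dens_cont]) auto
  then have fm: "f \<in> borel_measurable borel"
    unfolding f_def by (intro borel_measurable_continuous_on_indicator) auto
  have N: "distr lborel borel (norm :: real^'n \<Rightarrow> real) =
     density lborel (\<lambda>r. ennreal (c * r ^ (n - 1)) * indicator {0..} r)"
    using distr_lborel_norm[where 'a = "real^'n"] n3 unfolding c_def n by simp
  also have "(\<lambda>r. ennreal (c * r ^ (n - 1)) * indicator {0..} r) = (\<lambda>r. ennreal (indicator {0..} r * (c * r ^ (n - 1))))"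
    by (auto simp: indicator_def)
  finally have N: "distr lborel borel (norm :: real^'n \<Rightarrow> real) =
     density lborel (\<lambda>r. ennreal (indicator {0..} r * (c * r ^ (n - 1))))" .
  have "(LINT x::real^'n|lborel. dens (norm x) * k (norm x)) = (LINT x::real^'n|lborel. f (norm x))"
    using k(2) by (intro Bochner_Integration.integral_cong) (auto simp: f_def indicator_def)
  also have "\<dots> = (LINT r|distr lborel borel (norm :: real^'n \<Rightarrow> real). f r)"
    using fm by (subst integral_distr) auto
  also have "\<dots> = (LINT r|lborel. (indicator {0..} r * (c * r ^ (n - 1))) *\<^sub>R f r)"
    unfolding N
  proof (rule integral_density)
    show "AE r in lborel. 0 \<le> indicator {0..} r * (c * r ^ (n - 1))"
      by (rule AE_I2) (auto simp: indicator_def c_def)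
  qed (use fm in auto)
  also have "\<dots> = (LINT r|lborel. c * (indicator {0..R} r *\<^sub>R (w r * k r)))"
  proof (intro Bochner_Integration.integral_cong refl)
    fix r :: real
    have "w r = dens r * r ^ (n - 1)" if "r \<ge> 0"
      using dens_eq[of r] that n3 by (cases "r = 0") auto
    then show "(indicator {0..} r * (c * r ^ (n - 1))) *\<^sub>R f r = c * (indicator {0..R} r *\<^sub>R (w r * k r))"
      by (auto simp: f_def indicator_def mult_ac)
  qed
  also have "\<dots> = c * (LINT r:{0..R}|lborel. w r * k r)"
    unfolding set_lebesgue_integral_def by simp
  also have "(LINT r:{0..R}|lborel. w r * k r) = integral {0..R} (\<lambda>r. w r * k r)"
    by (intro set_borel_integral_eq_integral borel_integrable_atLeastAtMost' continuous_intros k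
        continuous_on_subset[OF w_cont]) auto
  finally show ?thesis unfolding c_def .
qed

text \<open>
  For \<open>\<phi>(x) = G(\<bar>x\<bar>\<^sup>2)\<close> the gradient is radial with length \<open>\<bar>2 r G'(r\<^sup>2)\<bar>\<close>.
\<close>
lemma radial_quadratic_form:
  fixes G g q :: "real \<Rightarrow> real"
  assumes n: "n = CARD('n::finite)" and R: "R > 0"
    and G: "\<And>s. (G has_real_derivative g s) (at s)" "continuous_on UNIV g" "\<And>s. s \<ge> R\<^sup>2 \<Longrightarrow> G s = 0" "\<And>s. s \<ge> R\<^sup>2 \<Longrightarrow> g s = 0"
    and t: "(\<lambda>x::real^'n. G (x \<bullet> x)) \<in> test_functions" and q: "continuous_on {0..} q"
  shows "dirichlet (\<lambda>x::real^'n. G (x \<bullet> x)) -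
      (LINT x::real^'n|vol. q (norm x) * (G (x \<bullet> x))\<^sup>2) =
    real n * unit_ball_vol n * integral {0..R} (\<lambda>r. w r * ((g (r\<^sup>2) * (2 * r))\<^sup>2 - q r * (G (r\<^sup>2))\<^sup>2))"
proof -
  have grad: "coord_grad (\<lambda>x::real^'n. G (x \<bullet> x)) x = (2 * g (x \<bullet> x)) *\<^sub>R x" for x
  proof -
    have "frechet_derivative (\<lambda>x::real^'n. G (x \<bullet> x)) (at x) = (\<lambda>v. g (x \<bullet> x) * (2 * (x \<bullet> v)))"
      by (rule frechet_derivative_at[OF has_derivative_radial[OF G(1)], symmetric])
    then show ?thesis by (simp add: coord_grad_def vec_eq_iff inner_axis)
  qed
  have gs: "grad_sq (\<lambda>x::real^'n. G (x \<bullet> x)) x = (g ((norm x)\<^sup>2) * (2 * norm x))\<^sup>2" for x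
  proof -
    have 1: "x \<bullet> sgn x = norm x"
      by (cases "x = 0") (simp_all add: sgn_div_norm power2_norm_eq_inner[symmetric] power2_eq_square)
    have "(((2 * g (x \<bullet> x)) *\<^sub>R x) \<bullet> sgn x)\<^sup>2 = (g ((norm x)\<^sup>2) * (2 * norm x))\<^sup>2"
      by (simp add: 1 power2_norm_eq_inner mult_ac)
    moreover have "((2 * g (x \<bullet> x)) *\<^sub>R x) \<bullet> ((2 * g (x \<bullet> x)) *\<^sub>R x) = (((2 * g (x \<bullet> x)) *\<^sub>R x) \<bullet> sgn x)\<^sup>2"
      by (simp add: 1 power2_norm_eq_inner[symmetric] power2_eq_square)
    ultimately show ?thesis unfolding grad_sq_def grad by simp
  qed
  have Gc: "continuous_on UNIV G" using G(1) by (meson DERIV_isCont continuous_at_imp_continuous_on)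
  have c1: "continuous_on {0..R} (\<lambda>r. (g (r\<^sup>2) * (2 * r))\<^sup>2)"
    by (intro continuous_intros continuous_on_compose2[OF G(2)]) auto
  have c2: "continuous_on {0..R} (\<lambda>r. q r * (G (r\<^sup>2))\<^sup>2)"
    by (intro continuous_intros continuous_on_compose2[OF Gc] continuous_on_subset[OF q]) auto
  have big: "r\<^sup>2 \<ge> R\<^sup>2" if "r > R" for r using that R by (intro power_mono) auto
  have "dirichlet (\<lambda>x::real^'n. G (x \<bullet> x)) =
     (LINT x::real^'n|lborel. dens (norm x) * (g ((norm x)\<^sup>2) * (2 * norm x))\<^sup>2)"
    unfolding dirichlet_energy_eq[OF n t] gs ..
  also have "\<dots> = real n * unit_ball_vol n * integral {0..R} (\<lambda>r. w r * (g (r\<^sup>2) * (2 * r))\<^sup>2)"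
    by (rule radial_integral[OF n]) (use R c1 G(4) big in auto)
  finally have E: "dirichlet (\<lambda>x::real^'n. G (x \<bullet> x)) =
     real n * unit_ball_vol n * integral {0..R} (\<lambda>r. w r * (g (r\<^sup>2) * (2 * r))\<^sup>2)" .
  have "(LINT x::real^'n|vol. q (norm x) * (G (x \<bullet> x))\<^sup>2) =
     (LINT x::real^'n|lborel. dens (norm x) * (q (norm x) * (G ((norm x)\<^sup>2))\<^sup>2))"
    using LINT_weighted_sq[OF n t q] by (simp add: power2_norm_eq_inner)
  also have "\<dots> = real n * unit_ball_vol n * integral {0..R} (\<lambda>r. w r * (q r * (G (r\<^sup>2))\<^sup>2))"
    by (rule radial_integral[OF n]) (use R c2 G(3) big in auto)
  finally have P: "(LINT x::real^'n|vol. q (norm x) * (G (x \<bullet> x))\<^sup>2) =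
    real n * unit_ball_vol n * integral {0..R} (\<lambda>r. w r * (q r * (G (r\<^sup>2))\<^sup>2))" .
  have wc: "continuous_on {0..R} w" by (rule continuous_on_subset[OF w_cont]) auto
  have "integral {0..R} (\<lambda>r. w r * ((g (r\<^sup>2) * (2 * r))\<^sup>2 - q r * (G (r\<^sup>2))\<^sup>2)) =
     integral {0..R} (\<lambda>r. w r * (g (r\<^sup>2) * (2 * r))\<^sup>2 - w r * (q r * (G (r\<^sup>2))\<^sup>2))"
    by (simp only: right_diff_distrib)
  also have "\<dots> = integral {0..R} (\<lambda>r. w r * (g (r\<^sup>2) * (2 * r))\<^sup>2) - integral {0..R} (\<lambda>r. w r * (q r * (G (r\<^sup>2))\<^sup>2))"
    by (rule integral_diff; intro integrable_continuous_real continuous_on_mult wc c1 c2)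
  finally show ?thesis unfolding E P by (simp only: right_diff_distrib)
qed

text \<open>
  A \<open>C\<^sup>1\<close> profile \<open>\<zeta>\<close> on \<open>[0,R]\<close> with a negative form can be replaced by a smooth test function. In the
  variable \<open>s = r\<^sup>2\<close> the derivative \<open>\<zeta>'(r)/(2 r)\<close> is bounded, by the assumption on \<open>C\<close>. It is approximated
  by polynomials times flat cutoffs at \<open>s = R\<^sup>2\<close>; the profiles with these derivatives converge to \<open>\<zeta>\<close>
  and their forms converge by dominated convergence.
\<close>
lemma radial_instability:
  fixes \<zeta> \<zeta>' q :: "real \<Rightarrow> real"
  assumes n: "n = CARD('n::finite)" and R: "R > 0" and q: "continuous_on {0..} q"
    and \<zeta>: "continuous_on {0..R} \<zeta>" "continuous_on {0..R} \<zeta>'" "\<zeta> R = 0"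
    and d: "\<And>r. 0 < r \<Longrightarrow> r < R \<Longrightarrow> (\<zeta> has_real_derivative \<zeta>' r) (at r)"
    and C: "\<And>r. 0 \<le> r \<Longrightarrow> r \<le> R \<Longrightarrow> \<bar>\<zeta>' r\<bar> \<le> C * r"
    and neg: "integral {0..R} (\<lambda>r. w r * ((\<zeta>' r)\<^sup>2 - q r * (\<zeta> r)\<^sup>2)) < 0"
  shows "\<exists>\<phi>\<in>test_functions. dirichlet (\<phi> :: real^'n \<Rightarrow> real) -
      (LINT x|vol. q (norm x) * (\<phi> x)\<^sup>2) < 0"
proof -
  define b where "b = R\<^sup>2"
  have b: "b > 0" using R by (simp add: b_def)
  \<comment> \<open>\<open>\<zeta>'(r)/(2 r)\<close> as a function of \<open>s = r\<^sup>2\<close>, frozen near \<open>s = 0\<close>, where it need not have a limit.\<close>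
  define qm where "qm = (\<lambda>m s. \<zeta>' (sqrt (max s (b / real (Suc m)))) / (2 * sqrt (max s (b / real (Suc m)))))"
  have C0: "C \<ge> 0" using C[of R] R by (smt (verit) abs_ge_zero zero_le_mult_iff)
  have sq: "0 < sqrt (max s (b / real (Suc m)))" "sqrt (max s (b / real (Suc m))) \<le> R" if "s \<le> b" for s m
  proof -
    have "b / real (Suc m) \<le> b" using b by (simp add: divide_le_eq)
    then have "sqrt (max s (b / real (Suc m))) \<le> sqrt b" using that by simp
    also have "sqrt b = R" using R by (simp add: b_def)
    finally show "sqrt (max s (b / real (Suc m))) \<le> R" .
    show "0 < sqrt (max s (b / real (Suc m)))" using b by (simp add: less_max_iff_disj)
  qed
  have qm_cont: "continuous_on {0..b} (qm m)" for m
    unfolding qm_def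
    by (intro continuous_on_divide continuous_on_compose2[OF \<zeta>(2)] continuous_intros)
      (use sq[of _ m] in \<open>force simp: less_imp_le\<close>)+
  have qm_bound: "\<bar>qm m s\<bar> \<le> C / 2" if "s \<le> b" for s m
    using C[of "sqrt (max s (b / real (Suc m)))"] sq[OF that, of m]
    by (simp add: qm_def abs_divide divide_le_eq mult_ac)
  have "\<exists>a N. \<forall>s\<in>{0..b}. \<bar>qm m s - (\<Sum>i\<le>N. a i * s ^ i)\<bar> < inverse (real (Suc m))" for m
  proof -
    obtain P where P: "real_polynomial_function P" "\<And>s. s \<in> {0..b} \<Longrightarrow> \<bar>qm m s - P s\<bar> < inverse (real (Suc m))"
      using Stone_Weierstrass_real_polynomial_function[OF compact_Icc qm_cont[of m], of "inverse (real (Suc m))"]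
      by (metis inverse_positive_iff_positive of_nat_0_less_iff zero_less_Suc)
    from P(1) obtain a N where "P = (\<lambda>s. \<Sum>i\<le>N. a i * s ^ i)"
      by (auto simp: real_polynomial_function_iff_sum)
    then show ?thesis using P(2) by blast
  qed
  then obtain a N where aN: "\<And>m s. s \<in> {0..b} \<Longrightarrow> \<bar>qm m s - (\<Sum>i\<le>N m. a m i * s ^ i)\<bar> < inverse (real (Suc m))"
    by metis
  define H where "H = (\<lambda>m s. (\<Sum>i\<le>N m. a m i * s ^ i) * flat 0 (real (Suc m) * (b - s)))"
  have "\<exists>G. (\<forall>s. (G has_real_derivative H m s) (at s)) \<and> (\<forall>s\<ge>b. G s = 0) \<and>
      (\<lambda>x::real^'n. G (x \<bullet> x)) \<in> test_functions" for m
  proof -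
    have "real (Suc m) > 0" "b \<ge> 0" using b by simp_all
    then show ?thesis unfolding H_def
      by (rule radial_test_function[where 'n = 'n and N = "N m" and a = "a m"]) blast
  qed
  then obtain G where G: "\<And>m s. (G m has_real_derivative H m s) (at s)" "\<And>m s. s \<ge> b \<Longrightarrow> G m s = 0"
      "\<And>m. (\<lambda>x::real^'n. G m (x \<bullet> x)) \<in> test_functions"
    by metis
  have Hc: "continuous_on UNIV (H m)" for m
    unfolding H_def by (intro continuous_intros continuous_on_compose2[OF continuous_on_flat[of UNIV]]) auto
  have H0: "H m s = 0" if "s \<ge> b" for m s
    using that by (simp add: H_def flat_def zero_less_mult_iff)
  define dm where "dm = (\<lambda>m r. H m (r\<^sup>2) * (2 * r))"
  define B where "B = (C / 2 + 1) * (2 * R)"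
  have B: "\<bar>dm m r\<bar> \<le> B" if r: "0 \<le> r" "r \<le> R" for m r
  proof -
    have r2: "r\<^sup>2 \<in> {0..b}" using r power_mono[of r R 2] by (simp add: b_def)
    have "\<bar>\<Sum>i\<le>N m. a m i * (r\<^sup>2) ^ i\<bar> \<le> C / 2 + 1"
      using aN[OF r2, of m] qm_bound[of "r\<^sup>2" m] r2 inverse_le_1_iff[of "real (Suc m)"] by (simp del: of_nat_Suc)
    then have "\<bar>H m (r\<^sup>2)\<bar> \<le> (C / 2 + 1) * 1"
      unfolding H_def abs_mult using flat_0_bounds by (intro mult_mono) auto
    then show ?thesis unfolding dm_def B_def abs_mult using r C0 by (intro mult_mono) auto
  qed
  \<comment> \<open>The pointwise limit of the derivatives: at \<open>R\<close> the cutoffs vanish, so it differs from \<open>\<zeta>'\<close> there.\<close>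
  define z where "z = (\<lambda>r. if r = R then 0 else \<zeta>' r)"
  have lim: "(\<lambda>m. dm m r) \<longlonglongrightarrow> z r" if r: "0 \<le> r" "r \<le> R" for r
  proof -
    consider "r = 0" | "r = R" | "0 < r" "r < R" using r by linarith
    then show ?thesis
    proof cases
      case 1
      then have "z r = 0" using C[of 0] R by (simp add: z_def)
      then show ?thesis using 1 by (simp add: dm_def)
    next
      case 2
      then show ?thesis by (simp add: dm_def z_def H0 b_def)
    next
      case 3
      have r2: "r\<^sup>2 \<in> {0..b}" "r\<^sup>2 < b" "r\<^sup>2 > 0"
        using 3 power_strict_mono[of r R 2] by (auto simp: b_def)
      have e0: "(\<lambda>m. inverse (real (Suc m))) \<longlonglongrightarrow> 0" by (rule LIMSEQ_inverse_real_of_nat)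
      have q: "(\<lambda>m. qm m (r\<^sup>2)) \<longlonglongrightarrow> \<zeta>' r / (2 * r)"
      proof (rule tendsto_eventually)
        have "(\<lambda>m. b * inverse (real (Suc m))) \<longlonglongrightarrow> b * 0" by (intro tendsto_intros e0)
        then have "\<forall>\<^sub>F m in sequentially. b * inverse (real (Suc m)) < r\<^sup>2"
          using r2(3) by (intro order_tendstoD) auto
        then show "\<forall>\<^sub>F m in sequentially. qm m (r\<^sup>2) = \<zeta>' r / (2 * r)"
        proof eventually_elim
          case (elim m)
          then have "max (r\<^sup>2) (b / real (Suc m)) = r\<^sup>2" by (simp add: divide_inverse max_def del: of_nat_Suc)
          then show ?case unfolding qm_def using 3 by simp
        qed
      qed
      have "(\<lambda>m. (\<Sum>i\<le>N m. a m i * (r\<^sup>2) ^ i) - qm m (r\<^sup>2)) \<longlonglongrightarrow> 0"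
        by (rule Lim_null_comparison[OF always_eventually e0])
          (use aN[OF r2(1)] in \<open>auto simp: abs_minus_commute less_imp_le simp del: of_nat_Suc\<close>)
      from tendsto_add[OF this q]
      have P: "(\<lambda>m. \<Sum>i\<le>N m. a m i * (r\<^sup>2) ^ i) \<longlonglongrightarrow> \<zeta>' r / (2 * r)" by simp
      have fl: "(\<lambda>m. flat 0 (real (Suc m) * (b - r\<^sup>2))) \<longlonglongrightarrow> 1"
      proof -
        have "(\<lambda>m. exp (- (inverse (real (Suc m)) * (1 / (b - r\<^sup>2))))) \<longlonglongrightarrow> exp (- (0 * (1 / (b - r\<^sup>2))))"
          by (intro tendsto_intros e0)
        moreover have "flat 0 (real (Suc m) * (b - r\<^sup>2)) = exp (- (inverse (real (Suc m)) * (1 / (b - r\<^sup>2))))" for m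
          using r2(2) by (simp add: flat_def divide_inverse mult.commute del: of_nat_Suc)
        ultimately show ?thesis by simp
      qed
      have "(\<lambda>m. (\<Sum>i\<le>N m. a m i * (r\<^sup>2) ^ i) * flat 0 (real (Suc m) * (b - r\<^sup>2)) * (2 * r)) \<longlonglongrightarrow> \<zeta>' r / (2 * r) * 1 * (2 * r)"
        by (intro tendsto_intros P fl)
      then show ?thesis using 3 by (simp add: dm_def H_def z_def)
    qed
  qed
  have dmc: "continuous_on A (dm m)" for A m
    unfolding dm_def by (intro continuous_intros continuous_on_compose2[OF Hc]) auto
  have G_eq: "G m (r\<^sup>2) = - integral {r..R} (dm m)" if r: "0 \<le> r" "r \<le> R" for m r
  proof -
    have "((dm m) has_integral G m (R\<^sup>2) - G m (r\<^sup>2)) {r..R}"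
    proof (rule fundamental_theorem_of_calculus)
      fix x :: real
      have "((\<lambda>r. G m (r\<^sup>2)) has_real_derivative dm m x) (at x)"
        unfolding dm_def by (rule DERIV_chain2[OF G(1)]) (auto intro!: derivative_eq_intros)
      then show "((\<lambda>r. G m (r\<^sup>2)) has_vector_derivative dm m x) (at x within {r..R})"
        by (simp add: has_real_derivative_iff_has_vector_derivative has_vector_derivative_at_within)
    qed (use r in simp)
    then show ?thesis using G(2)[of b m] by (simp add: b_def integral_unique)
  qed
  have \<zeta>_eq: "\<zeta> r = - integral {r..R} z" if r: "0 \<le> r" "r \<le> R" for r
  proof -
    have "(\<zeta>' has_integral \<zeta> R - \<zeta> r) {r..R}"
      by (rule fundamental_theorem_of_calculus_interior)
        (use r d in \<open>auto intro: continuous_on_subset[OF \<zeta>(1)] simp: has_real_derivative_iff_has_vector_derivative[symmetric]\<close>)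
    then have "integral {r..R} \<zeta>' = - \<zeta> r" using \<zeta>(3) by (simp add: integral_unique)
    moreover have "integral {r..R} \<zeta>' = integral {r..R} z"
      by (rule integral_spike[of "{R}"]) (auto simp: z_def)
    ultimately show ?thesis by simp
  qed
  have Glim: "(\<lambda>m. G m (r\<^sup>2)) \<longlonglongrightarrow> \<zeta> r" if r: "0 \<le> r" "r \<le> R" for r
  proof -
    have "(\<lambda>m. integral {r..R} (dm m)) \<longlonglongrightarrow> integral {r..R} z"
      by (rule dominated_convergence(2)[where h = "\<lambda>_. B"])
        (use B lim r in \<open>auto intro: integrable_continuous_real dmc\<close>)
    then show ?thesis unfolding G_eq[OF r] \<zeta>_eq[OF r] by (rule tendsto_minus)
  qed
  have Gb: "\<bar>G m (r\<^sup>2)\<bar> \<le> B * R" if r: "0 \<le> r" "r \<le> R" for m r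
  proof -
    have "norm (integral {r..R} (dm m)) \<le> B * (R - r)"
      by (rule integral_bound) (use r B dmc in auto)
    also have "\<dots> \<le> B * R" using r C0 R by (intro mult_left_mono) (auto simp: B_def)
    finally show ?thesis unfolding G_eq[OF r] by simp
  qed
  obtain Q where Q: "Q > 0" "\<And>r. 0 \<le> r \<Longrightarrow> r \<le> R \<Longrightarrow> \<bar>q r\<bar> \<le> Q"
    by (rule continuous_atLeast_bounded_above[OF q]) (rule that)
  have Gc: "continuous_on UNIV (G m)" for m using G(1) by (meson DERIV_isCont continuous_at_imp_continuous_on)
  have "(\<lambda>m. integral {0..R} (\<lambda>r. w r * ((dm m r)\<^sup>2 - q r * (G m (r\<^sup>2))\<^sup>2))) \<longlonglongrightarrow>
     integral {0..R} (\<lambda>r. w r * ((z r)\<^sup>2 - q r * (\<zeta> r)\<^sup>2))"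
  proof (rule dominated_convergence(2)[where h = "\<lambda>_. w R * (B\<^sup>2 + Q * (B * R)\<^sup>2)"])
    fix m
    show "(\<lambda>r. w r * ((dm m r)\<^sup>2 - q r * (G m (r\<^sup>2))\<^sup>2)) integrable_on {0..R}"
      by (intro integrable_continuous_real continuous_intros dmc continuous_on_compose2[OF Gc]
          continuous_on_subset[OF w_cont] continuous_on_subset[OF q]) auto
    fix r assume "r \<in> {0..R}"
    then have r: "0 \<le> r" "r \<le> R" by auto
    have "\<bar>(dm m r)\<^sup>2\<bar> \<le> B\<^sup>2" using power_mono[OF B[OF r, of m], of 2] by simp
    moreover have "\<bar>q r * (G m (r\<^sup>2))\<^sup>2\<bar> \<le> Q * (B * R)\<^sup>2"
      unfolding abs_mult using Q r power_mono[OF Gb[OF r, of m], of 2] by (intro mult_mono) auto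
    ultimately have "\<bar>(dm m r)\<^sup>2 - q r * (G m (r\<^sup>2))\<^sup>2\<bar> \<le> B\<^sup>2 + Q * (B * R)\<^sup>2" by linarith
    then show "norm (w r * ((dm m r)\<^sup>2 - q r * (G m (r\<^sup>2))\<^sup>2)) \<le> w R * (B\<^sup>2 + Q * (B * R)\<^sup>2)"
      unfolding real_norm_def abs_mult using w_nonneg[OF r(1)] w_mono[OF r] by (intro mult_mono) auto
  next
    fix r assume "r \<in> {0..R}"
    then have r: "0 \<le> r" "r \<le> R" by auto
    show "(\<lambda>m. w r * ((dm m r)\<^sup>2 - q r * (G m (r\<^sup>2))\<^sup>2)) \<longlonglongrightarrow> w r * ((z r)\<^sup>2 - q r * (\<zeta> r)\<^sup>2)"
      by (intro tendsto_intros lim[OF r] Glim[OF r])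
  qed (rule integrable_const_ivl)
  moreover have "integral {0..R} (\<lambda>r. w r * ((z r)\<^sup>2 - q r * (\<zeta> r)\<^sup>2)) = integral {0..R} (\<lambda>r. w r * ((\<zeta>' r)\<^sup>2 - q r * (\<zeta> r)\<^sup>2))"
    by (rule integral_spike[of "{R}"]) (auto simp: z_def)
  ultimately have "\<forall>\<^sub>F m in sequentially. integral {0..R} (\<lambda>r. w r * ((dm m r)\<^sup>2 - q r * (G m (r\<^sup>2))\<^sup>2)) < 0"
    using neg by (intro order_tendstoD(2)) auto
  then obtain m where m: "integral {0..R} (\<lambda>r. w r * ((dm m r)\<^sup>2 - q r * (G m (r\<^sup>2))\<^sup>2)) < 0"
    by (auto dest: eventually_happens)
  have "real n * unit_ball_vol n > 0" using n3 by simp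
  then have "real n * unit_ball_vol n * integral {0..R} (\<lambda>r. w r * ((H m (r\<^sup>2) * (2 * r))\<^sup>2 - q r * (G m (r\<^sup>2))\<^sup>2)) < 0"
    using m unfolding dm_def by (rule mult_pos_neg)
  moreover have "dirichlet (\<lambda>x::real^'n. G m (x \<bullet> x)) -
      (LINT x::real^'n|vol. q (norm x) * (G m (x \<bullet> x))\<^sup>2) =
    real n * unit_ball_vol n * integral {0..R} (\<lambda>r. w r * ((H m (r\<^sup>2) * (2 * r))\<^sup>2 - q r * (G m (r\<^sup>2))\<^sup>2))"
    using G(2) H0 unfolding b_def by (intro radial_quadratic_form[OF n R G(1) Hc _ _ G(3) q])
  ultimately show ?thesis by (intro bexI[OF _ G(3)[of m]]) simp
qed

section \<open>Forms below the Dirichlet energy and the order of stable solutions\<close>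

text \<open>
  The dimension is passed as a type, since it is not determined by the potential.
\<close>
definition form_bounded :: "'n::finite itself \<Rightarrow> (real \<Rightarrow> real) \<Rightarrow> bool" where
  "form_bounded _ q \<longleftrightarrow> (\<forall>\<phi>\<in>test_functions.
     (LINT x::real^'n|vol. q (norm x) * (\<phi> x)\<^sup>2) \<le> dirichlet \<phi>)"

lemma weighted_sq_volume_integrable:
  fixes \<phi> :: "real^'n::finite \<Rightarrow> real"
  assumes n: "n = CARD('n)" and \<phi>: "\<phi> \<in> test_functions" and q: "continuous_on {0..} q"
  shows "integrable (vol) (\<lambda>x. q (norm x) * (\<phi> x)\<^sup>2)"
proof -
  have "(\<lambda>x::real^'n. q (norm x) * (\<phi> x)\<^sup>2) \<in> borel_measurable lborel"
    unfolding measurable_lborel2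
    by (intro borel_measurable_continuous_onI continuous_intros radial_cont q test_function_cont[OF \<phi>])
  moreover have "(\<lambda>x::real^'n. dens (norm x)) \<in> borel_measurable lborel"
    unfolding measurable_lborel2 by (rule dens_measurable)
  moreover have "AE x::real^'n in lborel. 0 \<le> dens (norm x)"
    by (rule AE_I2) (rule less_imp_le[OF dens_pos[OF norm_ge_zero]])
  ultimately show ?thesis
    unfolding volume_measure_eq[OF n]
    using weighted_sq_integrable[OF \<phi> q] by (subst integrable_density) simp_all
qed

lemma form_bounded_mono:
  assumes n: "n = CARD('n::finite)" and q: "form_bounded TYPE('n) q2" "continuous_on {0..} q1" "continuous_on {0..} q2"
    and le: "\<And>r. r \<ge> 0 \<Longrightarrow> q1 r \<le> q2 r"
  shows "form_bounded TYPE('n) q1"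
  unfolding form_bounded_def
proof
  fix \<phi> :: "real^'n \<Rightarrow> real" assume \<phi>: "\<phi> \<in> test_functions"
  have "(LINT x|vol. q1 (norm x) * (\<phi> x)\<^sup>2) \<le>
      (LINT x|vol. q2 (norm x) * (\<phi> x)\<^sup>2)"
    by (intro integral_mono weighted_sq_volume_integrable n \<phi> q mult_right_mono le) auto
  also have "\<dots> \<le> dirichlet \<phi>"
    using q(1) \<phi> unfolding form_bounded_def by blast
  finally show "(LINT x|vol. q1 (norm x) * (\<phi> x)\<^sup>2) \<le> dirichlet \<phi>" .
qed

lemma form_bounded_convex:
  assumes n: "n = CARD('n::finite)" and q: "form_bounded TYPE('n) q1" "form_bounded TYPE('n) q2"
      "continuous_on {0..} q1" "continuous_on {0..} q2" and s: "0 \<le> s" "s \<le> 1"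
  shows "form_bounded TYPE('n) (\<lambda>r. (1 - s) * q1 r + s * q2 r)"
  unfolding form_bounded_def
proof
  fix \<phi> :: "real^'n \<Rightarrow> real" assume \<phi>: "\<phi> \<in> test_functions"
  let ?E = "dirichlet \<phi>"
  let ?I = "\<lambda>q. LINT x|vol. q (norm x) * (\<phi> x)\<^sup>2"
  have i: "integrable (vol) (\<lambda>x. q1 (norm x) * (\<phi> x)\<^sup>2)"
    "integrable (vol) (\<lambda>x. q2 (norm x) * (\<phi> x)\<^sup>2)"
    by (intro weighted_sq_volume_integrable n \<phi> q)+
  have "?I (\<lambda>r. (1 - s) * q1 r + s * q2 r) =
     (LINT x|vol. (1 - s) * (q1 (norm x) * (\<phi> x)\<^sup>2) + s * (q2 (norm x) * (\<phi> x)\<^sup>2))"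
    by (intro Bochner_Integration.integral_cong refl) (simp add: distrib_right)
  also have "\<dots> = (1 - s) * ?I q1 + s * ?I q2"
    using i by simp
  also have "\<dots> \<le> (1 - s) * ?E + s * ?E"
    using q(1,2) \<phi> s unfolding form_bounded_def by (intro add_mono mult_left_mono) auto
  also have "\<dots> = ?E" by (simp add: algebra_simps)
  finally show "?I (\<lambda>r. (1 - s) * q1 r + s * q2 r) \<le> ?E" .
qed

text \<open>
  A test function has compact support, so on its support the potential is dominated up to an
  arbitrarily small constant.
\<close>
lemma form_bounded_limit:
  assumes n: "n = CARD('n::finite)" and q: "continuous_on {0..} q"
    and lim: "\<And>R e. e > 0 \<Longrightarrow> \<exists>q'. form_bounded TYPE('n) q' \<and> continuous_on {0..} q' \<and>
        (\<forall>r. 0 \<le> r \<longrightarrow> r \<le> R \<longrightarrow> q r \<le> q' r + e)"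
  shows "form_bounded TYPE('n) q"
  unfolding form_bounded_def
proof
  fix \<phi> :: "real^'n \<Rightarrow> real" assume \<phi>: "\<phi> \<in> test_functions"
  let ?E = "dirichlet \<phi>"
  let ?I = "\<lambda>q. LINT x|vol. q (norm x) * (\<phi> x)\<^sup>2"
  obtain R where R: "R > 0" "\<And>x. norm x > R \<Longrightarrow> \<phi> x = 0" "\<And>x. norm x > R \<Longrightarrow> coord_grad \<phi> x = 0"
    by (rule test_function_support[OF \<phi>]) (rule that)
  have I1: "?I (\<lambda>_. 1) \<ge> 0" by (rule Bochner_Integration.integral_nonneg) simp
  show "?I q \<le> ?E"
  proof (rule field_le_epsilon)
    fix d :: real assume d: "d > 0"
    define J where "J = ?I (\<lambda>_. 1)"
    have J: "J \<ge> 0" using I1 by (simp add: J_def)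
    define e where "e = d / (J + 1)"
    have e0: "e > 0" "e * J \<le> d"
      using d J by (simp_all add: e_def divide_le_eq distrib_left)
    then have e: "e > 0" "e * ?I (\<lambda>_. 1) \<le> d" by (simp_all add: J_def)
    obtain q' where q': "form_bounded TYPE('n) q'" "continuous_on {0..} q'"
      "\<And>r. 0 \<le> r \<Longrightarrow> r \<le> R \<Longrightarrow> q r \<le> q' r + e"
      using lim[OF e(1), of R] by blast
    have i: "integrable (vol) (\<lambda>x. q' (norm x) * (\<phi> x)\<^sup>2)"
      "integrable (vol) (\<lambda>x. 1 * (\<phi> x)\<^sup>2)"
      by (intro weighted_sq_volume_integrable[where q = "\<lambda>_. 1"] weighted_sq_volume_integrable n \<phi> q' continuous_on_const)+
    have "?I q \<le> (LINT x|vol. q' (norm x) * (\<phi> x)\<^sup>2 + e * (1 * (\<phi> x)\<^sup>2))"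
    proof (rule integral_mono)
      show "integrable (vol) (\<lambda>x. q (norm x) * (\<phi> x)\<^sup>2)"
        by (intro weighted_sq_volume_integrable n \<phi> q)
      show "integrable (vol) (\<lambda>x. q' (norm x) * (\<phi> x)\<^sup>2 + e * (1 * (\<phi> x)\<^sup>2))"
        using i by simp
      fix x :: "real^'n"
      show "q (norm x) * (\<phi> x)\<^sup>2 \<le> q' (norm x) * (\<phi> x)\<^sup>2 + e * (1 * (\<phi> x)\<^sup>2)"
      proof (cases "norm x \<le> R")
        case True
        then have "q (norm x) * (\<phi> x)\<^sup>2 \<le> (q' (norm x) + e) * (\<phi> x)\<^sup>2"
          using q'(3)[of "norm x"] by (intro mult_right_mono) auto
        then show ?thesis by (simp add: distrib_right)
      qed (use R(2) in simp)
    qed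
    also have "\<dots> = ?I q' + e * ?I (\<lambda>_. 1)" using i by simp
    also have "?I q' \<le> ?E" using q'(1) \<phi> unfolding form_bounded_def by blast
    finally show "?I q \<le> ?E + d" using e(2) by simp
  qed
qed

lemma form_bounded_radial:
  assumes n: "n = CARD('n::finite)" and f: "form_bounded TYPE('n) q" and R: "R > 0" and q: "continuous_on {0..} q"
    and \<zeta>: "continuous_on {0..R} \<zeta>" "continuous_on {0..R} \<zeta>'" "\<zeta> R = 0"
    and d: "\<And>r. 0 < r \<Longrightarrow> r < R \<Longrightarrow> (\<zeta> has_real_derivative \<zeta>' r) (at r)"
    and C: "\<And>r. 0 \<le> r \<Longrightarrow> r \<le> R \<Longrightarrow> \<bar>\<zeta>' r\<bar> \<le> C * r"
  shows "integral {0..R} (\<lambda>r. w r * (q r * (\<zeta> r)\<^sup>2)) \<le> integral {0..R} (\<lambda>r. w r * (\<zeta>' r)\<^sup>2)"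
proof -
  have "\<not> integral {0..R} (\<lambda>r. w r * ((\<zeta>' r)\<^sup>2 - q r * (\<zeta> r)\<^sup>2)) < 0"
  proof
    assume "integral {0..R} (\<lambda>r. w r * ((\<zeta>' r)\<^sup>2 - q r * (\<zeta> r)\<^sup>2)) < 0"
    from radial_instability[OF n R q \<zeta> d C this]
    show False using f unfolding form_bounded_def by force
  qed
  moreover have "integral {0..R} (\<lambda>r. w r * ((\<zeta>' r)\<^sup>2 - q r * (\<zeta> r)\<^sup>2)) =
     integral {0..R} (\<lambda>r. w r * (\<zeta>' r)\<^sup>2 - w r * (q r * (\<zeta> r)\<^sup>2))"
    by (simp only: right_diff_distrib)
  moreover have "\<dots> = integral {0..R} (\<lambda>r. w r * (\<zeta>' r)\<^sup>2) - integral {0..R} (\<lambda>r. w r * (q r * (\<zeta> r)\<^sup>2))"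
    by (rule integral_diff; intro integrable_continuous_real continuous_intros \<zeta>
        continuous_on_subset[OF w_cont] continuous_on_subset[OF q]) auto
  ultimately show ?thesis by simp
qed

lemma form_bounded_Hardy:
  assumes "n = CARD('n::finite)"
  shows "form_bounded TYPE('n) (\<lambda>r. c - c\<^sup>2 * (ratio r)\<^sup>2)"
  unfolding form_bounded_def using dirichlet_energy_Hardy[OF assms] by blast

definition potential :: "real \<Rightarrow> (real \<Rightarrow> real) \<Rightarrow> real \<Rightarrow> real" where
  "potential p u r = p * \<bar>u r\<bar> powr (p - 1)"

lemma abs_powr_cont: "p > 1 \<Longrightarrow> continuous_on UNIV (\<lambda>x::real. p * \<bar>x\<bar> powr (p - 1))"
  by (intro continuous_intros continuous_on_powr') auto

lemma potential_cont: "sol p \<alpha> u u' \<Longrightarrow> continuous_on {0..} (potential p u)"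
  unfolding potential_def [abs_def]
  by (rule continuous_on_compose2[OF abs_powr_cont sol_cont]) (auto simp: sol_p)

lemma is_stable_iff_form_bounded:
  "is_stable (model_metric \<psi> :: 'n::finite metric) p (\<lambda>x. u (norm x)) \<longleftrightarrow> form_bounded TYPE('n) (potential p u)"
proof -
  have "(LINT x::real^'n|vol. potential p u (norm x) * (\<phi> x)\<^sup>2) =
     p * (LINT x::real^'n|vol. \<bar>u (norm x)\<bar> powr (p - 1) * (\<phi> x)\<^sup>2)" for \<phi>
    unfolding potential_def mult.assoc by simp
  then show ?thesis unfolding is_stable_def form_bounded_def by simp
qed

text \<open>
  At the first radius \<open>R\<close> where the order \<open>0 < u < v\<close> fails, \<open>u\<close> or \<open>v - u\<close> vanishes. In either case this
  function, restricted to \<open>[0,R]\<close>, has a negative form for the potential of \<open>v\<close>: by its own equation its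
  energy equals the form of a potential that is strictly smaller than \<open>p v\<^sup>p\<^sup>-\<^sup>1\<close> on \<open>(0,R)\<close>.
\<close>
lemma stable_solutions_ordered:
  assumes n: "n = CARD('n::finite)" and f: "form_bounded TYPE('n) (potential p v)"
    and s: "sol p \<alpha> u u'" and t: "sol p \<beta> v v'" and \<alpha>: "0 < \<alpha>" "\<alpha> < \<beta>" and r: "r \<ge> 0"
  shows "0 < u r \<and> u r < v r"
proof (rule ccontr)
  assume neg: "\<not> (0 < u r \<and> u r < v r)"
  have p: "p > 1" by (rule sol_p[OF s])
  have uc: "continuous_on A u" "continuous_on A u'" "continuous_on A v" "continuous_on A v'" if "A \<subseteq> {0..}" for A
    using that continuous_on_subset sol_cont[OF s] sol_cont[OF t] sol_deriv_cont[OF s] sol_deriv_cont[OF t]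
    by blast+
  have fc: "continuous_on A (\<lambda>r. signed_power p (u r))" "continuous_on A (\<lambda>r. signed_power p (v r))"
    "continuous_on A w" "continuous_on A (potential p v)" if "A \<subseteq> {0..}" for A
    using that continuous_on_subset sol_signed_power_cont[OF s] sol_signed_power_cont[OF t] w_cont potential_cont[OF t]
    by blast+
  define Z where "Z = {x \<in> {0..r}. u x \<le> 0} \<union> {x \<in> {0..r}. v x - u x \<le> 0}"
  have "closed {x \<in> {0..r}. u x \<le> 0}" "closed {x \<in> {0..r}. v x - u x \<le> 0}"
    by (intro continuous_on_closed_Collect_le uc continuous_intros; force)+
  then have "closed Z" unfolding Z_def by (rule closed_Un)
  then have "compact ({0..r} \<inter> Z)" by (intro compact_Int_closed) auto
  moreover have "{0..r} \<inter> Z = Z" by (auto simp: Z_def)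
  ultimately have "compact Z" by simp
  moreover have "Z \<noteq> {}" using neg r by (auto simp: Z_def not_less)
  ultimately have "\<exists>R\<in>Z. \<forall>x\<in>Z. R \<le> x" by (rule compact_attains_inf)
  then obtain R where R: "R \<in> Z" "\<And>x. x \<in> Z \<Longrightarrow> R \<le> x" by blast
  have R0: "0 \<le> R" "R \<le> r" using R(1) by (auto simp: Z_def)
  have at0: "u 0 = \<alpha>" "v 0 = \<beta>" using s t by (simp_all add: sol_def)
  have "0 \<notin> Z" unfolding Z_def using at0 \<alpha> by simp
  then have "R \<noteq> 0" using R(1) by metis
  then have Rpos: "R > 0" using R0 by simp
  have less_both: "0 < u x \<and> u x < v x" if x: "0 \<le> x" "x < R" for x
  proof -
    have "x \<notin> Z" using R(2)[of x] x by auto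
    moreover have "x \<in> {0..r}" using x R0 by simp
    ultimately show ?thesis unfolding Z_def by (simp add: not_le)
  qed
  then have less: "0 < u x" "u x < v x" if "0 \<le> x" "x < R" for x using that by auto
  have sub: "{0..R} \<subseteq> {0..}" by auto
  have lim: "\<And>h::real \<Rightarrow> real. continuous_on {0..R} h \<Longrightarrow> (\<And>x. 0 \<le> x \<Longrightarrow> x < R \<Longrightarrow> h x \<ge> 0) \<Longrightarrow> h R \<ge> 0"
  proof -
    fix h :: "real \<Rightarrow> real" assume h: "continuous_on {0..R} h" "\<And>x. 0 \<le> x \<Longrightarrow> x < R \<Longrightarrow> h x \<ge> 0"
    have "closure {0..<R} = {0..R}" using Rpos by (simp add: closure_atLeastLessThan)
    with h(1) have "continuous_on (closure {0..<R}) h" by simp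
    then show "h R \<ge> 0"
      by (rule continuous_ge_on_closure[where a = 0]) (use h(2) Rpos \<open>closure {0..<R} = {0..R}\<close> in auto)
  qed
  have uR: "u R \<ge> 0" by (rule lim[OF uc(1)[OF sub]]) (use less in \<open>simp add: less_imp_le\<close>)
  have vR: "v R - u R \<ge> 0"
    by (rule lim[OF continuous_on_diff[OF uc(3)[OF sub] uc(1)[OF sub]]]) (use less in \<open>simp add: less_imp_le\<close>)
  obtain M1 where M1: "M1 \<ge> 0" "\<And>r. 0 \<le> r \<Longrightarrow> r \<le> R \<Longrightarrow> \<bar>u' r\<bar> \<le> M1 * r"
    using sol_deriv_bound[OF s R0(1)] by blast
  obtain M2 where M2: "M2 \<ge> 0" "\<And>r. 0 \<le> r \<Longrightarrow> r \<le> R \<Longrightarrow> \<bar>v' r\<bar> \<le> M2 * r"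
    using sol_deriv_bound[OF t R0(1)] by blast
  have ne: "{0<..<R} \<noteq> {}" using Rpos by simp
  consider "u R = 0" | "v R - u R = 0"
    using R(1) uR vR by (auto simp: Z_def)
  then show False
  proof cases
    case 1
    have "integral {0..R} (\<lambda>r. w r * (potential p v r * (u r)\<^sup>2)) \<le> integral {0..R} (\<lambda>r. w r * (u' r)\<^sup>2)"
      by (rule form_bounded_radial[OF n f Rpos potential_cont[OF t], where C = M1])
        (use uc[OF sub] 1 M1 sol_DERIV[OF s] in auto)
    also have "\<dots> = integral {0..R} (\<lambda>r. w r * u' r * u' r)"
      by (simp only: power2_eq_square mult.assoc)
    also have "\<dots> = integral {0..R} (\<lambda>r. w r * signed_power p (u r) * u r)"
      by (rule sol_weak_form[OF s R0(1)]) (use uc[OF sub] 1 sol_DERIV[OF s] in auto)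
    also have "\<dots> < integral {0..R} (\<lambda>r. w r * (potential p v r * (u r)\<^sup>2))"
    proof (rule integral_less_real)
      fix x assume x: "x \<in> {0<..<R}"
      then have ux: "0 < u x" "u x < v x" using less by auto
      have "signed_power p (u x) * u x = \<bar>u x\<bar> powr (p - 1) * (u x)\<^sup>2"
        by (simp add: signed_power_def power2_eq_square)
      also have "\<dots> < p * \<bar>v x\<bar> powr (p - 1) * (u x)\<^sup>2"
      proof (rule mult_strict_right_mono)
        have "\<bar>u x\<bar> powr (p - 1) < \<bar>v x\<bar> powr (p - 1)" using ux p by (intro powr_less_mono2) auto
        also have "\<dots> \<le> p * \<bar>v x\<bar> powr (p - 1)" using p by (simp add: mult_le_cancel_right1)
        finally show "\<bar>u x\<bar> powr (p - 1) < p * \<bar>v x\<bar> powr (p - 1)" .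
      qed (use ux in simp)
      finally show "w x * signed_power p (u x) * u x < w x * (potential p v x * (u x)\<^sup>2)"
        using w_pos[of x] x unfolding potential_def mult.assoc[of "w x"] by (intro mult_strict_left_mono) auto
    qed ((intro continuous_intros uc[OF sub] fc[OF sub])+, rule ne)
    finally show False by simp
  next
    case 2
    have duv: "((\<lambda>r. v r - u r) has_real_derivative v' x - u' x) (at x)" if "0 < x" for x
      by (intro DERIV_diff sol_DERIV[OF s] sol_DERIV[OF t] that)
    have cuv: "continuous_on {0..R} (\<lambda>r. v r - u r)" "continuous_on {0..R} (\<lambda>r. v' r - u' r)"
      by (intro continuous_intros uc[OF sub])+
    have "integral {0..R} (\<lambda>r. w r * (potential p v r * (v r - u r)\<^sup>2)) \<le> integral {0..R} (\<lambda>r. w r * (v' r - u' r)\<^sup>2)"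
    proof (rule form_bounded_radial[OF n f Rpos potential_cont[OF t] cuv 2 duv, where C = "M1 + M2"])
      fix r assume "0 \<le> r" "r \<le> R"
      then show "\<bar>v' r - u' r\<bar> \<le> (M1 + M2) * r"
        using M1(2)[of r] M2(2)[of r] unfolding distrib_right by linarith
    qed
    also have "\<dots> = integral {0..R} (\<lambda>r. w r * v' r * (v' r - u' r) - w r * u' r * (v' r - u' r))"
      by (rule integral_cong) (simp add: power2_eq_square algebra_simps)
    also have "\<dots> = integral {0..R} (\<lambda>r. w r * v' r * (v' r - u' r)) - integral {0..R} (\<lambda>r. w r * u' r * (v' r - u' r))"
      by (rule integral_diff; intro integrable_continuous_real continuous_intros uc[OF sub] fc[OF sub])
    also have "integral {0..R} (\<lambda>r. w r * v' r * (v' r - u' r)) = integral {0..R} (\<lambda>r. w r * signed_power p (v r) * (v r - u r))"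
      by (rule sol_weak_form[OF t R0(1) cuv 2 duv])
    also have "integral {0..R} (\<lambda>r. w r * u' r * (v' r - u' r)) = integral {0..R} (\<lambda>r. w r * signed_power p (u r) * (v r - u r))"
      by (rule sol_weak_form[OF s R0(1) cuv 2 duv])
    also have "integral {0..R} (\<lambda>r. w r * signed_power p (v r) * (v r - u r)) - \<dots> =
      integral {0..R} (\<lambda>r. w r * signed_power p (v r) * (v r - u r) - w r * signed_power p (u r) * (v r - u r))"
      by (rule integral_diff[symmetric]; intro integrable_continuous_real continuous_intros uc[OF sub] fc[OF sub])
    also have "\<dots> < integral {0..R} (\<lambda>r. w r * (potential p v r * (v r - u r)\<^sup>2))"
    proof (rule integral_less_real)
      fix x assume x: "x \<in> {0<..<R}"
      then have ux: "0 < u x" "u x < v x" using less by auto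
      have "(signed_power p (v x) - signed_power p (u x)) * (v x - u x) < (p * \<bar>v x\<bar> powr (p - 1) * (v x - u x)) * (v x - u x)"
        using ux by (intro mult_strict_right_mono signed_power_tangent_less p) auto
      then have "w x * ((signed_power p (v x) - signed_power p (u x)) * (v x - u x)) < w x * (potential p v x * (v x - u x)\<^sup>2)"
        using w_pos[of x] x unfolding potential_def power2_eq_square mult.assoc by (intro mult_strict_left_mono) auto
      then show "w x * signed_power p (v x) * (v x - u x) - w x * signed_power p (u x) * (v x - u x)
          < w x * (potential p v x * (v x - u x)\<^sup>2)"
        by (simp add: left_diff_distrib right_diff_distrib mult.assoc)
    qed ((intro continuous_intros uc[OF sub] fc[OF sub])+, rule ne)
    finally show False by simp
  qed
qed

lemma potential_continuous_dependence:
  assumes p: "p > 1" and e: "e > 0" and A: "A \<ge> 0"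
  obtains d where "d > 0"
    "\<And>\<alpha> \<beta> u u' v v' r. sol p \<alpha> u u' \<Longrightarrow> sol p \<beta> v v' \<Longrightarrow> \<bar>\<alpha>\<bar> \<le> A \<Longrightarrow> \<bar>\<beta>\<bar> \<le> A \<Longrightarrow> \<bar>\<alpha> - \<beta>\<bar> < d \<Longrightarrow>
       0 \<le> r \<Longrightarrow> r \<le> R \<Longrightarrow> \<bar>potential p u r - potential p v r\<bar> < e"
proof -
  have "uniformly_continuous_on {-A..A} (\<lambda>x::real. p * \<bar>x\<bar> powr (p - 1))"
    by (intro compact_uniformly_continuous continuous_on_subset[OF abs_powr_cont[OF p]]) auto
  from this[unfolded uniformly_continuous_on_def, rule_format, OF e]
  obtain c where c: "c > 0" "\<And>x y. x \<in> {-A..A} \<Longrightarrow> y \<in> {-A..A} \<Longrightarrow> dist y x < c \<Longrightarrow>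
      dist (p * \<bar>y\<bar> powr (p - 1)) (p * \<bar>x\<bar> powr (p - 1)) < e"
    by blast
  define K where "K = (1 + p * A powr (p - 1))"
  have K: "K \<ge> 0" using p by (simp add: K_def)
  define d where "d = c / exp (K * R / 2)"
  have d: "d > 0" using c by (simp add: d_def)
  show ?thesis
  proof (rule that[OF d])
    fix \<alpha> \<beta> u u' v v' r
    assume s: "sol p \<alpha> u u'" and t: "sol p \<beta> v v'" and a: "\<bar>\<alpha>\<bar> \<le> A" "\<bar>\<beta>\<bar> \<le> A" "\<bar>\<alpha> - \<beta>\<bar> < d"
      and r: "0 \<le> r" "r \<le> (R::real)"
    have "(u r - v r)\<^sup>2 \<le> (u r - v r)\<^sup>2 + (u' r - v' r)\<^sup>2" by simp
    also have "\<dots> \<le> (\<alpha> - \<beta>)\<^sup>2 * exp (K * r)"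
      unfolding K_def by (rule sol_continuous_dependence[OF s t a(1,2) r(1)])
    also have "\<dots> \<le> (\<alpha> - \<beta>)\<^sup>2 * exp (K * R)"
      using K r by (intro mult_left_mono) (auto intro: mult_left_mono)
    also have "\<dots> = (\<bar>\<alpha> - \<beta>\<bar> * exp (K * R / 2))\<^sup>2"
      by (simp add: power_mult_distrib exp_double[symmetric])
    finally have "\<bar>u r - v r\<bar> \<le> \<bar>\<alpha> - \<beta>\<bar> * exp (K * R / 2)"
      by (subst (asm) abs_le_square_iff[symmetric]) simp
    also have "\<dots> < c" using a(3) by (simp add: d_def pos_less_divide_eq)
    finally have "dist (u r) (v r) < c" by (simp add: dist_real_def)
    moreover have "u r \<in> {-A..A}" "v r \<in> {-A..A}"
      using sol_abs_le[OF s r(1)] sol_abs_le[OF t r(1)] a by auto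
    ultimately have "dist (p * \<bar>u r\<bar> powr (p - 1)) (p * \<bar>v r\<bar> powr (p - 1)) < e" using c(2) by blast
    then show "\<bar>potential p u r - potential p v r\<bar> < e" by (simp add: potential_def dist_real_def)
  qed
qed

end

section \<open>The integral estimate of Farina\<close>

text \<open>
  The first two conditions mean \<open>1 < \<gamma> < 2 p - 1 + 2 sqrt (p (p - 1))\<close>. With \<open>t = p - 1\<close> and
  \<open>S = sqrt (t (t + 1))\<close> the third can be met as well iff \<open>(n - 6) t - 4 < 4 S\<close>. For \<open>n \<le> 10\<close> this holds
  since \<open>S > t\<close>; otherwise squaring leads to a quadratic inequality in \<open>t\<close> whose larger root is the
  Joseph-Lundgren exponent minus one.
\<close>
lemma Joseph_Lundgren_exponent_choice:
  fixes p :: real and n :: nat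
  assumes np: "(3 \<le> n \<and> n \<le> 10 \<and> 1 < p) \<or> (11 \<le> n \<and> 1 < p \<and> p < joseph_lundgren_exponent n)"
  obtains \<gamma> where "\<gamma> > 1" "(\<gamma> + 1)\<^sup>2 < 4 * \<gamma> * p" "real n * (p - 1) < 2 * (p + \<gamma>)"
proof -
  define t where "t = p - 1"
  define S where "S = sqrt (t * (t + 1))"
  define m where "m = real n - 6"
  have t: "t > 0" using np by (auto simp: t_def)
  have S2: "S\<^sup>2 = t * (t + 1)" using t by (simp add: S_def)
  have S: "S > t"
  proof -
    have "sqrt (t * t) < S" unfolding S_def using t by (intro real_sqrt_less_mono) simp
    then show ?thesis using t by simp
  qed
  have key: "m * t - 4 < 4 * S"
  proof (cases "n \<le> 10")
    case True
    then have "m * t \<le> 4 * t" using t by (intro mult_right_mono) (auto simp: m_def)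
    then show ?thesis using S by simp
  next
    case False
    then have n: "n \<ge> 11" "p < joseph_lundgren_exponent n" using np by auto
    show ?thesis
    proof (cases "m * t < 4")
      case True
      then show ?thesis using S t by linarith
    next
      case mt: False
      define s where "s = sqrt (real n - 1)"
      define a where "a = m\<^sup>2 - 16"
      have m: "m \<ge> 5" using n by (simp add: m_def)
      have s2: "s\<^sup>2 = m + 5" using n by (simp add: s_def m_def)
      have s3: "s \<ge> 3" unfolding s_def using n by (intro real_le_rsqrt) auto
      have mm: "m\<^sup>2 \<ge> 25" using power_mono[of 5 m 2] m by simp
      have a: "a > 0" using mm by (simp add: a_def)
      have aeq: "(real n - 2) * (real n - 10) = a" by (simp add: a_def m_def power2_eq_square algebra_simps)
      have "p < ((real n - 2)\<^sup>2 - 4 * real n + 8 * s) / a"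
        using n(2) unfolding joseph_lundgren_exponent_def aeq s_def .
      then have "a * p < (real n - 2)\<^sup>2 - 4 * real n + 8 * s"
        using a by (simp add: pos_less_divide_eq mult.commute)
      then have up: "a * t < 4 * m + 8 + 8 * s"
        by (simp add: t_def a_def m_def power2_eq_square algebra_simps)
      have "4 / m \<le> t" using mt m by (simp add: divide_le_eq mult.commute)
      then have "a * (4 / m) \<le> a * t" using a by (intro mult_left_mono) auto
      moreover have "a * (4 / m) = 4 * m - 64 / m" using m by (simp add: a_def field_simps power2_eq_square)
      moreover have "64 / m \<le> 64 / 5" using m by (intro divide_left_mono) auto
      ultimately have "4 * m - 64 / 5 \<le> a * t" by linarith
      then have low: "4 * m + 8 - 8 * s < a * t" using s3 by linarith
      have "\<bar>a * t - (4 * m + 8)\<bar> < \<bar>8 * s\<bar>" using up low by linarith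
      then have "(a * t - (4 * m + 8))\<^sup>2 < (8 * s)\<^sup>2"
        using power_strict_mono[of "\<bar>a * t - (4 * m + 8)\<bar>" "\<bar>8 * s\<bar>" 2] by simp
      then have "a * (a * t\<^sup>2 - 8 * (m + 2) * t + 16) < 0"
        unfolding power_mult_distrib s2 a_def by (simp add: power2_eq_square algebra_simps)
      then have "a * t\<^sup>2 - 8 * (m + 2) * t + 16 < 0" using a by (simp add: mult_less_0_iff)
      then have "(m * t - 4)\<^sup>2 < (4 * S)\<^sup>2"
        unfolding power_mult_distrib S2 a_def by (simp add: power2_eq_square algebra_simps)
      moreover have "0 \<le> 4 * S" using S t by simp
      ultimately show ?thesis by (rule power2_less_imp_less)
    qed
  qed
  define l where "l = max 1 (real n * (p - 1) / 2 - p)"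
  \<comment> \<open>\<open>g\<close> is the larger root of \<open>(\<gamma> + 1)\<^sup>2 = 4 \<gamma> p\<close>; the smaller root is less than \<open>1\<close>.\<close>
  define g where "g = 2 * t + 1 + 2 * S"
  have "real n * (p - 1) / 2 - p < g" using key unfolding g_def m_def t_def by (simp add: field_simps)
  moreover have "1 < g" using t S by (simp add: g_def)
  ultimately have lg: "l < g" by (simp add: l_def)
  define \<gamma> where "\<gamma> = (l + g) / 2"
  have \<gamma>: "l < \<gamma>" "\<gamma> < g" using lg by (auto simp: \<gamma>_def)
  have \<gamma>1: "\<gamma> > 1" using \<gamma> by (simp add: l_def)
  have "(\<gamma> - (2 * t + 1 - 2 * S)) * (\<gamma> - g) < 0"
    using \<gamma>1 S \<gamma>(2) by (intro mult_pos_neg) auto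
  then have "\<gamma>\<^sup>2 - 2 * (2 * t + 1) * \<gamma> + (2 * t + 1)\<^sup>2 - 4 * S\<^sup>2 < 0"
    unfolding g_def by (simp add: power2_eq_square algebra_simps)
  then have "(\<gamma> + 1)\<^sup>2 < 4 * \<gamma> * p"
    unfolding S2 by (simp add: t_def power2_eq_square algebra_simps)
  moreover have "real n * (p - 1) < 2 * (p + \<gamma>)" using \<gamma>(1) by (simp add: l_def)
  ultimately show ?thesis using that \<gamma>1 by blast
qed

text \<open>
  A \<open>C\<^sup>1\<close> cutoff on \<open>[0,2]\<close>: it equals \<open>1\<close> on \<open>[0,1]\<close> and vanishes at \<open>2\<close>.
\<close>
definition cutoff :: "real \<Rightarrow> real" where "cutoff r = 1 - (max 0 (r - 1))\<^sup>2"
definition cutoff' :: "real \<Rightarrow> real" where "cutoff' r = - 2 * max 0 (r - 1)"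

lemma DERIV_max_square: "((\<lambda>x::real. (max 0 x)\<^sup>2) has_real_derivative 2 * max 0 x) (at x)"
proof (cases x "0::real" rule: linorder_cases)
  case less
  show ?thesis
  proof (rule has_field_derivative_transform_within_open[where S = "{..<0}" and f = "\<lambda>_. 0"])
    show "((\<lambda>_. 0) has_real_derivative 2 * max 0 x) (at x)" using less by simp
    show "0 = (max 0 y)\<^sup>2" if "y \<in> {..<0}" for y :: real using that by simp
  qed (use less in simp_all)
next
  case greater
  show ?thesis
  proof (rule has_field_derivative_transform_within_open[where S = "{0<..}" and f = "\<lambda>x. x\<^sup>2"])
    have "((\<lambda>x::real. x\<^sup>2) has_real_derivative 2 * x) (at x)" by (auto intro!: derivative_eq_intros)
    then show "((\<lambda>x::real. x\<^sup>2) has_real_derivative 2 * max 0 x) (at x)" using greater by simp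
    show "y\<^sup>2 = (max 0 y)\<^sup>2" if "y \<in> {0<..}" for y :: real using that by simp
  qed (use greater in simp_all)
next
  case equal
  have "((\<lambda>x::real. (max 0 x)\<^sup>2) has_real_derivative 0) (at 0)"
    by (rule DERIV_abs_powr_zero[where q = 1]) (auto simp: max_def power2_eq_square)
  then show ?thesis using equal by simp
qed

lemma cutoff_DERIV: "(cutoff has_real_derivative cutoff' r) (at r)"
proof -
  have "((\<lambda>r. (max 0 (r - 1))\<^sup>2) has_real_derivative 2 * max 0 (r - 1) * 1) (at r)"
    by (rule DERIV_chain2[OF DERIV_max_square]) (auto intro!: derivative_eq_intros)
  from DERIV_diff[OF DERIV_const this, of 1] show ?thesis
    unfolding cutoff_def[abs_def] cutoff'_def by simp
qed

lemma cutoff_cont: "continuous_on A cutoff"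
  by (meson cutoff_DERIV DERIV_isCont continuous_at_imp_continuous_on)

lemma cutoff'_cont: "continuous_on A cutoff'"
  unfolding cutoff'_def[abs_def] by (intro continuous_intros)

lemma cutoff_2: "cutoff 2 = 0" by (simp add: cutoff_def)

lemma cutoff_1: "r \<le> 1 \<Longrightarrow> cutoff r = 1" "r \<le> 1 \<Longrightarrow> cutoff' r = 0"
  by (simp_all add: cutoff_def cutoff'_def)

lemma cutoff_bounds:
  assumes "r \<le> 2" shows "0 \<le> cutoff r" "cutoff r \<le> 1"
  using power_mono[of "max 0 (r - 1)" 1 2] assms by (simp_all add: cutoff_def)

lemma cutoff'_bounds: assumes "r \<ge> 0" shows "cutoff' r \<le> 0" "\<bar>cutoff' r\<bar> \<le> 2 * r"
  using assms by (simp_all add: cutoff'_def)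

context radial_weight
begin

text \<open>
  With \<open>A\<close>, \<open>X\<close>, \<open>B\<close>, \<open>D\<close> the integrals of \<open>u\<^sup>\<gamma>\<^sup>-\<^sup>1 u'\<^sup>2 \<eta>\<^sup>2\<close>, \<open>u\<^sup>\<gamma> u' \<eta> \<eta>'\<close>, \<open>u\<^sup>p\<^sup>+\<^sup>\<gamma> \<eta>\<^sup>2\<close> and \<open>u\<^sup>\<gamma>\<^sup>+\<^sup>1 \<eta>'\<^sup>2\<close>, the equation
  gives \<open>\<gamma> A + 2 X = B\<close> and stability gives \<open>p B \<le> (\<gamma> + 1)\<^sup>2/4 A + (\<gamma> + 1) X + D\<close>. Eliminating \<open>A\<close> leaves
  \<open>(p - k) B \<le> m X + D\<close> with \<open>k = (\<gamma> + 1)\<^sup>2/(4 \<gamma>) < p\<close>, and \<open>X\<close> is absorbed by Young's inequality. The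
  constant depends on \<open>p\<close> and \<open>\<gamma>\<close> only, in particular not on the initial value.
\<close>
lemma Farina_estimate:
  assumes n: "n = CARD('n::finite)" and p: "p > 1" and \<gamma>: "\<gamma> > 1" "(\<gamma> + 1)\<^sup>2 < 4 * \<gamma> * p"
  shows "\<exists>C\<ge>0. \<forall>\<alpha> u u'. sol p \<alpha> u u' \<longrightarrow> form_bounded TYPE('n) (potential p u) \<longrightarrow>
      (\<forall>r\<ge>0. u r > 0) \<longrightarrow> (\<forall>r\<ge>0. u' r \<le> 0) \<longrightarrow>
      integral {0..2} (\<lambda>r. w r * (u r powr (p + \<gamma>) * (cutoff r)\<^sup>2)) \<le>
      C * integral {0..2} (\<lambda>r. w r * (u r powr (\<gamma> + 1) * (cutoff' r)\<^sup>2))"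
proof -
  define k where "k = (\<gamma> + 1)\<^sup>2 / (4 * \<gamma>)"
  define m where "m = (\<gamma> + 1) * (\<gamma> - 1) / (2 * \<gamma>)"
  have k: "k < p" using \<gamma> by (simp add: k_def divide_less_eq mult_ac)
  have m: "m > 0" using \<gamma> by (simp add: m_def)
  \<comment> \<open>Chosen so that the \<open>A\<close> term of Young's inequality costs half of the margin \<open>p - k\<close>.\<close>
  define e where "e = \<gamma> * (p - k) / (2 * m)"
  have e: "e > 0" using k m \<gamma> by (simp add: e_def)
  define C where "C = 2 * (1 + m / (4 * e)) / (p - k)"
  have C: "C \<ge> 0" using k m e by (simp add: C_def)
  show ?thesis
  proof (intro exI[of _ C] conjI allI impI, rule C)
    fix \<alpha> u u'
    assume s: "sol p \<alpha> u u'" and f: "form_bounded TYPE('n) (potential p u)"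
      and signs: "\<forall>r\<ge>0. u r > 0" "\<forall>r\<ge>0. u' r \<le> 0"
    have pos: "u r > 0" and dec: "u' r \<le> 0" if "r \<ge> 0" for r using signs that by auto
    have uc: "continuous_on {0..2} u" "continuous_on {0..2} u'" "continuous_on {0..2} w"
      using continuous_on_subset[OF sol_cont[OF s], of "{0..2}"] continuous_on_subset[OF sol_deriv_cont[OF s], of "{0..2}"]
        continuous_on_subset[OF w_cont, of "{0..2}"] by auto
    have pc: "continuous_on {0..2} (\<lambda>r. u r powr q)" for q
    proof (intro continuous_on_powr uc continuous_on_const ballI)
      show "u r \<noteq> 0" if "r \<in> {0..2}" for r using pos[of r] that by simp
    qed
    note cont = uc pc cutoff_cont cutoff'_cont
    define A where "A = integral {0..2} (\<lambda>r. w r * (u r powr (\<gamma> - 1) * (u' r)\<^sup>2 * (cutoff r)\<^sup>2))"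
    define X where "X = integral {0..2} (\<lambda>r. w r * (u r powr \<gamma> * u' r * cutoff r * cutoff' r))"
    define B where "B = integral {0..2} (\<lambda>r. w r * (u r powr (p + \<gamma>) * (cutoff r)\<^sup>2))"
    define D where "D = integral {0..2} (\<lambda>r. w r * (u r powr (\<gamma> + 1) * (cutoff' r)\<^sup>2))"
    have ints: "(\<lambda>r. w r * (u r powr (\<gamma> - 1) * (u' r)\<^sup>2 * (cutoff r)\<^sup>2)) integrable_on {0..2}"
      "(\<lambda>r. w r * (u r powr \<gamma> * u' r * cutoff r * cutoff' r)) integrable_on {0..2}"
      "(\<lambda>r. w r * (u r powr (p + \<gamma>) * (cutoff r)\<^sup>2)) integrable_on {0..2}"
      "(\<lambda>r. w r * (u r powr (\<gamma> + 1) * (cutoff' r)\<^sup>2)) integrable_on {0..2}"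
      by (intro integrable_continuous_real continuous_on_mult continuous_on_power cont)+
    have wn: "w r \<ge> 0" if "r \<in> {0..2}" for r using w_nonneg[of r] that by simp
    have A0: "A \<ge> 0" unfolding A_def by (rule integral_nonneg[OF ints(1)]) (use wn in simp)
    have D0: "D \<ge> 0" unfolding D_def by (rule integral_nonneg[OF ints(4)]) (use wn in simp)
    have B0: "B \<ge> 0" unfolding B_def by (rule integral_nonneg[OF ints(3)]) (use wn in simp)
    have X0: "X \<ge> 0" unfolding X_def
    proof (rule integral_nonneg[OF ints(2)])
      fix r :: real assume r: "r \<in> {0..2}"
      have "u' r * cutoff' r \<ge> 0" using dec[of r] cutoff'_bounds[of r] r by (intro mult_nonpos_nonpos) auto
      moreover have "w r * (u r powr \<gamma> * cutoff r) \<ge> 0"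
        using wn[OF r] cutoff_bounds[of r] r by (intro mult_nonneg_nonneg) auto
      ultimately have "w r * (u r powr \<gamma> * cutoff r) * (u' r * cutoff' r) \<ge> 0" by (metis mult_nonneg_nonneg)
      then show "w r * (u r powr \<gamma> * u' r * cutoff r * cutoff' r) \<ge> 0" by (simp only: mult_ac)
    qed
    have dpow: "((\<lambda>r. u r powr q) has_real_derivative q * u r powr (q - 1) * u' r) (at r)" if "r > 0" for q r
      using pos[of r] that by (auto intro!: derivative_eq_intros sol_DERIV[OF s that])
    \<comment> \<open>The equation tested with \<open>u\<^sup>\<gamma> \<eta>\<^sup>2\<close>.\<close>
    have weak: "\<gamma> * A + 2 * X = B"
    proof -
      define z where "z = (\<lambda>r. u r powr \<gamma> * (cutoff r)\<^sup>2)"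
      define z' where "z' = (\<lambda>r. \<gamma> * u r powr (\<gamma> - 1) * u' r * (cutoff r)\<^sup>2 + 2 * cutoff r * cutoff' r * u r powr \<gamma>)"
      have "integral {0..2} (\<lambda>r. w r * u' r * z' r) = integral {0..2} (\<lambda>r. w r * signed_power p (u r) * z r)"
      proof (rule sol_weak_form[OF s])
        show "continuous_on {0..2} z" unfolding z_def by (intro continuous_on_mult continuous_on_power cont)
        show "continuous_on {0..2} z'" unfolding z'_def
          by (intro continuous_on_add continuous_on_mult continuous_on_power continuous_on_const cont)
        show "(z has_real_derivative z' r) (at r)" if "0 < r" for r
          unfolding z_def z'_def by (rule DERIV_mult[OF dpow[OF that] DERIV_square[OF cutoff_DERIV]])
      qed (auto simp: z_def cutoff_2)
      also have "\<dots> = B" unfolding B_def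
      proof (rule integral_cong)
        fix r :: real assume "r \<in> {0..2}"
        then have "signed_power p (u r) * u r powr \<gamma> = u r powr (p + \<gamma>)"
          using pos[of r] p by (simp add: signed_power_nonneg_eq powr_add)
        then show "w r * signed_power p (u r) * z r = w r * (u r powr (p + \<gamma>) * (cutoff r)\<^sup>2)"
          unfolding z_def by (simp add: mult.assoc flip: \<open>signed_power p (u r) * u r powr \<gamma> = u r powr (p + \<gamma>)\<close>)
      qed
      also have "integral {0..2} (\<lambda>r. w r * u' r * z' r) = integral {0..2} (\<lambda>r.
          \<gamma> * (w r * (u r powr (\<gamma> - 1) * (u' r)\<^sup>2 * (cutoff r)\<^sup>2)) + 2 * (w r * (u r powr \<gamma> * u' r * cutoff r * cutoff' r)))"
        by (rule integral_cong) (simp add: z'_def power2_eq_square algebra_simps)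
      also have "\<dots> = \<gamma> * A + 2 * X"
        unfolding A_def X_def using ints(1,2)
        by (simp add: integral_add integrable_on_mult_right)
      finally show ?thesis .
    qed
    \<comment> \<open>Stability tested with \<open>u\<^sup>h \<eta>\<close>, where \<open>h = (\<gamma> + 1)/2\<close>.\<close>
    have stab: "p * B \<le> ((\<gamma> + 1) / 2)\<^sup>2 * A + (\<gamma> + 1) * X + D"
    proof -
      define h where "h = (\<gamma> + 1) / 2"
      define z where "z = (\<lambda>r. u r powr h * cutoff r)"
      define z' where "z' = (\<lambda>r. h * u r powr (h - 1) * u' r * cutoff r + cutoff' r * u r powr h)"
      obtain M where M: "M \<ge> 0" "\<And>r. 0 \<le> r \<Longrightarrow> r \<le> 2 \<Longrightarrow> \<bar>u' r\<bar> \<le> M * r"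
        using sol_deriv_bound[OF s, of 2] by auto
      have h: "h > 1" using \<gamma> by (simp add: h_def)
      have ua: "u r \<le> \<bar>\<alpha>\<bar>" if "r \<ge> 0" for r using sol_abs_le[OF s that] by simp
      have "integral {0..2} (\<lambda>r. w r * (potential p u r * (z r)\<^sup>2)) \<le> integral {0..2} (\<lambda>r. w r * (z' r)\<^sup>2)"
      proof (rule form_bounded_radial[OF n f _ potential_cont[OF s], where C = "h * \<bar>\<alpha>\<bar> powr (h - 1) * M + 2 * \<bar>\<alpha>\<bar> powr h"])
        show "continuous_on {0..2} z" unfolding z_def by (intro continuous_on_mult cont)
        show "continuous_on {0..2} z'" unfolding z'_def
          by (intro continuous_on_add continuous_on_mult continuous_on_const cont)
        show "(z has_real_derivative z' r) (at r)" if "0 < r" for r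
          unfolding z_def z'_def by (rule DERIV_mult[OF dpow[OF that] cutoff_DERIV])
        fix r :: real assume r: "0 \<le> r" "r \<le> 2"
        have u: "0 < u r" "u r \<le> \<bar>\<alpha>\<bar>" using pos[OF r(1)] ua[OF r(1)] by auto
        have "\<bar>h * u r powr (h - 1) * u' r * cutoff r\<bar> \<le> h * \<bar>\<alpha>\<bar> powr (h - 1) * (M * r) * 1"
          unfolding abs_mult using u h M(2)[OF r] M(1) r cutoff_bounds[OF r(2)]
          by (intro mult_mono) (auto intro: powr_mono2)
        moreover have "\<bar>cutoff' r * u r powr h\<bar> \<le> (2 * r) * \<bar>\<alpha>\<bar> powr h"
          unfolding abs_mult using u h r cutoff'_bounds[OF r(1)] by (intro mult_mono) (auto intro: powr_mono2)
        ultimately show "\<bar>z' r\<bar> \<le> (h * \<bar>\<alpha>\<bar> powr (h - 1) * M + 2 * \<bar>\<alpha>\<bar> powr h) * r"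
          unfolding z'_def by (simp add: algebra_simps)
      qed (auto simp: z_def cutoff_2)
      moreover have "integral {0..2} (\<lambda>r. w r * (potential p u r * (z r)\<^sup>2)) = p * B"
      proof -
        have "integral {0..2} (\<lambda>r. w r * (potential p u r * (z r)\<^sup>2)) = integral {0..2} (\<lambda>r. p * (w r * (u r powr (p + \<gamma>) * (cutoff r)\<^sup>2)))"
        proof (rule integral_cong)
          fix r :: real assume "r \<in> {0..2}"
          then have u: "u r > 0" using pos by simp
          have "u r powr (p - 1) * (u r powr h)\<^sup>2 = u r powr (p + \<gamma>)"
            unfolding power2_eq_square powr_add[symmetric] by (simp add: h_def)
          then have *: "u r powr (p + \<gamma>) = u r powr (p - 1) * (u r powr h)\<^sup>2" ..
          show "w r * (potential p u r * (z r)\<^sup>2) = p * (w r * (u r powr (p + \<gamma>) * (cutoff r)\<^sup>2))"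
            using u unfolding * z_def potential_def by (simp add: power_mult_distrib mult_ac)
        qed
        then show ?thesis unfolding B_def by simp
      qed
      moreover have "integral {0..2} (\<lambda>r. w r * (z' r)\<^sup>2) = h\<^sup>2 * A + 2 * h * X + D"
      proof -
        have "integral {0..2} (\<lambda>r. w r * (z' r)\<^sup>2) = integral {0..2} (\<lambda>r.
           h\<^sup>2 * (w r * (u r powr (\<gamma> - 1) * (u' r)\<^sup>2 * (cutoff r)\<^sup>2)) + 2 * h * (w r * (u r powr \<gamma> * u' r * cutoff r * cutoff' r))
            + w r * (u r powr (\<gamma> + 1) * (cutoff' r)\<^sup>2))"
        proof (rule integral_cong)
          fix r :: real assume "r \<in> {0..2}"
          have "2 * h = \<gamma> + 1" by (simp add: h_def)
          then have hh: "h - 1 + (h - 1) = \<gamma> - 1" "h - 1 + h = \<gamma>" "h + h = \<gamma> + 1"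
            by simp_all
          have 1: "u r powr (\<gamma> - 1) = u r powr (h - 1) * u r powr (h - 1)"
            and 2: "u r powr \<gamma> = u r powr (h - 1) * u r powr h"
            and 3: "u r powr (\<gamma> + 1) = u r powr h * u r powr h"
            unfolding powr_add[symmetric] hh by simp_all
          show "w r * (z' r)\<^sup>2 = h\<^sup>2 * (w r * (u r powr (\<gamma> - 1) * (u' r)\<^sup>2 * (cutoff r)\<^sup>2)) +
              2 * h * (w r * (u r powr \<gamma> * u' r * cutoff r * cutoff' r)) + w r * (u r powr (\<gamma> + 1) * (cutoff' r)\<^sup>2)"
            unfolding 1 2 3 z'_def by (simp add: power2_eq_square algebra_simps)
        qed
        then show ?thesis
          unfolding A_def X_def D_def using ints
          by (simp add: integral_add integrable_add integrable_on_mult_right)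
      qed
      moreover have "2 * h = \<gamma> + 1" by (simp add: h_def)
      ultimately show ?thesis unfolding h_def[symmetric] by simp
    qed
    \<comment> \<open>Young's inequality; the integrand of \<open>X\<close> is a product of square roots of those of \<open>A\<close> and \<open>D\<close>.\<close>
    have young: "X \<le> e * A + D / (4 * e)"
    proof -
      have "X \<le> integral {0..2} (\<lambda>r. e * (w r * (u r powr (\<gamma> - 1) * (u' r)\<^sup>2 * (cutoff r)\<^sup>2)) +
           1 / (4 * e) * (w r * (u r powr (\<gamma> + 1) * (cutoff' r)\<^sup>2)))"
        unfolding X_def
      proof (rule integral_le)
        fix r :: real assume r: "r \<in> {0..2}"
        define a where "a = u r powr ((\<gamma> - 1) / 2) * u' r * cutoff r"
        define b where "b = u r powr ((\<gamma> + 1) / 2) * cutoff' r"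
        have ab: "a * b = u r powr \<gamma> * u' r * cutoff r * cutoff' r"
        proof -
          have "u r powr \<gamma> = u r powr ((\<gamma> - 1) / 2) * u r powr ((\<gamma> + 1) / 2)"
            unfolding powr_add[symmetric] by (simp add: field_simps)
          then show ?thesis unfolding a_def b_def by (simp only: mult_ac)
        qed
        have aa: "a\<^sup>2 = u r powr (\<gamma> - 1) * (u' r)\<^sup>2 * (cutoff r)\<^sup>2"
        proof -
          have "(u r powr ((\<gamma> - 1) / 2))\<^sup>2 = u r powr (\<gamma> - 1)"
            unfolding power2_eq_square powr_add[symmetric] by simp
          then show ?thesis unfolding a_def by (simp add: power_mult_distrib)
        qed
        have bb: "b\<^sup>2 = u r powr (\<gamma> + 1) * (cutoff' r)\<^sup>2"
        proof -
          have "(u r powr ((\<gamma> + 1) / 2))\<^sup>2 = u r powr (\<gamma> + 1)"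
            unfolding power2_eq_square powr_add[symmetric] by simp
          then show ?thesis unfolding b_def by (simp add: power_mult_distrib)
        qed
        have "0 \<le> (2 * e * a - b)\<^sup>2 / (4 * e)" using e by simp
        also have "(2 * e * a - b)\<^sup>2 / (4 * e) = e * a\<^sup>2 - a * b + 1 / (4 * e) * b\<^sup>2"
          using e by (simp add: power2_eq_square field_simps)
        finally have "a * b \<le> e * a\<^sup>2 + 1 / (4 * e) * b\<^sup>2" by simp
        then have "w r * (a * b) \<le> w r * (e * a\<^sup>2 + 1 / (4 * e) * b\<^sup>2)" using wn[OF r] by (rule mult_left_mono)
        then show "w r * (u r powr \<gamma> * u' r * cutoff r * cutoff' r) \<le>
          e * (w r * (u r powr (\<gamma> - 1) * (u' r)\<^sup>2 * (cutoff r)\<^sup>2)) + 1 / (4 * e) * (w r * (u r powr (\<gamma> + 1) * (cutoff' r)\<^sup>2))"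
          unfolding ab aa bb by (simp add: algebra_simps)
      qed (intro integrable_add integrable_on_mult_right ints)+
      also have "\<dots> = e * A + 1 / (4 * e) * D"
        unfolding A_def D_def integral_mult_right[symmetric]
        by (rule integral_add; intro integrable_on_mult_right ints)
      finally show ?thesis by simp
    qed
    have AB: "A \<le> B / \<gamma>" using weak X0 \<gamma> by (simp add: le_divide_eq mult.commute)
    have Aeq: "A = (B - 2 * X) / \<gamma>" using weak \<gamma> by (simp add: eq_divide_eq mult.commute)
    have "((\<gamma> + 1) / 2)\<^sup>2 * A + (\<gamma> + 1) * X + D = k * B + m * X + D"
      unfolding Aeq k_def m_def using \<gamma> by (simp add: field_simps power2_eq_square)
    with stab have 1: "(p - k) * B \<le> m * X + D" by (simp add: algebra_simps)
    have "e * A \<le> e * (B / \<gamma>)" using AB e by (intro mult_left_mono) auto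
    with young have "m * X \<le> m * (e * (B / \<gamma>) + D / (4 * e))" using m by (intro mult_left_mono) auto
    also have "\<dots> = (p - k) / 2 * B + m / (4 * e) * D"
      using \<gamma> m by (simp add: distrib_left) (simp add: e_def field_simps)
    finally have "(p - k) * B \<le> (p - k) / 2 * B + (1 + m / (4 * e)) * D"
      using 1 by (simp add: distrib_right)
    then have "B * (p - k) \<le> 2 * (1 + m / (4 * e)) * D" by (simp add: field_simps)
    then have "B \<le> 2 * (1 + m / (4 * e)) * D / (p - k)" using k by (simp add: le_divide_eq)
    then show "integral {0..2} (\<lambda>r. w r * (u r powr (p + \<gamma>) * (cutoff r)\<^sup>2)) \<le>
      C * integral {0..2} (\<lambda>r. w r * (u r powr (\<gamma> + 1) * (cutoff' r)\<^sup>2))"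
      unfolding B_def[symmetric] D_def[symmetric] C_def by simp
  qed
qed

section \<open>Large initial values and the spectral threshold\<close>

text \<open>
  Suppose all solutions are stable. Then they are positive, decreasing and bounded at \<open>r = 1\<close>
  independently of \<open>\<alpha>\<close>. The right-hand side of Farina's estimate involves only values on \<open>[1,2]\<close>, so the
  left-hand side is bounded by a constant \<open>K\<close>. A large \<open>\<alpha>\<close> contradicts this, since \<open>u \<ge> \<alpha>/2\<close> near the pole.
\<close>
lemma stable_solutions_bounded:
  fixes u u' :: "real \<Rightarrow> real \<Rightarrow> real"
  assumes n: "n = CARD('n::finite)"
    and np: "(3 \<le> n \<and> n \<le> 10 \<and> 1 < p) \<or> (11 \<le> n \<and> 1 < p \<and> p < joseph_lundgren_exponent n)"
    and s: "\<And>\<alpha>. \<alpha> \<ge> 0 \<Longrightarrow> sol p \<alpha> (u \<alpha>) (u' \<alpha>)"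
  shows "\<exists>\<alpha>>0. \<not> form_bounded TYPE('n) (potential p (u \<alpha>))"
proof (rule ccontr)
  assume "\<not> (\<exists>\<alpha>>0. \<not> form_bounded TYPE('n) (potential p (u \<alpha>)))"
  then have st: "form_bounded TYPE('n) (potential p (u \<alpha>))" if "\<alpha> > 0" for \<alpha> using that by blast
  have p: "p > 1" using np by auto
  obtain \<gamma> where \<gamma>: "\<gamma> > 1" "(\<gamma> + 1)\<^sup>2 < 4 * \<gamma> * p" "real n * (p - 1) < 2 * (p + \<gamma>)"
    by (rule Joseph_Lundgren_exponent_choice[OF np]) (rule that)
  have pos: "u \<alpha> r > 0" if "\<alpha> > 0" "r \<ge> 0" for \<alpha> r
    using stable_solutions_ordered[OF n st[of "\<alpha> + 1"] s[of \<alpha>] s[of "\<alpha> + 1"], of r] that by simp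
  have dec: "u' \<alpha> r \<le> 0" if a: "\<alpha> > 0" and r: "r \<ge> 0" for \<alpha> r
  proof (cases "r = 0")
    case True
    then show ?thesis using s[of \<alpha>] a by (simp add: sol_def)
  next
    case False
    have sa: "sol p \<alpha> (u \<alpha>) (u' \<alpha>)" using s a by simp
    have "0 \<le> integral {0..r} (\<lambda>t. w t * signed_power p (u \<alpha> t))"
    proof (rule integral_nonneg)
      show "(\<lambda>t. w t * signed_power p (u \<alpha> t)) integrable_on {0..r}"
        by (intro integrable_continuous_real continuous_on_mult continuous_on_subset[OF w_cont]
            continuous_on_subset[OF sol_signed_power_cont[OF sa]]) auto
      show "0 \<le> w t * signed_power p (u \<alpha> t)" if "t \<in> {0..r}" for t
        using pos[OF a, of t] w_nonneg[of t] that by (simp add: signed_power_def)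
    qed
    then have "w r * u' \<alpha> r \<le> 0" using sol_flux[OF sa r] by simp
    then show ?thesis using w_pos[of r] r False by (simp add: mult_le_0_iff)
  qed
  have anti: "u \<alpha> r \<le> u \<alpha> t" if a: "\<alpha> > 0" and t: "0 \<le> t" "t \<le> r" for \<alpha> r t
  proof (rule DERIV_nonpos_imp_decreasing_open[OF t(2)])
    have sa: "sol p \<alpha> (u \<alpha>) (u' \<alpha>)" using s a by simp
    show "\<exists>y. (u \<alpha> has_real_derivative y) (at x) \<and> y \<le> 0" if "t < x" "x < r" for x
      using sol_DERIV[OF sa, of x] dec[OF a, of x] that t by auto
    show "continuous_on {t..r} (u \<alpha>)" using t by (intro continuous_on_subset[OF sol_cont[OF sa]]) auto
  qed
  define I where "I = integral {0..2} (\<lambda>r. w r * (cutoff' r)\<^sup>2)"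
  have wc: "continuous_on A w" if "A \<subseteq> {0..}" for A using continuous_on_subset[OF w_cont that] .
  have wn: "0 \<le> w r" if "r \<in> {0..2}" for r using that by (intro w_nonneg) simp
  have Ii: "(\<lambda>r. w r * (cutoff' r)\<^sup>2) integrable_on {0..2}"
    by (intro integrable_continuous_real continuous_on_mult continuous_on_power cutoff'_cont wc) auto
  have I0: "I \<ge> 0" unfolding I_def by (rule integral_nonneg[OF Ii]) (use wn in simp)
  define U where "U = (I / (p * V 1)) powr (1 / (p - 1))"
  \<comment> \<open>Stability tested with the cutoff alone bounds \<open>u(1)\<close>, because \<open>u \<ge> u(1)\<close> on \<open>[0,1]\<close>.\<close>
  have u1: "u \<alpha> 1 \<le> U" if a: "\<alpha> > 0" for \<alpha>
  proof -
    have sa: "sol p \<alpha> (u \<alpha>) (u' \<alpha>)" using s a by simp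
    note pc = continuous_on_subset[OF potential_cont[OF sa]]
    have "p * u \<alpha> 1 powr (p - 1) * V 1 = integral {0..1} (\<lambda>r. p * u \<alpha> 1 powr (p - 1) * w r)"
      by (simp add: V_def)
    also have "\<dots> \<le> integral {0..1} (\<lambda>r. w r * (potential p (u \<alpha>) r * (cutoff r)\<^sup>2))"
    proof (rule integral_le)
      show "(\<lambda>r. p * u \<alpha> 1 powr (p - 1) * w r) integrable_on {0..1}"
        by (intro integrable_continuous_real continuous_on_mult continuous_on_const wc) auto
      show "(\<lambda>r. w r * (potential p (u \<alpha>) r * (cutoff r)\<^sup>2)) integrable_on {0..1}"
        by (intro integrable_continuous_real continuous_on_mult continuous_on_power cutoff_cont wc pc) auto
      fix r :: real assume r: "r \<in> {0..1}"
      have "u \<alpha> 1 powr (p - 1) \<le> \<bar>u \<alpha> r\<bar> powr (p - 1)"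
        using anti[OF a, of r 1] pos[OF a, of 1] r p by (intro powr_mono2) auto
      then have "w r * (p * u \<alpha> 1 powr (p - 1)) \<le> w r * (p * \<bar>u \<alpha> r\<bar> powr (p - 1))"
        using p w_nonneg[of r] r by (intro mult_left_mono) auto
      then show "p * u \<alpha> 1 powr (p - 1) * w r \<le> w r * (potential p (u \<alpha>) r * (cutoff r)\<^sup>2)"
        using r by (simp add: cutoff_1 potential_def mult_ac)
    qed
    also have "\<dots> \<le> integral {0..2} (\<lambda>r. w r * (potential p (u \<alpha>) r * (cutoff r)\<^sup>2))"
    proof -
      have i: "(\<lambda>r. w r * (potential p (u \<alpha>) r * (cutoff r)\<^sup>2)) integrable_on {0..b}" for b
        by (intro integrable_continuous_real continuous_on_mult continuous_on_power cutoff_cont wc pc) auto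
      have "0 \<le> w r * (potential p (u \<alpha>) r * (cutoff r)\<^sup>2)" if "r \<in> {0..2}" for r
        using wn[OF that] p by (simp add: potential_def)
      then show ?thesis by (intro integral_subset_le[OF _ i i]) auto
    qed
    also have "\<dots> \<le> I" unfolding I_def
      by (rule form_bounded_radial[OF n st[OF a] _ potential_cont[OF sa], where C = 2])
        (auto intro: cutoff_cont cutoff'_cont cutoff_2 cutoff_DERIV cutoff'_bounds(2))
    finally have "u \<alpha> 1 powr (p - 1) \<le> I / (p * V 1)"
      using p V_pos[of 1] by (simp add: le_divide_eq mult_ac)
    then have "(u \<alpha> 1 powr (p - 1)) powr (1 / (p - 1)) \<le> U"
      unfolding U_def using p by (intro powr_mono2) auto
    then show ?thesis using p pos[OF a, of 1] by (simp add: powr_powr)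
  qed
  obtain C where C: "C \<ge> 0" "\<forall>\<alpha> u u'. sol p \<alpha> u u' \<longrightarrow> form_bounded TYPE('n) (potential p u) \<longrightarrow>
      (\<forall>r\<ge>0. u r > 0) \<longrightarrow> (\<forall>r\<ge>0. u' r \<le> 0) \<longrightarrow>
      integral {0..2} (\<lambda>r. w r * (u r powr (p + \<gamma>) * (cutoff r)\<^sup>2)) \<le>
      C * integral {0..2} (\<lambda>r. w r * (u r powr (\<gamma> + 1) * (cutoff' r)\<^sup>2))"
    using Farina_estimate[OF n p \<gamma>(1,2)] by blast
  define K where "K = C * (U powr (\<gamma> + 1) * I)"
  have K0: "K \<ge> 0" using C(1) I0 by (simp add: K_def)
  have upcont: "continuous_on A (\<lambda>r. u \<alpha> r powr q)" if a: "\<alpha> > 0" and A: "A \<subseteq> {0..}" for \<alpha> q A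
  proof (intro continuous_on_powr continuous_on_const ballI)
    show "continuous_on A (u \<alpha>)" using s[of \<alpha>] a by (intro continuous_on_subset[OF sol_cont A]) auto
    show "u \<alpha> r \<noteq> 0" if "r \<in> A" for r using pos[OF a, of r] that A by auto
  qed
  have upper: "integral {0..2} (\<lambda>r. w r * (u \<alpha> r powr (p + \<gamma>) * (cutoff r)\<^sup>2)) \<le> K" if a: "\<alpha> > 0" for \<alpha>
  proof -
    have sa: "sol p \<alpha> (u \<alpha>) (u' \<alpha>)" using s a by simp
    have "integral {0..2} (\<lambda>r. w r * (u \<alpha> r powr (p + \<gamma>) * (cutoff r)\<^sup>2)) \<le>
      C * integral {0..2} (\<lambda>r. w r * (u \<alpha> r powr (\<gamma> + 1) * (cutoff' r)\<^sup>2))"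
      using C(2) sa st[OF a] pos[OF a] dec[OF a] by blast
    also have "\<dots> \<le> C * integral {0..2} (\<lambda>r. U powr (\<gamma> + 1) * (w r * (cutoff' r)\<^sup>2))"
    proof (intro mult_left_mono integral_le C(1))
      show "(\<lambda>r. w r * (u \<alpha> r powr (\<gamma> + 1) * (cutoff' r)\<^sup>2)) integrable_on {0..2}"
        by (intro integrable_continuous_real continuous_on_mult continuous_on_power cutoff'_cont wc upcont a) auto
      show "(\<lambda>r. U powr (\<gamma> + 1) * (w r * (cutoff' r)\<^sup>2)) integrable_on {0..2}"
        by (intro integrable_on_mult_right Ii)
      fix r :: real assume r: "r \<in> {0..2}"
      show "w r * (u \<alpha> r powr (\<gamma> + 1) * (cutoff' r)\<^sup>2) \<le> U powr (\<gamma> + 1) * (w r * (cutoff' r)\<^sup>2)"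
      proof (cases "r \<le> 1")
        case True
        then show ?thesis by (simp add: cutoff_1)
      next
        case False
        then have "u \<alpha> r powr (\<gamma> + 1) \<le> U powr (\<gamma> + 1)"
          using anti[OF a, of 1 r] u1[OF a] pos[OF a, of r] \<gamma>(1) by (intro powr_mono2) auto
        then have "u \<alpha> r powr (\<gamma> + 1) * (w r * (cutoff' r)\<^sup>2) \<le> U powr (\<gamma> + 1) * (w r * (cutoff' r)\<^sup>2)"
          using wn[OF r] by (intro mult_right_mono) auto
        then show ?thesis by (simp only: mult_ac)
      qed
    qed
    also have "\<dots> = K" by (simp add: K_def I_def)
    finally show ?thesis .
  qed
  obtain r0 where r0: "r0 > 0" "\<And>r. 0 \<le> r \<Longrightarrow> r \<le> r0 \<Longrightarrow> (r / 2) ^ (n - 1) \<le> w r"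
    by (rule w_lower) (rule that)
  \<comment> \<open>The first term of the maximum makes the lower bound exceed \<open>K\<close>, the second makes \<open>r1\<close> so small that
    the cutoff is \<open>1\<close> and the weight is Euclidean up to a constant on \<open>[0,r1]\<close>.\<close>
  define T where "T = min r0 1"
  define \<delta> where "\<delta> = p + \<gamma> - real n * (p - 1) / 2"
  define X where "X = K * (8 ^ n * 2 powr (p + \<gamma>)) + 1"
  define \<alpha> where "\<alpha> = max (X powr (1 / \<delta>)) (T powr (2 / (1 - p)))"
  have T: "T > 0" "T \<le> r0" "T \<le> 1" using r0 by (auto simp: T_def)
  have \<delta>: "\<delta> > 0" using \<gamma>(3) by (simp add: \<delta>_def)
  have X: "X > 0" using K0 by (simp add: X_def add_nonneg_pos)
  have \<alpha>: "\<alpha> > 0" using T by (simp add: \<alpha>_def less_max_iff_disj)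
  have "(X powr (1 / \<delta>)) powr \<delta> \<le> \<alpha> powr \<delta>" using \<delta> by (intro powr_mono2) (auto simp: \<alpha>_def)
  then have \<alpha>X: "X \<le> \<alpha> powr \<delta>" using \<delta> X by (simp add: powr_powr)
  have "\<alpha> powr ((1 - p) / 2) \<le> (T powr (2 / (1 - p))) powr ((1 - p) / 2)"
    using p T by (intro powr_mono2') (auto simp: \<alpha>_def)
  also have "\<dots> = T powr (2 / (1 - p) * ((1 - p) / 2))" by (rule powr_powr)
  also have "2 / (1 - p) * ((1 - p) / 2) = 1" using p by simp
  finally have \<alpha>T: "\<alpha> powr ((1 - p) / 2) \<le> T" using T by simp
  have sa: "sol p \<alpha> (u \<alpha>) (u' \<alpha>)" using s \<alpha> by simp
  define r1 where "r1 = \<alpha> powr ((1 - p) / 2) / 2"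
  have r1: "r1 > 0" "r1 \<le> r0" "r1 \<le> 1" using \<alpha> \<alpha>T T by (auto simp: r1_def)
  have half: "\<alpha> / 2 \<le> u \<alpha> r" if r: "0 < r" "r \<le> r1" for r
  proof -
    obtain z where z: "0 < z" "z < r" "u \<alpha> r - u \<alpha> 0 = u' \<alpha> z * (r - 0)"
    proof (rule mvt[of 0 r "u \<alpha>" "\<lambda>x. (*) (u' \<alpha> x)"])
      show "continuous_on {0..r} (u \<alpha>)" by (intro continuous_on_subset[OF sol_cont[OF sa]]) auto
      show "(u \<alpha> has_derivative (*) (u' \<alpha> x)) (at x)" if "0 < x" for x
        using sol_DERIV[OF sa that] by (simp add: has_field_derivative_def)
    qed (use r in auto)
    have "\<bar>u' \<alpha> z\<bar> \<le> \<alpha> powr p * z"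
    proof (rule sol_flux_bound[OF sa])
      fix t assume "0 \<le> t" "t \<le> z"
      then have "0 < u \<alpha> t" "u \<alpha> t \<le> \<alpha>" using pos[OF \<alpha>, of t] sol_abs_le[OF sa, of t] \<alpha> by auto
      then show "\<bar>signed_power p (u \<alpha> t)\<bar> \<le> \<alpha> powr p"
        using p by (simp add: signed_power_nonneg_eq powr_mono2)
    qed (use z in simp)
    also have "\<dots> \<le> \<alpha> powr p * r1" using z r by (intro mult_left_mono) auto
    finally have "\<bar>u' \<alpha> z\<bar> * r \<le> (\<alpha> powr p * r1) * r1" using r r1 by (intro mult_mono) auto
    also have "\<dots> = \<alpha> / 4"
    proof -
      have "\<alpha> powr p * (\<alpha> powr ((1 - p) / 2) * \<alpha> powr ((1 - p) / 2)) = \<alpha>"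
        using \<alpha> by (simp flip: powr_add)
      then show ?thesis by (simp add: r1_def mult.assoc)
    qed
    finally have "\<bar>u' \<alpha> z * r\<bar> \<le> \<alpha> / 4" using r by (simp add: abs_mult)
    moreover have "u \<alpha> 0 = \<alpha>" using sa by (simp add: sol_def)
    ultimately show ?thesis using z(3) \<alpha> by simp
  qed
  have "(r1 / 4) ^ n * (\<alpha> / 2) powr (p + \<gamma>) \<le> (r1 / 2) * ((r1 / 4) ^ (n - 1) * (\<alpha> / 2) powr (p + \<gamma>))"
  proof -
    have "n = Suc (n - 1)" using n3 by simp
    then have "(r1 / 4) ^ n = (r1 / 4) * (r1 / 4) ^ (n - 1)" by (metis power_Suc)
    then have "(r1 / 4) ^ n * (\<alpha> / 2) powr (p + \<gamma>) = (r1 / 4) * ((r1 / 4) ^ (n - 1) * (\<alpha> / 2) powr (p + \<gamma>))"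
      by (simp only: mult.assoc)
    also have "\<dots> \<le> (r1 / 2) * ((r1 / 4) ^ (n - 1) * (\<alpha> / 2) powr (p + \<gamma>))"
      using r1 by (intro mult_right_mono) auto
    finally show ?thesis .
  qed
  also have "\<dots> = integral {r1/2..r1} (\<lambda>_. (r1 / 4) ^ (n - 1) * (\<alpha> / 2) powr (p + \<gamma>))"
    using r1 by simp
  also have "\<dots> \<le> integral {r1/2..r1} (\<lambda>r. w r * (u \<alpha> r powr (p + \<gamma>) * (cutoff r)\<^sup>2))"
  proof (rule integral_le)
    show "(\<lambda>r. w r * (u \<alpha> r powr (p + \<gamma>) * (cutoff r)\<^sup>2)) integrable_on {r1/2..r1}"
      using r1 by (intro integrable_continuous_real continuous_on_mult continuous_on_power cutoff_cont wc upcont \<alpha>) auto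
    fix r assume r: "r \<in> {r1/2..r1}"
    then have r': "0 < r" "r \<le> r1" "r \<le> r0" "r \<le> 1" using r1 by auto
    have "(r1 / 4) ^ (n - 1) \<le> (r / 2) ^ (n - 1)" using r r1 by (intro power_mono) auto
    also have "\<dots> \<le> w r" using r0(2)[of r] r' by simp
    finally have "(r1 / 4) ^ (n - 1) * (\<alpha> / 2) powr (p + \<gamma>) \<le> w r * u \<alpha> r powr (p + \<gamma>)"
      using half[OF r'(1,2)] \<alpha> p \<gamma>(1) r1 w_pos[OF r'(1)] by (intro mult_mono powr_mono2) auto
    then show "(r1 / 4) ^ (n - 1) * (\<alpha> / 2) powr (p + \<gamma>) \<le> w r * (u \<alpha> r powr (p + \<gamma>) * (cutoff r)\<^sup>2)"
      using r' by (simp add: cutoff_1)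
  qed (rule integrable_const_ivl)
  also have "\<dots> \<le> integral {0..2} (\<lambda>r. w r * (u \<alpha> r powr (p + \<gamma>) * (cutoff r)\<^sup>2))"
  proof (rule integral_subset_le)
    show "(\<lambda>r. w r * (u \<alpha> r powr (p + \<gamma>) * (cutoff r)\<^sup>2)) integrable_on {r1/2..r1}"
      using r1 by (intro integrable_continuous_real continuous_on_mult continuous_on_power cutoff_cont wc upcont \<alpha>) auto
    show "(\<lambda>r. w r * (u \<alpha> r powr (p + \<gamma>) * (cutoff r)\<^sup>2)) integrable_on {0..2}"
      by (intro integrable_continuous_real continuous_on_mult continuous_on_power cutoff_cont wc upcont \<alpha>) auto
    show "\<forall>r\<in>{0..2}. 0 \<le> w r * (u \<alpha> r powr (p + \<gamma>) * (cutoff r)\<^sup>2)" using wn by simp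
  qed (use r1 in auto)
  also have "\<dots> \<le> K" by (rule upper[OF \<alpha>])
  finally have le: "(r1 / 4) ^ n * (\<alpha> / 2) powr (p + \<gamma>) \<le> K" .
  have "(r1 / 4) ^ n * (\<alpha> / 2) powr (p + \<gamma>) = \<alpha> powr \<delta> / (8 ^ n * 2 powr (p + \<gamma>))"
  proof -
    have "(\<alpha> powr ((1 - p) / 2)) ^ n * \<alpha> powr (p + \<gamma>) = \<alpha> powr \<delta>"
      using \<alpha> by (simp add: \<delta>_def powr_add[symmetric] powr_realpow[symmetric] powr_powr field_simps)
    moreover have "(r1 / 4) ^ n = (\<alpha> powr ((1 - p) / 2)) ^ n / 8 ^ n" by (simp add: r1_def power_divide)
    moreover have "(\<alpha> / 2) powr (p + \<gamma>) = \<alpha> powr (p + \<gamma>) / 2 powr (p + \<gamma>)" using \<alpha> by (simp add: powr_divide)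
    ultimately show ?thesis by simp
  qed
  with le have "\<alpha> powr \<delta> \<le> K * (8 ^ n * 2 powr (p + \<gamma>))" by (simp add: divide_le_eq)
  then show False using \<alpha>X by (simp add: X_def)
qed

text \<open>
  Near the pole \<open>w' > 0\<close> and \<open>u' < 0\<close>, hence the dissipation is strict there.
\<close>
lemma energy_less:
  assumes s: "sol p \<alpha> u u'" and \<alpha>: "\<alpha> > 0" and \<rho>: "\<rho> > 0"
  shows "energy p u u' \<rho> < \<alpha> powr (p + 1) / (p + 1)"
proof -
  have u0: "u 0 = \<alpha>" "u' 0 = 0" using s by (simp_all add: sol_def)
  have "\<forall>\<^sub>F x in at 0 within {0..}. 0 < u x"
    using sol_cont[OF s] \<alpha> u0 by (intro order_tendstoD(1)[of u "u 0"]) (auto simp: continuous_on_def)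
  moreover have "\<forall>\<^sub>F x in at 0 within {0..}. 0 < \<psi>' x"
  proof (rule order_tendstoD(1))
    show "(\<psi>' \<longlongrightarrow> \<psi>' 0) (at 0 within {0..})" using \<psi>'_cont unfolding continuous_on_def by simp
  qed (simp add: \<psi>_0)
  ultimately have "\<forall>\<^sub>F x in at 0 within {0..}. 0 < u x \<and> 0 < \<psi>' x" by eventually_elim simp
  then obtain d where d: "d > 0" "\<And>x. x \<in> {0..} \<Longrightarrow> x \<noteq> 0 \<Longrightarrow> dist x 0 < d \<Longrightarrow> 0 < u x \<and> 0 < \<psi>' x"
    unfolding eventually_at by blast
  define r where "r = min \<rho> (d / 2)"
  have r: "r > 0" "r \<le> \<rho>" "r < d" using d \<rho> by (auto simp: r_def)
  have near: "0 < u x" "0 < \<psi>' x" if "0 < x" "x \<le> r" for x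
    using d(2)[of x] that r by (auto simp: dist_real_def)
  have neg: "u' x < 0" if x: "0 < x" "x \<le> r" for x
  proof -
    have "integral {0..x} (\<lambda>_. 0) < integral {0..x} (\<lambda>t. w t * signed_power p (u t))"
    proof (rule integral_less_real)
      show "continuous_on {0..x} (\<lambda>t. w t * signed_power p (u t))"
        by (intro continuous_on_mult continuous_on_subset[OF w_cont] continuous_on_subset[OF sol_signed_power_cont[OF s]]) auto
      show "0 < w t * signed_power p (u t)" if "t \<in> {0<..<x}" for t
        using w_pos[of t] near[of t] that x by (simp add: signed_power_def)
    qed (use x in auto)
    then have "w x * u' x < 0" using sol_flux[OF s, of x] x by simp
    then show ?thesis using w_pos[OF x(1)] by (simp add: mult_less_0_iff)
  qed
  have "energy p u u' r < energy p u u' 0"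
  proof (rule DERIV_neg_imp_decreasing_open[OF r(1)])
    fix x assume x: "0 < x" "x < r"
    have "w' x > 0" unfolding w'_def using near[of x] x \<psi>_pos[OF x(1)] n3 by simp
    then have "- (w' x / w x) * (u' x)\<^sup>2 < 0" using w_pos[OF x(1)] neg[of x] x by simp
    then show "\<exists>y. (energy p u u' has_real_derivative y) (at x) \<and> y < 0"
      using energy_DERIV[OF s x(1)] by blast
  qed (use r in \<open>auto intro: continuous_on_subset[OF energy_cont[OF s]]\<close>)
  also have "energy p u u' 0 = \<alpha> powr (p + 1) / (p + 1)" using u0 \<alpha> by (simp add: energy_def)
  finally show ?thesis using energy_antimono[OF s less_imp_le[OF r(1)] r(2)] by simp
qed

lemma sol_dependence_tendsto:
  assumes s: "\<And>k. sol p (a k) (u k) (u' k)" and t: "sol p \<alpha> v v'" and a: "a \<longlonglongrightarrow> \<alpha>" and r: "r \<ge> 0"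
  shows "(\<lambda>k. u k r) \<longlonglongrightarrow> v r" "(\<lambda>k. u' k r) \<longlonglongrightarrow> v' r"
proof -
  obtain A where A: "\<And>k. \<bar>a k\<bar> \<le> A" using convergent_imp_Bseq[OF convergentI[OF a]] by (auto simp: Bseq_def)
  have A\<alpha>: "\<bar>\<alpha>\<bar> \<le> A" by (rule LIMSEQ_le_const2[OF tendsto_rabs[OF a]]) (use A in auto)
  define E where "E = exp ((1 + p * A powr (p - 1)) * r)"
  have lim: "(\<lambda>k. (a k - \<alpha>)\<^sup>2 * E) \<longlonglongrightarrow> 0"
    by (rule tendsto_eq_intros a refl | simp)+
  have b: "(u k r - v r)\<^sup>2 + (u' k r - v' r)\<^sup>2 \<le> (a k - \<alpha>)\<^sup>2 * E" for k
    unfolding E_def by (rule sol_continuous_dependence[OF s t A A\<alpha> r])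
  have "(\<lambda>k. (u k r - v r)\<^sup>2) \<longlonglongrightarrow> 0"
  proof (rule Lim_null_comparison[OF always_eventually lim], rule allI)
    show "norm ((u k r - v r)\<^sup>2) \<le> (a k - \<alpha>)\<^sup>2 * E" for k
      using b[of k] zero_le_power2[of "u' k r - v' r"]
      unfolding real_norm_def abs_of_nonneg[OF zero_le_power2] by linarith
  qed
  then have "(\<lambda>k. u k r - v r) \<longlonglongrightarrow> 0" by simp
  then show "(\<lambda>k. u k r) \<longlonglongrightarrow> v r" by (simp add: LIM_zero_iff)
  have "(\<lambda>k. (u' k r - v' r)\<^sup>2) \<longlonglongrightarrow> 0"
  proof (rule Lim_null_comparison[OF always_eventually lim], rule allI)
    show "norm ((u' k r - v' r)\<^sup>2) \<le> (a k - \<alpha>)\<^sup>2 * E" for k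
      using b[of k] zero_le_power2[of "u k r - v r"]
      unfolding real_norm_def abs_of_nonneg[OF zero_le_power2] by linarith
  qed
  then have "(\<lambda>k. u' k r - v' r) \<longlonglongrightarrow> 0" by simp
  then show "(\<lambda>k. u' k r) \<longlonglongrightarrow> v' r" by (simp add: LIM_zero_iff)
qed

lemma ratio_bounded: obtains C where "C > 0" "\<And>r. r \<ge> 0 \<Longrightarrow> (ratio r)\<^sup>2 \<le> C\<^sup>2"
proof -
  obtain C where C: "C > 0" "\<And>r. r \<ge> 0 \<Longrightarrow> V r \<le> C * w r" by (rule V_le_w) (rule that)
  have "(ratio r)\<^sup>2 \<le> C\<^sup>2" if r: "r \<ge> 0" for r
  proof (rule power_mono)
    show "ratio r \<le> C"
      using C(2)[OF r] C(1) w_pos[of r] r by (cases "r = 0") (auto simp: ratio_def divide_le_eq)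
  qed (rule ratio_bounds(1)[OF r])
  then show ?thesis using that C(1) by blast
qed

text \<open>
  For \<open>\<alpha>\<close> slightly above the threshold \<open>a\<close> the potential of \<open>u\<^sub>\<alpha>\<close> is at most \<open>l + t\<close> on \<open>[0,\<rho>]\<close> and at most
  \<open>l - d\<close> beyond \<open>\<rho>\<close>, the latter by the energy. The potential \<open>h\<close> from the Hardy inequality is at least
  \<open>l + 1\<close> on \<open>[0,\<rho>]\<close> and at least \<open>-K\<close> everywhere, so \<open>(1 - t) l + t h\<close> dominates for small \<open>t\<close>.
\<close>
lemma stable_above_spectral_threshold:
  fixes u u' :: "real \<Rightarrow> real \<Rightarrow> real"
  assumes n: "n = CARD('n::finite)" and p: "p > 1"
    and s: "\<And>\<alpha>. \<alpha> \<ge> 0 \<Longrightarrow> sol p \<alpha> (u \<alpha>) (u' \<alpha>)"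
    and l: "l > 0" "form_bounded TYPE('n) (\<lambda>_. l)"
  shows "\<exists>\<alpha>. \<alpha> > (l / p) powr (1 / (p - 1)) \<and> form_bounded TYPE('n) (potential p (u \<alpha>))"
proof -
  define a where "a = (l / p) powr (1 / (p - 1))"
  have a: "a > 0" using l p by (simp add: a_def)
  have pa: "p * a powr (p - 1) = l" using l p by (simp add: a_def powr_powr)
  have sa: "sol p a (u a) (u' a)" using s a by simp
  obtain C where C: "C > 0" "\<And>r. r \<ge> 0 \<Longrightarrow> (ratio r)\<^sup>2 \<le> C\<^sup>2" by (rule ratio_bounded) (rule that)
  \<comment> \<open>Since \<open>V/w \<le> r\<close>, the Hardy potential stays above \<open>c/2 = l + 1\<close> as long as \<open>c\<^sup>2 r\<^sup>2 \<le> l + 1\<close>.\<close>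
  define c where "c = 2 * (l + 1)"
  define \<rho> where "\<rho> = sqrt (l + 1) / c"
  define K where "K = c\<^sup>2 * C\<^sup>2"
  have c: "c > 0" using l by (simp add: c_def)
  have \<rho>: "\<rho> > 0" using l c by (simp add: \<rho>_def)
  have K: "K \<ge> 0" by (simp add: K_def)
  have c\<rho>: "c\<^sup>2 * \<rho>\<^sup>2 = l + 1" using c l by (simp add: \<rho>_def power_divide)
  define h where "h = (\<lambda>r. c - c\<^sup>2 * (ratio r)\<^sup>2)"
  have h_in: "h r \<ge> l + 1" if "0 \<le> r" "r \<le> \<rho>" for r
  proof -
    have "(ratio r)\<^sup>2 \<le> \<rho>\<^sup>2" using ratio_bounds[OF that(1)] that by (intro power_mono) auto
    then have "c\<^sup>2 * (ratio r)\<^sup>2 \<le> l + 1" unfolding c\<rho>[symmetric] by (intro mult_left_mono) auto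
    then show ?thesis by (simp add: h_def c_def)
  qed
  have h_out: "h r \<ge> - K" if "0 \<le> r" for r
  proof -
    have "c\<^sup>2 * (ratio r)\<^sup>2 \<le> K" unfolding K_def by (rule mult_left_mono[OF C(2)[OF that]]) simp
    then show ?thesis using c unfolding h_def by linarith
  qed
  \<comment> \<open>The energy at \<open>\<rho>\<close> is below the level of \<open>a\<close>; any \<open>e\<close> between confines nearby solutions to
    \<open>\<bar>u\<bar> \<le> b < a\<close> beyond \<open>\<rho>\<close>.\<close>
  define e0 where "e0 = a powr (p + 1) / (p + 1)"
  define e1 where "e1 = energy p (u a) (u' a) \<rho>"
  define e where "e = (e0 + e1) / 2"
  have e10: "e1 < e0" unfolding e1_def e0_def by (rule energy_less[OF sa a \<rho>])
  have e1n: "e1 \<ge> 0" unfolding e1_def energy_def using p by simp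
  have e: "e1 < e" "e < e0" "e > 0" using e10 e1n by (auto simp: e_def)
  define b where "b = ((p + 1) * e) powr (1 / (p + 1))"
  have b: "0 < b" "b < a"
  proof -
    show "0 < b" using e p by (simp add: b_def)
    have "(p + 1) * e < a powr (p + 1)" using e(2) p by (simp add: e0_def less_divide_eq mult.commute)
    then have "b < (a powr (p + 1)) powr (1 / (p + 1))"
      unfolding b_def using p e by (intro powr_less_mono2) auto
    then show "b < a" using p a by (simp add: powr_powr)
  qed
  define d where "d = l - p * b powr (p - 1)"
  have "b powr (p - 1) < a powr (p - 1)" using b p by (intro powr_less_mono2) auto
  then have d: "d > 0" using p by (simp add: d_def flip: pa)
  define t where "t = min 1 (d / (l + K))"
  have lK: "l + K > 0" using l K by simp
  have t: "0 < t" "t \<le> 1" using d lK by (auto simp: t_def)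
  have "t \<le> d / (l + K)" by (simp add: t_def)
  then have tK: "t * (l + K) \<le> d" using lK by (simp add: le_divide_eq)
  define al where "al = (\<lambda>k. a + inverse (real (Suc k)))"
  have al: "al \<longlonglongrightarrow> a" unfolding al_def using tendsto_add[OF tendsto_const LIMSEQ_inverse_real_of_nat, of a] by simp
  have al_pos: "al k > a" for k by (simp add: al_def)
  have sk: "sol p (al k) (u (al k)) (u' (al k))" for k using s al_pos[of k] a by simp
  have "(\<lambda>k. energy p (u (al k)) (u' (al k)) \<rho>) \<longlonglongrightarrow> e1"
  proof -
    have F: "isCont (\<lambda>x::real. \<bar>x\<bar> powr (p + 1) / (p + 1)) x" for x using abs_powr_DERIV[OF p] by (rule DERIV_isCont)
    have "(\<lambda>k. \<bar>u (al k) \<rho>\<bar> powr (p + 1) / (p + 1)) \<longlonglongrightarrow> \<bar>u a \<rho>\<bar> powr (p + 1) / (p + 1)"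
      by (rule isCont_tendsto_compose[OF F sol_dependence_tendsto(1)[OF sk sa al less_imp_le[OF \<rho>]]])
    moreover have "(\<lambda>k. (u' (al k) \<rho>)\<^sup>2 / 2) \<longlonglongrightarrow> (u' a \<rho>)\<^sup>2 / 2"
      by (intro tendsto_intros sol_dependence_tendsto(2)[OF sk sa al less_imp_le[OF \<rho>]]) simp
    ultimately show ?thesis unfolding e1_def energy_def by (rule tendsto_add[rotated])
  qed
  then have ev1: "\<forall>\<^sub>F k in sequentially. energy p (u (al k)) (u' (al k)) \<rho> < e" using e(1) by (rule order_tendstoD(2))
  have "(\<lambda>k. p * al k powr (p - 1)) \<longlonglongrightarrow> p * a powr (p - 1)"
    using a by (intro tendsto_intros al) auto
  then have ev2: "\<forall>\<^sub>F k in sequentially. p * al k powr (p - 1) < l + t"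
    unfolding pa using t by (intro order_tendstoD(2)) auto
  have "\<forall>\<^sub>F k in sequentially. energy p (u (al k)) (u' (al k)) \<rho> < e \<and> p * al k powr (p - 1) < l + t"
    using ev1 ev2 by eventually_elim simp
  then obtain k where k: "energy p (u (al k)) (u' (al k)) \<rho> < e" "p * al k powr (p - 1) < l + t"
    by (auto dest: eventually_happens)
  have hc: "continuous_on {0..} h" unfolding h_def by (intro continuous_intros ratio_cont)
  have fb: "form_bounded TYPE('n) (\<lambda>r. (1 - t) * l + t * h r)"
    by (rule form_bounded_convex[OF n l(2) _ continuous_on_const hc])
      (use form_bounded_Hardy[OF n] t in \<open>auto simp: h_def\<close>)
  have "form_bounded TYPE('n) (potential p (u (al k)))"
  proof (rule form_bounded_mono[OF n fb potential_cont[OF sk]])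
    show "continuous_on {0..} (\<lambda>r. (1 - t) * l + t * h r)" by (intro continuous_intros hc)
    fix r :: real assume r: "r \<ge> 0"
    show "potential p (u (al k)) r \<le> (1 - t) * l + t * h r"
    proof (cases "r \<le> \<rho>")
      case True
      have "\<bar>u (al k) r\<bar> \<le> al k" using sol_abs_le[OF sk r, of k] al_pos[of k] a by simp
      then have "potential p (u (al k)) r \<le> p * al k powr (p - 1)"
        unfolding potential_def using p by (intro mult_left_mono powr_mono2) auto
      also have "\<dots> \<le> (1 - t) * l + t * (l + 1)" using k(2) by (simp add: algebra_simps)
      also have "\<dots> \<le> (1 - t) * l + t * h r" using h_in[OF r True] t by (intro add_left_mono mult_left_mono) auto
      finally show ?thesis .
    next
      case False
      have "\<bar>u (al k) r\<bar> powr (p + 1) / (p + 1) \<le> energy p (u (al k)) (u' (al k)) r" by (simp add: energy_def)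
      also have "\<dots> \<le> energy p (u (al k)) (u' (al k)) \<rho>"
        by (rule energy_antimono[OF sk]) (use \<rho> False in auto)
      also have "\<dots> < e" by (rule k(1))
      finally have "\<bar>u (al k) r\<bar> powr (p + 1) \<le> (p + 1) * e" using p by (simp add: divide_less_eq mult.commute)
      then have "(\<bar>u (al k) r\<bar> powr (p + 1)) powr (1 / (p + 1)) \<le> b"
        unfolding b_def using p by (intro powr_mono2) auto
      then have "\<bar>u (al k) r\<bar> \<le> b" using p by (simp add: powr_powr)
      then have "potential p (u (al k)) r \<le> p * b powr (p - 1)"
        unfolding potential_def using p by (intro mult_left_mono powr_mono2) auto
      also have "\<dots> = l - d" by (simp add: d_def)
      also have "\<dots> \<le> l - t * (l + K)" using tK by simp
      also have "\<dots> = (1 - t) * l + t * (- K)" by (simp add: algebra_simps)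
      also have "\<dots> \<le> (1 - t) * l + t * h r" using h_out[OF r] t by (intro add_left_mono mult_left_mono) auto
      finally show ?thesis .
    qed
  qed
  then show ?thesis using al_pos[of k] unfolding a_def by blast
qed

section \<open>The stability threshold\<close>

lemma dirichlet_energy_nonneg:
  fixes \<phi> :: "real^'n::finite \<Rightarrow> real"
  assumes "n = CARD('n)" "\<phi> \<in> test_functions"
  shows "dirichlet \<phi> \<ge> 0"
  unfolding dirichlet_energy_eq[OF assms]
  by (intro Bochner_Integration.integral_nonneg mult_nonneg_nonneg grad_sq_nonneg less_imp_le[OF dens_pos]) simp

lemma form_bounded_bottom_spectrum:
  assumes n: "n = CARD('n::finite)"
  shows "form_bounded TYPE('n) (\<lambda>_. bottom_spectrum (model_metric \<psi> :: 'n metric))"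
  unfolding form_bounded_def
proof
  fix \<phi> :: "real^'n \<Rightarrow> real" assume \<phi>: "\<phi> \<in> test_functions"
  define I where "I = (LINT x|vol. (\<phi> x)\<^sup>2)"
  define l where "l = bottom_spectrum (model_metric \<psi> :: 'n metric)"
  have nn: "dirichlet f / (LINT x|vol. (f x)\<^sup>2) \<ge> 0"
    if "f \<in> test_functions" for f :: "real^'n \<Rightarrow> real"
    by (intro divide_nonneg_nonneg dirichlet_energy_nonneg n that Bochner_Integration.integral_nonneg) simp
  have I: "I \<ge> 0" unfolding I_def by (rule Bochner_Integration.integral_nonneg) simp
  have "l * I \<le> dirichlet \<phi>"
  proof (cases "I = 0")
    case True
    then show ?thesis using dirichlet_energy_nonneg[OF n \<phi>] by simp
  next
    case False
    then have "\<phi> \<noteq> (\<lambda>x. 0)" by (auto simp: I_def)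
    then have "l \<le> dirichlet \<phi> / I"
      unfolding l_def bottom_spectrum_def I_def using \<phi> nn
      by (intro cINF_lower bdd_belowI2[where m = 0]) auto
    then show ?thesis using False I by (simp add: le_divide_eq)
  qed
  then show "(LINT x|vol. bottom_spectrum (model_metric \<psi> :: 'n metric) * (\<phi> x)\<^sup>2)
      \<le> dirichlet \<phi>"
    by (simp add: l_def I_def)
qed

text \<open>
  A potential that is not form bounded provides a nonzero test function, so the infimum is taken over a
  nonempty set.
\<close>
lemma bottom_spectrum_nonneg:
  assumes n: "n = CARD('n::finite)" and q: "\<not> form_bounded TYPE('n) q"
  shows "bottom_spectrum (model_metric \<psi> :: 'n metric) \<ge> 0"
proof -
  obtain \<phi> :: "real^'n \<Rightarrow> real" where \<phi>: "\<phi> \<in> test_functions"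
    "\<not> (LINT x|vol. q (norm x) * (\<phi> x)\<^sup>2) \<le> dirichlet \<phi>"
    using q unfolding form_bounded_def by blast
  have "\<phi> \<noteq> (\<lambda>x. 0)"
  proof
    assume "\<phi> = (\<lambda>x. 0)"
    then have "(LINT x|vol. q (norm x) * (\<phi> x)\<^sup>2) = 0" by simp
    then show False using \<phi> dirichlet_energy_nonneg[OF n \<phi>(1)] by simp
  qed
  then have "test_functions - {\<lambda>x::real^'n. 0} \<noteq> {}" using \<phi>(1) by blast
  then show ?thesis unfolding bottom_spectrum_def
    by (intro cINF_greatest divide_nonneg_nonneg dirichlet_energy_nonneg n Bochner_Integration.integral_nonneg) auto
qed

lemma form_bounded_positive_constant:
  assumes n: "n = CARD('n::finite)"
  shows "\<exists>c>0. form_bounded TYPE('n) (\<lambda>_. c)"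
proof -
  obtain C where C: "C > 0" "\<And>r. r \<ge> 0 \<Longrightarrow> (ratio r)\<^sup>2 \<le> C\<^sup>2" by (rule ratio_bounded) (rule that)
  define c where "c = 1 / (2 * C\<^sup>2)"
  have c: "c > 0" "c\<^sup>2 * C\<^sup>2 = c / 2" using C(1) by (simp_all add: c_def power2_eq_square)
  have "form_bounded TYPE('n) (\<lambda>_. c / 2)"
  proof (rule form_bounded_mono[OF n form_bounded_Hardy[OF n, of c] continuous_on_const])
    show "continuous_on {0..} (\<lambda>r. c - c\<^sup>2 * (ratio r)\<^sup>2)" by (intro continuous_intros ratio_cont)
    show "c / 2 \<le> c - c\<^sup>2 * (ratio r)\<^sup>2" if "r \<ge> 0" for r
      using mult_left_mono[OF C(2)[OF that], of "c\<^sup>2"] c by simp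
  qed
  then show ?thesis using c by (intro exI[of _ "c / 2"]) simp
qed

text \<open>
  The threshold is the supremum of the stable initial values. The bottom of the spectrum is replaced by
  its maximum with a positive constant potential that is form bounded, so that the existence of a
  stable solution above the spectral threshold applies.
\<close>
lemma stability_threshold:
  fixes u u' :: "real \<Rightarrow> real \<Rightarrow> real"
  assumes n: "n = CARD('n::finite)"
    and np: "(3 \<le> n \<and> n \<le> 10 \<and> 1 < p) \<or> (11 \<le> n \<and> 1 < p \<and> p < joseph_lundgren_exponent n)"
    and s: "\<And>\<alpha>. \<alpha> \<ge> 0 \<Longrightarrow> sol p \<alpha> (u \<alpha>) (u' \<alpha>)"
  defines "st \<equiv> \<lambda>\<alpha>. form_bounded TYPE('n) (potential p (u \<alpha>))"
  shows "\<exists>a>0. (\<forall>\<alpha>\<in>{0..a}. st \<alpha>) \<and> (\<forall>\<alpha>>a. \<not> st \<alpha>) \<and>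
    a > (bottom_spectrum (model_metric \<psi> :: 'n metric) / p) powr (1 / (p - 1))"
proof -
  have p: "p > 1" using np by auto
  have down: "st \<alpha>" if "st \<beta>" "0 \<le> \<alpha>" "\<alpha> \<le> \<beta>" for \<alpha> \<beta>
  proof -
    have "\<alpha> = \<beta> \<or> (\<alpha> = 0 \<and> \<alpha> < \<beta>) \<or> (0 < \<alpha> \<and> \<alpha> < \<beta>)" using that by auto
    then consider "\<alpha> = \<beta>" | "\<alpha> = 0" "\<alpha> < \<beta>" | "0 < \<alpha>" "\<alpha> < \<beta>" by blast
    then show ?thesis
    proof cases
      case 1
      then show ?thesis using that by simp
    next
      case 2
      have "potential p (u \<alpha>) r \<le> potential p (u \<beta>) r" if "r \<ge> 0" for r
        using sol_abs_le[OF s[of 0] that] 2 p by (simp add: potential_def)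
      then show ?thesis using form_bounded_mono[OF n] that 2 s unfolding st_def
        by (metis potential_cont order_trans)
    next
      case 3
      have "potential p (u \<alpha>) r \<le> potential p (u \<beta>) r" if r: "r \<ge> 0" for r
      proof -
        have "0 < u \<alpha> r \<and> u \<alpha> r < u \<beta> r"
          using stable_solutions_ordered[OF n _ s[of \<alpha>] s[of \<beta>] 3 r] \<open>st \<beta>\<close> 3 by (simp add: st_def)
        then show ?thesis unfolding potential_def using p by (intro mult_left_mono powr_mono2) auto
      qed
      then show ?thesis using form_bounded_mono[OF n] that 3 s unfolding st_def
        by (metis potential_cont order_trans)
    qed
  qed
  obtain M where M: "M > 0" "\<not> st M"
    using stable_solutions_bounded[OF n np s] unfolding st_def by blast
  define S where "S = {\<alpha>. 0 \<le> \<alpha> \<and> st \<alpha>}"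
  have bdd: "bdd_above S"
  proof (rule bdd_aboveI)
    fix x assume "x \<in> S"
    then show "x \<le> M" using down[of x M] M unfolding S_def by (cases "x \<le> M") auto
  qed
  define l1 where "l1 = bottom_spectrum (model_metric \<psi> :: 'n metric)"
  have l1: "l1 \<ge> 0" unfolding l1_def using bottom_spectrum_nonneg[OF n] M(2) unfolding st_def by blast
  obtain c where c: "c > 0" "form_bounded TYPE('n) (\<lambda>_. c)" using form_bounded_positive_constant[OF n] by blast
  define l where "l = max l1 c"
  have "form_bounded TYPE('n) (\<lambda>_. l)"
    using c(2) form_bounded_bottom_spectrum[OF n] by (simp add: l_def l1_def max_def)
  moreover have "l > 0" using c(1) by (simp add: l_def)
  ultimately obtain \<alpha>1 where \<alpha>1: "\<alpha>1 > (l / p) powr (1 / (p - 1))" "st \<alpha>1"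
    using stable_above_spectral_threshold[OF n p s, of l] unfolding st_def by blast
  have "\<alpha>1 > 0" using \<alpha>1(1) by (smt (verit) powr_ge_zero)
  then have \<alpha>1S: "\<alpha>1 \<in> S" using \<alpha>1 by (simp add: S_def)
  define a where "a = Sup S"
  have a1: "\<alpha>1 \<le> a" unfolding a_def using \<alpha>1S bdd by (rule cSup_upper)
  have a0: "a > 0" using a1 \<open>\<alpha>1 > 0\<close> by simp
  have "st a" unfolding st_def
  proof (rule form_bounded_limit[OF n])
    show "continuous_on {0..} (potential p (u a))" using potential_cont[OF s] a0 by simp
    fix R e :: real assume e: "e > 0"
    obtain d where d: "d > 0" "\<And>\<alpha> \<beta> u u' v v' r. sol p \<alpha> u u' \<Longrightarrow> sol p \<beta> v v' \<Longrightarrow> \<bar>\<alpha>\<bar> \<le> a \<Longrightarrow> \<bar>\<beta>\<bar> \<le> a \<Longrightarrow> \<bar>\<alpha> - \<beta>\<bar> < d \<Longrightarrow>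
       0 \<le> r \<Longrightarrow> r \<le> R \<Longrightarrow> \<bar>potential p u r - potential p v r\<bar> < e"
      by (rule potential_continuous_dependence[OF p e less_imp_le[OF a0], of R]) (rule that; blast)
    have "a - d < Sup S" using d(1) by (simp add: a_def)
    then obtain \<alpha> where \<alpha>: "\<alpha> \<in> S" "a - d < \<alpha>" using less_cSupD[of S "a - d"] \<alpha>1S by blast
    have \<alpha>a: "\<alpha> \<le> a" unfolding a_def using \<alpha>(1) bdd by (rule cSup_upper)
    have \<alpha>0: "\<alpha> \<ge> 0" "st \<alpha>" using \<alpha>(1) by (auto simp: S_def)
    have "potential p (u a) r \<le> potential p (u \<alpha>) r + e" if "0 \<le> r" "r \<le> R" for r
      using d(2)[OF s[of a] s[OF \<alpha>0(1)], of r] that \<alpha>0 \<alpha>a \<alpha>(2) a0 by simp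
    then show "\<exists>q'. form_bounded TYPE('n) q' \<and> continuous_on {0..} q' \<and> (\<forall>r. 0 \<le> r \<longrightarrow> r \<le> R \<longrightarrow> potential p (u a) r \<le> q' r + e)"
      using \<alpha>0(2) potential_cont[OF s[OF \<alpha>0(1)]] unfolding st_def by blast
  qed
  then have "\<forall>\<alpha>\<in>{0..a}. st \<alpha>" using down by auto
  moreover have "\<forall>\<alpha>>a. \<not> st \<alpha>"
  proof (intro allI impI notI)
    fix \<alpha> assume "\<alpha> > a" "st \<alpha>"
    then have "\<alpha> \<in> S" using a0 by (simp add: S_def)
    then have "\<alpha> \<le> a" unfolding a_def using bdd by (rule cSup_upper)
    then show False using \<open>\<alpha> > a\<close> by simp
  qed
  moreover have "(l1 / p) powr (1 / (p - 1)) \<le> (l / p) powr (1 / (p - 1))"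
    using l1 p by (intro powr_mono2 divide_right_mono) (auto simp: l_def)
  then have "(l1 / p) powr (1 / (p - 1)) < a" using \<alpha>1(1) a1 by simp
  ultimately show ?thesis using a0 unfolding l1_def by blast
qed

end

theorem theorem2p11:
  fixes \<psi> \<psi>' \<psi>'' :: "real \<Rightarrow> real" and p :: real and n :: nat
    and g :: "'n::finite metric" and u :: "real \<Rightarrow> real \<Rightarrow> real" and l :: ereal
  assumes n: "n = CARD('n)"
    and np: "(3 \<le> n \<and> n \<le> 10 \<and> 1 < p) \<or>
             (11 \<le> n \<and> 1 < p \<and> p < joseph_lundgren_exponent n)"
    and \<psi>_deriv: "\<And>r. r \<ge> 0 \<Longrightarrow> (\<psi> has_real_derivative \<psi>' r) (at r within {0..})"
    and \<psi>'_deriv: "\<And>r. r \<ge> 0 \<Longrightarrow> (\<psi>' has_real_derivative \<psi>'' r) (at r within {0..})"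
    and \<psi>''_cont: "continuous_on {0..} \<psi>''"
    and \<psi>_pos: "\<And>r. r > 0 \<Longrightarrow> \<psi> r > 0"
    and \<psi>_0: "\<psi> 0 = 0" "\<psi>'' 0 = 0" "\<psi>' 0 = 1"
    and \<psi>'_nonneg: "\<And>r. r > 0 \<Longrightarrow> \<psi>' r \<ge> 0"
    and l: "l = Liminf at_top (\<lambda>r. ereal (\<psi>' r / \<psi> r))" "l > 0"
    and g: "g = model_metric \<psi>"
    and u: "\<And>\<alpha>. \<alpha> \<ge> 0 \<Longrightarrow> radial_solution \<psi> n p \<alpha> (u \<alpha>)"
  shows "\<exists>\<alpha>\<^sub>0>0.
           (\<forall>\<alpha>\<in>{0..\<alpha>\<^sub>0}. is_stable g p (\<lambda>x. u \<alpha> (norm x))) \<and>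
           (\<forall>\<alpha>>\<alpha>\<^sub>0. \<not> is_stable g p (\<lambda>x. u \<alpha> (norm x))) \<and>
           \<alpha>\<^sub>0 \<ge> (bottom_spectrum g / p) powr (1 / (p - 1)) \<and>
           (Limsup at_top (\<lambda>r. ereal (\<psi>' r / \<psi> r)) < \<infinity> \<or>
            (l = \<infinity> \<and>
             deriv (\<lambda>r. ln (\<psi>' r / \<psi> r)) \<in> O[at_top](\<lambda>_. 1) \<and>
             (\<exists>r\<^sub>0\<ge>0. (\<forall>r\<ge>r\<^sub>0. \<psi>' r > 0) \<and>
                      \<not> set_integrable lborel {r\<^sub>0<..} (\<lambda>r. \<psi> r / \<psi>' r)))
            \<longrightarrow> \<alpha>\<^sub>0 > (bottom_spectrum g / p) powr (1 / (p - 1)))"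
proof -
  interpret radial_weight \<psi> \<psi>' n
  proof
    show "3 \<le> n" using np by auto
    show "continuous_on {0..} \<psi>'" using \<psi>'_deriv by (auto intro!: DERIV_continuous_on)
    show "0 \<le> \<psi>' r" if "0 \<le> r" for r using \<psi>'_nonneg[of r] \<psi>_0 that by (cases "r = 0") auto
    have "\<exists>c. 0 < ereal c \<and> ereal c < l" by (rule ereal_dense2[OF l(2)])
    then obtain c where c: "0 < c" "ereal c < Liminf at_top (\<lambda>r. ereal (\<psi>' r / \<psi> r))" using l(1) by auto
    have "\<forall>\<^sub>F r in at_top. ereal c < ereal (\<psi>' r / \<psi> r)" by (rule less_LiminfD[OF c(2)])
    then obtain R where R: "\<And>r. r \<ge> R \<Longrightarrow> c < \<psi>' r / \<psi> r" by (auto simp: eventually_at_top_linorder)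
    have "c * \<psi> r \<le> \<psi>' r" if "r \<ge> max R 1" for r
      using R[of r] \<psi>_pos[of r] that by (simp add: pos_less_divide_eq)
    then show "\<exists>c>0. \<exists>R. \<forall>r\<ge>R. c * \<psi> r \<le> \<psi>' r" using c(1) by blast
  qed (use \<psi>_deriv \<psi>_pos \<psi>_0 in auto)
  have p: "p > 1" using np by auto
  have "\<exists>u'. sol p \<alpha> (u \<alpha>) u'" if "\<alpha> \<ge> 0" for \<alpha>
    by (rule radial_solution_imp_sol[OF u[OF that] p]) blast
  then obtain u' where u': "\<And>\<alpha>. \<alpha> \<ge> 0 \<Longrightarrow> sol p \<alpha> (u \<alpha>) (u' \<alpha>)" by metis
  obtain a where a: "a > 0" "\<forall>\<alpha>\<in>{0..a}. form_bounded TYPE('n) (potential p (u \<alpha>))"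
    "\<forall>\<alpha>>a. \<not> form_bounded TYPE('n) (potential p (u \<alpha>))"
    "(bottom_spectrum (model_metric \<psi> :: 'n metric) / p) powr (1 / (p - 1)) < a"
    using stability_threshold[OF n np u'] by blast
  then show ?thesis
    unfolding g is_stable_iff_form_bounded by (intro exI[of _ a]) (simp add: less_imp_le)
qed

end
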